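(* a) Let $\Omega$ be an open set of $\mathbb{C}^p$, $p>1$, and $f=[(f_\varepsilon)_\varepsilon]\in\mathcal{G}_H(\Omega)$. (i) Assume that $f(x)=0$ in $\bar{\mathbb{C}}$ for every $x\in\Omega$. Then $f\equiv0$. (ii) Assume that $S\subset\Gamma=\gamma_1\times\cdots\times\gamma_p\subset\Omega$, where $\gamma_i$, $i=1,\dots,p$, are smooth curves in $\mathbb{C}$, has the property $\mathrm{meas}(S)>0$, where $\mathrm{meas}$ is the product of the length measures, and that $f(x)=0$ in $\bar{\mathbb{C}}$ for every $x\in S$. Then $f\equiv0$. (iii) Assume that $\mathcal{A}$ is a Lebesgue measurable subset of $\Omega$ whose Lebesgue measure is positive, and that $f(x)=0$ in $\bar{\mathbb{C}}$ for every $x\in\mathcal{A}$. Then $f\equiv0$. b) Let $\omega$ be an open set of $\mathbb{R}^d$, $d\in\mathbb{N}$, and $f=[(f_\varepsilon)_\varepsilon]\in\mathcal{G}_A(\omega)$. If $f(x)=0$ in $\bar{\mathbb{C}}$ for every $x\in\mathcal{A}$, where $\mathcal{A}\subset\omega$ is a Lebesgue measurable set of positive Lebesgue measure, then $f\equiv0$.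
   Context: For $\omega\subset\mathbb{R}^d$ open, $\mathcal{E}_M(\omega)$ is the set of nets $(f_\varepsilon)_{\varepsilon\in(0,1)}$ of smooth functions on $\omega$ such that for every compact $K\subset\omega$ and $\alpha\in\mathbb{N}_0^d$ there is $a\in\mathbb{R}$ with $\sup_{x\in K}|f_\varepsilon^{(\alpha)}(x)|=O(\varepsilon^a)$ as $\varepsilon\to0$; $\mathcal{N}(\omega)$ is the ideal of nets for which this holds for every $a\in\mathbb{R}$, every $K$ and every $\alpha$. The Colombeau algebra is $\mathcal{G}(\omega)=\mathcal{E}_M(\omega)/\mathcal{N}(\omega)$; the class of $(f_\varepsilon)_\varepsilon$ is $[(f_\varepsilon)_\varepsilon]$. Here $f\equiv0$ means $f=0$ in $\mathcal{G}(\Omega)$ (respectively $\mathcal{G}(\omega)$), i.e. the representing net is in $\mathcal{N}(\Omega)$ (respectively $\mathcal{N}(\omega)$). The ring of generalized complex numbers is $\bar{\mathbb{C}}=\mathcal{E}_M/\mathcal{N}_0$, where $\mathcal{E}_M$ consists of nets $(c_\varepsilon)_\varepsilon\in\mathbb{C}^{(0,1)}$ with $|c_\varepsilon|=O(\varepsilon^a)$ for some $a\in\mathbb{R}$ and $\mathcal{N}_0$ of those with $|c_\varepsilon|=O(\varepsilon^a)$ for all $a\in\mathbb{R}$. For a classical point $x$, the value of $f=[(f_\varepsilon)_\varepsilon]$ is $f(x)=[(f_\varepsilon(x))_\varepsilon]\in\bar{\mathbb{C}}$. For $\Omega\subset\mathbb{C}^p\equiv\mathbb{R}^{2p}$ open,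 $\mathcal{G}_H(\Omega)$ is the set of holomorphic generalized functions: $f\in\mathcal{G}(\Omega)$ with $\bar\partial_{z_i}f=0$ in $\mathcal{G}(\Omega)$, $i=1,\dots,p$, i.e. $\left(\frac12(\partial_{x_i}+\sqrt{-1}\,\partial_{y_i})f_\varepsilon\right)_\varepsilon\in\mathcal{N}(\Omega)$. $\mathcal{G}_A(\omega)$: $f\in\mathcal{G}(\omega)$ is real analytic at $x_0\in\omega$ if there are an open ball $B=B(x_0,r)\subset\omega$ and $(g_\varepsilon)_\varepsilon\in\mathcal{E}_M(B)$ with $f|_B=[(g_\varepsilon)_\varepsilon]$ in $\mathcal{G}(B)$ and constants $\eta>0$, $a>0$, $\varepsilon_0\in(0,1)$ such that $\sup_{x\in B}|g_\varepsilon^{(\alpha)}(x)|\le\eta^{|\alpha|+1}\alpha!\,\varepsilon^{-a}$ for $0<\varepsilon<\varepsilon_0$, $\alpha\in\mathbb{N}_0^d$. $f\in\mathcal{G}_A(\omega)$ if it is real analytic at each point of $\omega$.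
   Formalization: In a)(ii), a)(iii) and b) the open set Ω (resp. ω) is additionally assumed connected; without this the claims fail, e.g. for f equal to 0 on one component and 1 on another. Part a)(i) is for every open Ω. *)

theory Defs
  imports "HOL-Analysis.Analysis" "HOL-Library.Landau_Symbols"
begin

subsection \<open>Partial derivatives and smooth functions\<close>

text \<open>
  The ambient space is a Euclidean space, with coordinates given by its standard basis. For
  \<^typ>\<open>real^'d\<close> these are the usual coordinates; the standard basis of \<^typ>\<open>complex^'p\<close>
  consists of the vectors \<^term>\<open>axis i 1\<close> and \<^term>\<open>axis i \<i>\<close>, i.e. of the
  directions \<open>x_i\<close> and \<open>y_i\<close> under the identification of \<open>C^p\<close> with \<open>R^(2p)\<close>.
\<close>

definition partial :: "'a::euclidean_space \<Rightarrow> ('a \<Rightarrow> complex) \<Rightarrow> 'a \<Rightarrow> complex" where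
  "partial b f x = vector_derivative (\<lambda>t. f (x + t *\<^sub>R b)) (at 0)"

text \<open>
  On an open set the following is the class of infinitely differentiable functions: every iterated
  partial derivative is differentiable, hence continuous.
\<close>

definition smooth_on :: "'a::euclidean_space set \<Rightarrow> ('a \<Rightarrow> complex) \<Rightarrow> bool" where
  "smooth_on \<omega> f \<longleftrightarrow> (\<forall>bs. set bs \<subseteq> Basis \<longrightarrow> foldr partial bs f differentiable_on \<omega>)"

text \<open>
  A multi-index is a function \<open>\<alpha> :: 'a \<Rightarrow> nat\<close>, of which only the values on the basis matter.
  The basis is enumerated in a fixed but arbitrary order; for smooth functions on an open set
  the order of differentiation is irrelevant.
\<close>

definition basis_list :: "'a::euclidean_space list" where
  "basis_list = (SOME bs. distinct bs \<and> set bs = Basis)"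

definition mderiv :: "('a::euclidean_space \<Rightarrow> nat) \<Rightarrow> ('a \<Rightarrow> complex) \<Rightarrow> 'a \<Rightarrow> complex" where
  "mderiv \<alpha> = foldr (\<lambda>b. partial b ^^ \<alpha> b) basis_list"

definition mi_length :: "('a::euclidean_space \<Rightarrow> nat) \<Rightarrow> nat" where
  "mi_length \<alpha> = (\<Sum>b\<in>Basis. \<alpha> b)"

definition mi_fact :: "('a::euclidean_space \<Rightarrow> nat) \<Rightarrow> real" where
  "mi_fact \<alpha> = (\<Prod>b\<in>Basis. fact (\<alpha> b))"

definition dbar :: "'p \<Rightarrow> (complex^'p::finite \<Rightarrow> complex) \<Rightarrow> complex^'p \<Rightarrow> complex" where
  "dbar i f x = (1/2) * (partial (axis i 1) f x + \<i> * partial (axis i \<i>) f x)"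


subsection \<open>The Colombeau algebra\<close>

text \<open>
  A net \<open>(f\<^sub>\<epsilon>)\<close> is a function of \<open>\<epsilon> :: real\<close>, of which only the values for
  \<open>\<epsilon> \<in> {0<..<1}\<close> matter. The empty compact set is excluded in \<open>sup_growth\<close> because the
  supremum of the empty set of reals is an unspecified number.
\<close>

type_synonym 'a net = "real \<Rightarrow> 'a \<Rightarrow> complex"

definition smooth_nets :: "'a::euclidean_space set \<Rightarrow> 'a net set" where
  "smooth_nets \<omega> = {f. \<forall>\<epsilon>\<in>{0<..<1}. smooth_on \<omega> (f \<epsilon>)}"

definition sup_growth :: "'a::euclidean_space net \<Rightarrow> 'a set \<Rightarrow> ('a \<Rightarrow> nat) \<Rightarrow> real \<Rightarrow> bool" where
  "sup_growth f K \<alpha> a \<longleftrightarrow>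
     (\<lambda>\<epsilon>. SUP x\<in>K. norm (mderiv \<alpha> (f \<epsilon>) x)) \<in> O[at_right 0](\<lambda>\<epsilon>. \<epsilon> powr a)"

definition moderate :: "'a::euclidean_space set \<Rightarrow> 'a net set" where
  "moderate \<omega> = {f \<in> smooth_nets \<omega>.
     \<forall>K \<alpha>. compact K \<and> K \<noteq> {} \<and> K \<subseteq> \<omega> \<longrightarrow> (\<exists>a. sup_growth f K \<alpha> a)}"

definition negligible_nets :: "'a::euclidean_space set \<Rightarrow> 'a net set" where
  "negligible_nets \<omega> = {f \<in> smooth_nets \<omega>.
     \<forall>K \<alpha>. compact K \<and> K \<noteq> {} \<and> K \<subseteq> \<omega> \<longrightarrow> (\<forall>a. sup_growth f K \<alpha> a)}"

definition colombeau_rel :: "'a::euclidean_space set \<Rightarrow> ('a net \<times> 'a net) set" where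
  "colombeau_rel \<omega> = {(f, g). f \<in> moderate \<omega> \<and> g \<in> moderate \<omega> \<and>
     (\<lambda>\<epsilon> x. f \<epsilon> x - g \<epsilon> x) \<in> negligible_nets \<omega>}"

definition colombeau :: "'a::euclidean_space set \<Rightarrow> 'a net set set" where
  "colombeau \<omega> = moderate \<omega> // colombeau_rel \<omega>"

definition gfun :: "'a::euclidean_space set \<Rightarrow> 'a net \<Rightarrow> 'a net set" where
  "gfun \<omega> f = colombeau_rel \<omega> `` {f}"


subsection \<open>Generalized complex numbers\<close>

definition moderate_numbers :: "(real \<Rightarrow> complex) set" where
  "moderate_numbers = {c. \<exists>a. (\<lambda>\<epsilon>. norm (c \<epsilon>)) \<in> O[at_right 0](\<lambda>\<epsilon>. \<epsilon> powr a)}"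

definition negligible_numbers :: "(real \<Rightarrow> complex) set" where
  "negligible_numbers = {c. \<forall>a. (\<lambda>\<epsilon>. norm (c \<epsilon>)) \<in> O[at_right 0](\<lambda>\<epsilon>. \<epsilon> powr a)}"

definition gcomplex_rel :: "((real \<Rightarrow> complex) \<times> (real \<Rightarrow> complex)) set" where
  "gcomplex_rel = {(c, d). c \<in> moderate_numbers \<and> d \<in> moderate_numbers \<and>
     (\<lambda>\<epsilon>. c \<epsilon> - d \<epsilon>) \<in> negligible_numbers}"

definition gcomplex :: "(real \<Rightarrow> complex) \<Rightarrow> (real \<Rightarrow> complex) set" where
  "gcomplex c = gcomplex_rel `` {c}"

text \<open>
  The value at a classical point, for a generalized function given by a representing net; the
  result depends on its class only.
\<close>

definition gvalue :: "'a net \<Rightarrow> 'a \<Rightarrow> (real \<Rightarrow> complex) set" where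
  "gvalue f x = gcomplex (\<lambda>\<epsilon>. f \<epsilon> x)"


subsection \<open>Holomorphic and real analytic generalized functions\<close>

definition gen_holomorphic :: "(complex^'p::finite) set \<Rightarrow> (complex^'p) net set set" where
  "gen_holomorphic \<Omega> = {F \<in> colombeau \<Omega>. \<exists>f \<in> moderate \<Omega>. F = gfun \<Omega> f \<and>
     (\<forall>i. gfun \<Omega> (\<lambda>\<epsilon>. dbar i (f \<epsilon>)) = gfun \<Omega> (\<lambda>\<epsilon> x. 0))}"

definition gen_analytic_at :: "'a::euclidean_space set \<Rightarrow> 'a net \<Rightarrow> 'a \<Rightarrow> bool" where
  "gen_analytic_at \<omega> f x\<^sub>0 \<longleftrightarrow>
     (\<exists>r>0. ball x\<^sub>0 r \<subseteq> \<omega> \<and>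
       (\<exists>g \<in> moderate (ball x\<^sub>0 r). gfun (ball x\<^sub>0 r) f = gfun (ball x\<^sub>0 r) g \<and>
         (\<exists>\<eta>>0. \<exists>a>0. \<exists>\<epsilon>\<^sub>0\<in>{0<..<1}. \<forall>\<epsilon> \<alpha>. 0 < \<epsilon> \<and> \<epsilon> < \<epsilon>\<^sub>0 \<longrightarrow>
           (\<forall>x\<in>ball x\<^sub>0 r. norm (mderiv \<alpha> (g \<epsilon>) x)
              \<le> \<eta> ^ (mi_length \<alpha> + 1) * mi_fact \<alpha> * \<epsilon> powr (- a)))))"

definition gen_analytic :: "'a::euclidean_space set \<Rightarrow> 'a net set set" where
  "gen_analytic \<omega> = {F \<in> colombeau \<omega>. \<exists>f \<in> moderate \<omega>. F = gfun \<omega> f \<and>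
     (\<forall>x\<in>\<omega>. gen_analytic_at \<omega> f x)}"


subsection \<open>Smooth curves and length measure\<close>

text \<open>
  A smooth curve is parametrized by an arbitrary real interval, bounded or not, with a continuous
  and nowhere vanishing derivative; this includes all regular infinitely differentiable curves. It
  may have self-intersections. Differentiability is two-sided also at endpoints lying in the
  interval, which is no restriction: continue the parametrization affinely beyond them.
\<close>

definition smooth_curve :: "real set \<Rightarrow> (real \<Rightarrow> complex) \<Rightarrow> bool" where
  "smooth_curve J \<gamma> \<longleftrightarrow> is_interval J \<and> \<gamma> C1_differentiable_on J \<and>
     (\<forall>t\<in>J. vector_derivative \<gamma> (at t) \<noteq> 0)"

definition arc_length :: "real set \<Rightarrow> (real \<Rightarrow> complex) \<Rightarrow> real measure" where
  "arc_length J \<gamma> =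
     density (restrict_space lborel J) (\<lambda>t. ennreal (norm (vector_derivative \<gamma> (at t))))"

text \<open>
  The product of the length measures of the curves, as a measure on \<open>C^p\<close>. The product is taken
  in the parameters and then transported by the product of the parametrizations: arc length is
  sigma-finite there, while its image in the plane need not be if a curve
  returns to the same points infinitely often. When the images are sigma-finite the two products
  agree. The measure is completed, so that its measurable sets include the null sets.
\<close>

definition product_length ::
  "('p::finite \<Rightarrow> real set) \<Rightarrow> ('p \<Rightarrow> real \<Rightarrow> complex) \<Rightarrow> (complex^'p) measure" where
  "product_length J \<gamma> = completion
     (distr (PiM UNIV (\<lambda>i. arc_length (J i) (\<gamma> i))) borel (\<lambda>t. \<chi> i. \<gamma> i (t i)))"

definition product_curve ::
  "('p::finite \<Rightarrow> real set) \<Rightarrow> ('p \<Rightarrow> real \<Rightarrow> complex) \<Rightarrow> (complex^'p) set" where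
  "product_curve J \<gamma> = {z. \<forall>i. z $ i \<in> \<gamma> i ` J i}"

end

theory Submission
  imports Defs "HOL-Complex_Analysis.Conformal_Mappings"
begin

text \<open>
  Pointwise negligibility on a set of positive measure is uniform, for every power of \<open>\<epsilon>\<close> at once,
  on a subset \<open>E\<close> of positive measure. The heart of the matter is a Remez type inequality in
  one complex variable: \<open>n\<close> points of a set of length at least \<open>c\<close> can be chosen with mutual distances
  at least \<open>c \<bar>i - j\<bar> / (2n)\<close>, so Lagrange interpolation at them bounds a holomorphic
  function \<open>h\<close> with \<open>\<bar>h\<bar> \<le> M\<close> that is at most \<open>\<delta>\<close> at these points by \<open>M / 2^n + L^n \<delta>\<close>, where \<open>L\<close>
  depends on \<open>c\<close> only. For \<open>M\<close> a negative power of \<open>\<epsilon>\<close>, \<open>\<delta>\<close> an arbitrarily high one and \<open>n\<close> proportional to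
  \<open>log (1/\<epsilon>)\<close> this is again negligible. By Fubini's theorem negligibility spreads from \<open>E\<close> one
  coordinate at a time to a full neighbourhood, and then by connectedness everywhere. A net
  with negligible \<open>\<partial>\<close>-bar derivatives is treated through its Cauchy transform in a single
  variable, from which it differs by a negligible amount; a real analytic net through the power series
  extension along lines. Derivatives of a moderate net whose values are negligible are negligible by
  Landau's inequality.
\<close>

subsection \<open>A Remez type inequality for holomorphic functions\<close>

text \<open>For a fixed \<epsilon> the function \<open>f \<epsilon>\<close> need not vanish at a
  single point of the given set, so the identity theorem says nothing; a quantitative version is
  needed that loses no more than a power of \<epsilon>. In the bound M / 2^n + L^n \<delta> the
  degree n is free, and the size of L is irrelevant as long as L is one constant for all slices and
  all small \<epsilon>. This requirement shapes the proof. Slices of positive length are not enough: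
  their lengths must exceed one common c, which is obtained by restricting to a superlevel set of
  the slice length, again of positive measure in one coordinate less. The uniform subset E comes
  from an Egorov argument that treats countably many powers together. Sets of real dimension one
  suffice in each complex variable because interpolation asks only for separated points, not for
  area; this lets curves, real lines in C^p and lines in R^d be handled alike. For curves everything
  takes place in the parameters: near a parameter each curve stretches distances by at least a fixed
  factor, although globally it may cross itself.\<close>

text \<open>The zeros are divided out one at a time; the quotient has a removable singularity,
  filled in by the derivative.\<close>

lemma holomorphic_factor_zeros:
  fixes h :: "complex \<Rightarrow> complex"
  assumes "finite X" "open S" "h holomorphic_on S" "X \<subseteq> S" "\<And>x. x \<in> X \<Longrightarrow> h x = 0"
  shows "\<exists>q. q holomorphic_on S \<and> (\<forall>z\<in>S. h z = q z * (\<Prod>x\<in>X. z - x))"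
  using assms(1,4,5)
proof (induction X)
  case empty
  then show ?case using assms(3) by auto
next
  case (insert x X)
  then obtain q where q: "q holomorphic_on S" "\<And>z. z \<in> S \<Longrightarrow> h z = q z * (\<Prod>x\<in>X. z - x)"
    by auto
  \<comment> \<open>Since x lies outside X, the zero of h at x must come from the cofactor
    q.\<close>
  have "(\<Prod>y\<in>X. x - y) \<noteq> 0"
    using insert.hyps by (auto simp: prod_zero_iff)
  then have q0: "q x = 0"
    using q(2)[of x] insert.prems by auto
  define q' where "q' = (\<lambda>z. if z = x then deriv q x else q z / (z - x))"
  have "q' holomorphic_on S"
    by (rule pole_theorem_open_0[OF q(1) assms(2), where a = x])
       (auto simp: q'_def q0)
  moreover have "q z = q' z * (z - x)" if "z \<in> S" for z
    by (auto simp: q'_def q0)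
  ultimately show ?case
    using q(2) insert.hyps by (intro exI[of _ q']) (auto simp: mult_ac)
qed

text \<open>The i nodes below i contribute i!, the n - 1 - i nodes above it contribute (n - 1 - i)!.
  Up to scaling this is the denominator of a Lagrange basis polynomial at equally spaced
  nodes.\<close>

lemma prod_abs_diff:
  assumes "i < n"
  shows "(\<Prod>j\<in>{..<n}-{i}. \<bar>real i - real j\<bar>) = fact i * fact (n - 1 - i)"
proof -
  have "Suc i \<le> n" using assms by simp
  then show ?thesis
  proof (induction n rule: dec_induct)
    case base
    have "{..<Suc i} - {i} = {0..<i}" by auto
    moreover have "(\<Prod>j=0..<i. \<bar>real i - real j\<bar>) = (\<Prod>j=0..<i. real (i - j))"
      by (intro prod.cong) auto
    moreover have "\<dots> = fact i"
      by (simp add: fact_prod_rev)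
    ultimately show ?case by simp
  next
    case (step n)
    have "{..<Suc n} - {i} = insert n ({..<n} - {i})" using step by auto
    then have "(\<Prod>j\<in>{..<Suc n}-{i}. \<bar>real i - real j\<bar>) = \<bar>real i - real n\<bar> * (fact i * fact (n - 1 - i))"
      using step by simp
    also have "\<bar>real i - real n\<bar> = real (n - i)" using step by simp
    also have "real (n - i) * (fact i * fact (n - 1 - i)) = (fact i * fact (n - i) :: real)"
    proof -
      have "n - i = Suc (n - 1 - i)" using step by simp
      then show ?thesis by (metis fact_Suc mult.left_commute of_nat_mult of_nat_fact)
    qed
    finally show ?case by simp
  qed
qed

text \<open>One term of the exponential series; with \<open>x = n\<close> it serves as a crude
  Stirling bound for the factorial from below.\<close>

lemma power_div_fact_le_exp:
  fixes x :: real
  assumes "0 \<le> x"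
  shows "x ^ m / fact m \<le> exp x"
proof -
  have "(\<Sum>k\<in>{m}. inverse (fact k) * x ^ k) \<le> exp x"
    unfolding exp_def scaleR_conv_of_real
    by (rule order_trans[OF sum_le_suminf])
       (use assms summable_exp[of x] in \<open>auto simp: divide_inverse mult_ac\<close>)
  then show ?thesis by (simp add: field_simps)
qed

text \<open>The product is compared with that of equally spaced nodes at distance \<kappa>/n. With m
  = n - 1, the binomial bound gives i! (m - i)! \<ge> m! / 2^m, and m! \<ge> n^m / e^n cancels the
  factor n^m of the spacing, so the loss is only exponential in n.\<close>

lemma prod_separated_lower:
  fixes X :: "nat \<Rightarrow> complex"
  assumes "0 < \<kappa>" "i < n"
    and sep: "\<And>i j. i < n \<Longrightarrow> j < n \<Longrightarrow> \<kappa> * \<bar>real i - real j\<bar> / n \<le> dist (X i) (X j)"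
  shows "\<kappa> ^ (n - 1) / (2 ^ (n - 1) * exp n) \<le> (\<Prod>j\<in>{..<n}-{i}. norm (X i - X j))"
proof -
  define m where "m = n - 1"
  have n: "n > 0" and im: "i \<le> m" using assms by (auto simp: m_def)
  have "(\<Prod>j\<in>{..<n}-{i}. \<kappa> / n * \<bar>real i - real j\<bar>) \<le> (\<Prod>j\<in>{..<n}-{i}. norm (X i - X j))"
  proof (rule prod_mono)
    fix j assume "j \<in> {..<n} - {i}"
    then show "0 \<le> \<kappa> / n * \<bar>real i - real j\<bar> \<and> \<kappa> / n * \<bar>real i - real j\<bar> \<le> norm (X i - X j)"
      using sep[of i j] assms by (simp add: dist_norm)
  qed
  also have "(\<Prod>j\<in>{..<n}-{i}. \<kappa> / n * \<bar>real i - real j\<bar>) = (\<kappa> / n) ^ m * (fact i * fact (m - i))"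
    unfolding prod.distrib prod_abs_diff[OF assms(2)] using assms(2) by (simp add: m_def)
  finally have 1: "(\<kappa> / n) ^ m * (fact i * fact (m - i)) \<le> (\<Prod>j\<in>{..<n}-{i}. norm (X i - X j))" .
  have "real (m choose i) \<le> 2 ^ m"
    using binomial_le_pow2[of m i] by (metis of_nat_le_iff of_nat_numeral of_nat_power)
  moreover have "real (m choose i) = fact m / (fact i * fact (m - i))"
    using binomial_fact[OF im, where 'a = real] .
  ultimately have "fact m / 2 ^ m \<le> (fact i * fact (m - i) :: real)"
    by (simp add: field_simps)
  moreover have "real n ^ m / exp n \<le> fact m"
    using power_div_fact_le_exp[of n m] by (simp add: field_simps)
  ultimately have "real n ^ m / exp n / 2 ^ m \<le> (fact i * fact (m - i) :: real)"
    by (smt (verit) divide_right_mono zero_le_power)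
  then have "(\<kappa> / n) ^ m * (real n ^ m / exp n / 2 ^ m) \<le> (\<kappa> / n) ^ m * (fact i * fact (m - i))"
    using assms(1) by (intro mult_left_mono) auto
  moreover have "(\<kappa> / n) ^ m * (real n ^ m / exp n / 2 ^ m) = \<kappa> ^ m / (2 ^ m * exp n)"
    using n by (simp add: power_divide field_simps)
  ultimately show ?thesis using 1 by (simp add: m_def)
qed

text \<open>Per node, a Lagrange factor has numerator at most 6\<rho> and denominator about
  \<kappa>/2 in the geometric mean, up to a factor e: this gives e and 12\<rho>/\<kappa>. The
  summand 1 keeps the base at least 1, and 4 = 2 * 2 absorbs the number n of summands and one final
  doubling.\<close>

definition remez_const :: "real \<Rightarrow> real \<Rightarrow> real" where
  "remez_const \<rho> \<kappa> = 4 * exp 1 * (1 + 12 * \<rho> / \<kappa>)"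

lemma remez_const_ge_1:
  assumes "0 < \<rho>" "0 < \<kappa>"
  shows "1 \<le> remez_const \<rho> \<kappa>"
proof -
  have "1 * 1 \<le> 4 * exp 1 * (1 + 12 * \<rho> / \<kappa>)"
    using assms exp_ge_one_plus_x_over_n_power_n[of 1 1] by (intro mult_mono) auto
  then show ?thesis by (simp add: remez_const_def)
qed

text \<open>Let P be the Lagrange interpolant of h at the nodes. It is bounded by the node values
  times L^n. The difference h - P has all nodes as zeros, and the cofactor left after dividing them
  out is estimated by the maximum modulus principle on the circle of radius 5\<rho>. Points of that
  circle are at least 4\<rho> from every node, z is at most 2\<rho> away, so each node gains a
  factor 1/2.\<close>

lemma holomorphic_remez:
  fixes h :: "complex \<Rightarrow> complex" and X :: "nat \<Rightarrow> complex"
  assumes h: "h holomorphic_on ball c R" and hM: "\<And>w. w \<in> ball c R \<Longrightarrow> norm (h w) \<le> M"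
    and \<rho>: "0 < \<rho>" "5 * \<rho> < R" and \<kappa>: "0 < \<kappa>" and n: "0 < n"
    and X: "\<And>i. i < n \<Longrightarrow> X i \<in> cball c \<rho>" and h\<delta>: "\<And>i. i < n \<Longrightarrow> norm (h (X i)) \<le> \<delta>"
    and sep: "\<And>i j. i < n \<Longrightarrow> j < n \<Longrightarrow> \<kappa> * \<bar>real i - real j\<bar> / n \<le> dist (X i) (X j)"
    and z: "z \<in> cball c \<rho>"
  shows "norm (h z) \<le> M / 2 ^ n + remez_const \<rho> \<kappa> ^ n * \<delta>"
proof -
  have \<delta>0: "0 \<le> \<delta>" using h\<delta>[OF n] norm_ge_zero order_trans by blast
  have inj: "X i \<noteq> X j" if "i < n" "j < n" "i \<noteq> j" for i j
  proof
    assume "X i = X j"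
    then have "\<kappa> * \<bar>real i - real j\<bar> / n \<le> 0" using sep[OF that(1,2)] by simp
    moreover have "0 < \<kappa> * \<bar>real i - real j\<bar> / n" using that \<kappa> n by simp
    ultimately show False by linarith
  qed
  then have injX: "inj_on X {..<n}" by (auto simp: inj_on_def)
  define P where "P = (\<lambda>w. \<Sum>i<n. h (X i) * (\<Prod>j\<in>{..<n}-{i}. (w - X j) / (X i - X j)))"
  have holP: "P holomorphic_on ball c R"
    unfolding P_def by (intro holomorphic_intros) (auto simp: inj)
  have PX: "P (X k) = h (X k)" if "k < n" for k
  proof -
    have "(\<Prod>j\<in>{..<n}-{i}. (X k - X j) / (X i - X j)) = (if i = k then 1 else 0)" if "i < n" for i
    proof (cases "i = k")
      case True
      then show ?thesis using inj \<open>k < n\<close> by (auto intro!: prod.neutral)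
    next
      case False
      then have "\<exists>j\<in>{..<n}-{i}. (X k - X j) / (X i - X j) = 0"
        using \<open>k < n\<close> by (intro bexI[of _ k]) auto
      then show ?thesis using False by (subst prod_zero) auto
    qed
    then have "P (X k) = (\<Sum>i<n. h (X i) * (if i = k then 1 else 0))"
      unfolding P_def by (intro sum.cong) auto
    then show ?thesis using that by (simp add: if_distrib[of "\<lambda>x. _ * x"] sum.delta cong: if_cong)
  qed
  \<comment> \<open>This is already an n-th power, with half the base of \<open>remez_const\<close>;
    the missing 2 per node absorbs the doubling of \<open>L * \<delta>\<close> at the end.\<close>
  define L where "L = (2 * exp 1 * (1 + 12 * \<rho> / \<kappa>)) ^ n"
  have Pbound: "norm (P w) \<le> L * \<delta>" if w: "w \<in> cball c (5 * \<rho>)" for w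
  proof -
    have each: "norm (h (X i) * (\<Prod>j\<in>{..<n}-{i}. (w - X j) / (X i - X j))) \<le> \<delta> * (exp 1 * (1 + 12 * \<rho> / \<kappa>)) ^ n"
      if i: "i < n" for i
    proof -
      have "(\<Prod>j\<in>{..<n}-{i}. norm (w - X j)) \<le> (\<Prod>j\<in>{..<n}-{i}. 6 * \<rho>)"
      proof (rule prod_mono)
        fix j assume "j \<in> {..<n} - {i}"
        then have "dist (X j) c \<le> \<rho>" using X[of j] by (auto simp: dist_commute)
        moreover have "dist w c \<le> 5 * \<rho>" using w by (auto simp: dist_commute)
        ultimately show "0 \<le> norm (w - X j) \<and> norm (w - X j) \<le> 6 * \<rho>"
          using dist_triangle2[of w "X j" c] by (simp add: dist_norm)
      qed
      also have "\<dots> = (6 * \<rho>) ^ (n - 1)" using i by simp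
      finally have num: "(\<Prod>j\<in>{..<n}-{i}. norm (w - X j)) \<le> (6 * \<rho>) ^ (n - 1)" .
      have den: "\<kappa> ^ (n - 1) / (2 ^ (n - 1) * exp n) \<le> (\<Prod>j\<in>{..<n}-{i}. norm (X i - X j))"
        by (rule prod_separated_lower[OF \<kappa> i sep])
      have "norm (\<Prod>j\<in>{..<n}-{i}. (w - X j) / (X i - X j)) =
          (\<Prod>j\<in>{..<n}-{i}. norm (w - X j)) / (\<Prod>j\<in>{..<n}-{i}. norm (X i - X j))"
        by (simp add: norm_divide prod_norm[symmetric] prod_dividef)
      also have "\<dots> \<le> (6 * \<rho>) ^ (n - 1) / (\<kappa> ^ (n - 1) / (2 ^ (n - 1) * exp n))"
        using num den \<kappa> \<rho> by (intro frac_le) auto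
      also have "\<dots> = (12 * \<rho> / \<kappa>) ^ (n - 1) * exp n"
      proof -
        have "12 * \<rho> / \<kappa> = (6 * \<rho>) * 2 / \<kappa>" by simp
        then show ?thesis by (simp only: power_mult_distrib power_divide) (simp add: field_simps)
      qed
      \<comment> \<open>Adding 1 makes the base at least one, so the exponent n - 1 may be raised to
        n whether or not \<kappa> is small.\<close>
      also have "\<dots> \<le> (1 + 12 * \<rho> / \<kappa>) ^ n * exp n"
      proof -
        have "(12 * \<rho> / \<kappa>) ^ (n - 1) \<le> (1 + 12 * \<rho> / \<kappa>) ^ (n - 1)"
          using \<kappa> \<rho> by (intro power_mono) auto
        also have "\<dots> \<le> (1 + 12 * \<rho> / \<kappa>) ^ n"
          using \<kappa> \<rho> by (intro power_increasing) auto
        finally show ?thesis by (intro mult_right_mono) auto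
      qed
      also have "\<dots> = (exp 1 * (1 + 12 * \<rho> / \<kappa>)) ^ n"
        by (simp add: power_mult_distrib exp_of_nat_mult[symmetric])
      finally show ?thesis
        using h\<delta>[OF i] \<delta>0 unfolding norm_mult by (intro mult_mono) auto
    qed
    have "norm (P w) \<le> (\<Sum>i<n. \<delta> * (exp 1 * (1 + 12 * \<rho> / \<kappa>)) ^ n)"
      unfolding P_def by (rule order_trans[OF norm_sum sum_mono]) (use each in auto)
    also have "\<dots> = n * (\<delta> * (exp 1 * (1 + 12 * \<rho> / \<kappa>)) ^ n)" by simp
    also have "\<dots> \<le> 2 ^ n * (\<delta> * (exp 1 * (1 + 12 * \<rho> / \<kappa>)) ^ n)"
      using \<delta>0 \<kappa> \<rho> by (intro mult_right_mono less_imp_le[OF of_nat_less_two_power]) auto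
    also have "\<dots> = L * \<delta>" by (simp add: L_def power_mult_distrib)
    finally show ?thesis .
  qed
  have sub: "cball c (5 * \<rho>) \<subseteq> ball c R" using \<rho> by auto
  have XR: "X ` {..<n} \<subseteq> ball c R" using X \<rho> by fastforce
  have "(\<lambda>w. h w - P w) holomorphic_on ball c R"
    by (intro holomorphic_intros h holP)
  then have "\<exists>q. q holomorphic_on ball c R \<and>
      (\<forall>w\<in>ball c R. h w - P w = q w * (\<Prod>x\<in>X ` {..<n}. w - x))"
    by (rule holomorphic_factor_zeros[rotated 2]) (use XR in \<open>auto simp: PX\<close>)
  then obtain q where q: "q holomorphic_on ball c R"
    "\<And>w. w \<in> ball c R \<Longrightarrow> h w - P w = q w * (\<Prod>x\<in>X ` {..<n}. w - x)"
    by blast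
  have qP: "h w - P w = q w * (\<Prod>j<n. w - X j)" if "w \<in> ball c R" for w
    using q(2)[OF that] by (simp add: prod.reindex injX)
  have zR: "z \<in> cball c (5 * \<rho>)" using z \<rho> by auto
  have qbound: "norm (q z) \<le> (M + L * \<delta>) / (4 * \<rho>) ^ n"
  proof (rule maximum_modulus_frontier[of q "cball c (5 * \<rho>)"])
    show "q holomorphic_on interior (cball c (5 * \<rho>))"
      using q(1) sub by (meson holomorphic_on_subset interior_subset order_trans)
    show "continuous_on (closure (cball c (5 * \<rho>))) q"
      using q(1) sub by (metis closed_cball closure_closed holomorphic_on_imp_continuous_on holomorphic_on_subset)
    fix w assume "w \<in> frontier (cball c (5 * \<rho>))"
    then have w: "dist c w = 5 * \<rho>" using \<rho> by (simp add: frontier_cball)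
    then have wR: "w \<in> ball c R" and w5: "w \<in> cball c (5 * \<rho>)" using \<rho> by auto
    have "(\<Prod>j<n. 4 * \<rho>) \<le> (\<Prod>j<n. norm (w - X j))"
    proof (rule prod_mono)
      fix j assume "j \<in> {..<n}"
      then have "dist c (X j) \<le> \<rho>" using X[of j] by auto
      then show "0 \<le> 4 * \<rho> \<and> 4 * \<rho> \<le> norm (w - X j)"
        using w \<rho> dist_triangle[of c w "X j"] by (simp add: dist_norm norm_minus_commute)
    qed
    then have pl: "(4 * \<rho>) ^ n \<le> (\<Prod>j<n. norm (w - X j))" by simp
    have p4: "0 < (4 * \<rho>) ^ n" using \<rho> by simp
    have "norm (q w) * (4 * \<rho>) ^ n \<le> norm (q w) * (\<Prod>j<n. norm (w - X j))"
      using pl by (intro mult_left_mono) auto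
    also have "\<dots> = norm (h w - P w)" by (simp add: qP[OF wR] norm_mult prod_norm)
    also have "\<dots> \<le> M + L * \<delta>"
      using hM[OF wR] Pbound[OF w5] norm_triangle_ineq4[of "h w" "P w"] by linarith
    finally show "norm (q w) \<le> (M + L * \<delta>) / (4 * \<rho>) ^ n"
      using p4 by (simp add: field_simps)
  qed (use zR in auto)
  have "(\<Prod>j<n. norm (z - X j)) \<le> (\<Prod>j<n. 2 * \<rho>)"
  proof (rule prod_mono)
    fix j assume "j \<in> {..<n}"
    then have "dist c (X j) \<le> \<rho>" using X[of j] by auto
    then show "0 \<le> norm (z - X j) \<and> norm (z - X j) \<le> 2 * \<rho>"
      using z dist_triangle3[of z "X j" c] by (simp add: dist_norm)
  qed
  then have zprod: "(\<Prod>j<n. norm (z - X j)) \<le> (2 * \<rho>) ^ n" by simp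
  have L0: "0 \<le> L" using \<rho> \<kappa> by (simp add: L_def)
  have M0: "0 \<le> M" using hM[of c] \<rho> norm_ge_zero order_trans by (metis centre_in_ball less_trans mult_pos_pos zero_less_numeral)
  have "norm (h z - P z) = norm (q z) * (\<Prod>j<n. norm (z - X j))"
    using qP[of z] zR sub by (auto simp: norm_mult prod_norm)
  also have "\<dots> \<le> (M + L * \<delta>) / (4 * \<rho>) ^ n * (2 * \<rho>) ^ n"
    using qbound zprod L0 M0 \<delta>0 \<rho> by (intro mult_mono) (auto intro!: prod_nonneg)
  also have "\<dots> = (M + L * \<delta>) / 2 ^ n"
  proof -
    have "4 * \<rho> = 2 * (2 * \<rho>)" by simp
    then have "(4 * \<rho>) ^ n = 2 ^ n * (2 * \<rho>) ^ n" by (metis power_mult_distrib)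
    then show ?thesis using \<rho> by (simp add: field_simps)
  qed
  also have "\<dots> \<le> M / 2 ^ n + L * \<delta>"
  proof -
    have "L * \<delta> * 1 \<le> L * \<delta> * 2 ^ n"
      using L0 \<delta>0 by (intro mult_left_mono) auto
    then show ?thesis by (simp add: add_divide_distrib divide_le_eq)
  qed
  finally have "norm (h z) \<le> M / 2 ^ n + 2 * (L * \<delta>)"
    using Pbound[OF zR] norm_triangle_sub[of "h z" "P z"] by linarith
  also have "2 * (L * \<delta>) \<le> 2 ^ n * (L * \<delta>)"
    using n L0 \<delta>0 by (intro mult_right_mono self_le_power) auto
  also have "2 ^ n * (L * \<delta>) = remez_const \<rho> \<kappa> ^ n * \<delta>"
  proof -
    have "remez_const \<rho> \<kappa> = 2 * (2 * exp 1 * (1 + 12 * \<rho> / \<kappa>))" by (simp add: remez_const_def)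
    then show ?thesis unfolding L_def by (metis mult.assoc power_mult_distrib)
  qed
  finally show ?thesis by simp
qed

subsection \<open>The Cauchy transform of an almost holomorphic function\<close>

lemma has_vector_derivative_chain:
  assumes "(g has_derivative G) (at (f t))" "(f has_vector_derivative v) (at t within X)"
  shows "((\<lambda>t. g (f t)) has_vector_derivative G v) (at t within X)"
  using vector_derivative_diff_chain_within[OF assms(2) has_derivative_at_withinI[OF assms(1)]]
  by (simp add: o_def)

text \<open>The circle is contracted to z and the change of the Cauchy integral is measured by the
  d-bar derivative alone. For s = 1 the integral \<open>I s\<close> is the Cauchy integral, for s =
  0 it is 2 pi i g(z). Its derivative in s is bounded by 4 pi R d because the complex linear part of
  the differential of g integrates to zero around the contracted circle. Only integrals over circles
  occur, no area integral.\<close>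

lemma approx_cauchy_formula:
  fixes g gx gy :: "complex \<Rightarrow> complex"
  assumes der: "\<And>w. w \<in> cball c R \<Longrightarrow> (g has_derivative (\<lambda>v. Re v *\<^sub>R gx w + Im v *\<^sub>R gy w)) (at w)"
    and cgx: "continuous_on (cball c R) gx" and cgy: "continuous_on (cball c R) gy"
    and d: "\<And>w. w \<in> cball c R \<Longrightarrow> norm (1/2 * (gx w + \<i> * gy w)) \<le> d"
    and z: "z \<in> ball c R"
  shows "norm (g z - contour_integral (circlepath c R) (\<lambda>u. g u / (u - z)) / (2 * pi * \<i>)) \<le> 2 * R * d"
proof -
  have R: "0 < R" using z by (metis ball_eq_empty empty_iff not_le)
  have d0: "0 \<le> d"
    using d[of z] z by (meson ball_subset_cball norm_ge_zero order_trans subsetD)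
  define w where "w = (\<lambda>t::real. circlepath c R t - z)"
  define w' where "w' = (\<lambda>t::real. 2 * pi * \<i> * R * exp (2 * of_real pi * \<i> * t))"
  have w_eq: "w t = c + of_real R * exp (2 * of_real pi * \<i> * of_real t) - z" for t
    by (simp add: w_def circlepath)
  have w_der: "(w has_vector_derivative w' t) (at t within X)" for t X
    unfolding w_def w'_def using has_vector_derivative_circlepath[of c R t X]
    by (auto intro!: derivative_eq_intros)
  have dist_circ: "dist c (circlepath c R t) = R" for t
    using R by (simp add: circlepath dist_norm norm_mult)
  have w_nz: "w t \<noteq> 0" for t
    using dist_circ[of t] z by (auto simp: w_def)
  have nw': "norm (w' t) = 2 * pi * R" for t
    using R by (simp add: w'_def norm_mult)
  have cw: "continuous_on X w" and cw': "continuous_on X w'" for X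
    unfolding w_eq[abs_def] w'_def by (intro continuous_intros)+
  \<comment> \<open>For s running from 1 to 0 the loop \<open>q s\<close> shrinks from the circle to
    the point z.\<close>
  define q where "q = (\<lambda>s t. z + s *\<^sub>R w t)"
  have q_in: "q s t \<in> cball c R" if "s \<in> {0..1}" for s t
  proof -
    have "q s t = (1 - s) *\<^sub>R z + s *\<^sub>R circlepath c R t"
      by (simp add: q_def w_def algebra_simps)
    moreover have "circlepath c R t \<in> cball c R" using dist_circ[of t] by simp
    ultimately show ?thesis
      using that z convexD_alt[OF convex_cball[of c R], of z "circlepath c R t" s] by simp
  qed
  \<comment> \<open>\<open>D v s t\<close> is the differential of g at \<open>q s t\<close> applied
    to the vector v.\<close>
  define D where "D = (\<lambda>v s t. Re v *\<^sub>R gx (q s t) + Im v *\<^sub>R gy (q s t))"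
  have cq: "continuous_on X (\<lambda>(s, t). q s t)" for X
    unfolding q_def split_beta
    by (intro continuous_intros continuous_on_compose2[OF cw]) auto
  have cgq: "continuous_on ({0..1} \<times> X) (\<lambda>x. gx (q (fst x) (snd x)))"
            "continuous_on ({0..1} \<times> X) (\<lambda>x. gy (q (fst x) (snd x)))" for X
    by (rule continuous_on_compose2[OF cgx] continuous_on_compose2[OF cgy],
        use cq in \<open>simp add: split_beta\<close>, use q_in in auto)+
  have cg: "continuous_on (cball c R) g"
    by (rule has_derivative_continuous_on) (rule has_derivative_at_withinI[OF der])
  have cgq0: "continuous_on ({0..1} \<times> X) (\<lambda>x. g (q (fst x) (snd x)))" for X
    by (rule continuous_on_compose2[OF cg], use cq in \<open>simp add: split_beta\<close>, use q_in in auto)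
  define F where "F = (\<lambda>s t. g (q s t) * (w' t / w t))"
  define I where "I = (\<lambda>s. integral {0..1} (F s))"
  have cF: "continuous_on {0..1} (F s)" if "s \<in> {0..1}" for s
    unfolding F_def
    using that w_nz by (intro continuous_intros cw cw' continuous_on_compose2[OF cgq0[of UNIV], of _ "\<lambda>t. (s, t)", simplified]) auto
  have cfx: "continuous_on ({0..1} \<times> {0..1}) (\<lambda>(s, t). D (w t) s t * (w' t / w t))"
    unfolding D_def split_beta
    by (intro continuous_intros cgq continuous_on_compose2[OF cw] continuous_on_compose2[OF cw']) (auto simp: w_nz)
  define I' where "I' = (\<lambda>s. integral {0..1} (\<lambda>t. D (w t) s t * (w' t / w t)))"
  have I_der: "(I has_vector_derivative I' s) (at s within {0..1})"
    if s: "s \<in> {0..1}" for s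
    unfolding I_def I'_def cbox_interval[symmetric]
  proof (rule leibniz_rule_vector_derivative)
    fix s t :: real assume s: "s \<in> cbox 0 1"
    have "(g has_derivative (\<lambda>v. Re v *\<^sub>R gx (q s t) + Im v *\<^sub>R gy (q s t))) (at (q s t))"
      using der[OF q_in] s by auto
    moreover have "((\<lambda>s. q s t) has_vector_derivative w t) (at s within cbox 0 1)"
      unfolding q_def by (auto intro!: derivative_eq_intros)
    ultimately have "((\<lambda>s. g (q s t)) has_vector_derivative D (w t) s t) (at s within cbox 0 1)"
      unfolding D_def by (rule has_vector_derivative_chain)
    then show "((\<lambda>s. F s t) has_vector_derivative D (w t) s t * (w' t / w t)) (at s within cbox 0 1)"
      unfolding F_def by (rule has_vector_derivative_mult_left)
  next
    show "F s integrable_on cbox 0 1" if "s \<in> cbox 0 1" for s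
      using cF[of s] that by (auto intro: integrable_continuous_real)
  qed (use s cfx in auto)
  \<comment> \<open>Times s, the integrand is the t-derivative of g along a closed loop. Cancelling
    s requires s > 0, so the bound on \<open>I'\<close> is proved inside the open interval
    only.\<close>
  have circ0: "integral {0..1} (\<lambda>t. D (w' t) s t) = 0" if s: "0 < s" "s < 1" for s
  proof -
    have "integral {0..1} (\<lambda>t. s *\<^sub>R D (w' t) s t) = g (q s 1) - g (q s 0)"
    proof (rule integral_unique[OF fundamental_theorem_of_calculus])
      fix t :: real
      have "(g has_derivative (\<lambda>v. Re v *\<^sub>R gx (q s t) + Im v *\<^sub>R gy (q s t))) (at (q s t))"
        using der[OF q_in] s by auto
      moreover have "((\<lambda>t. q s t) has_vector_derivative s *\<^sub>R w' t) (at t within {0..1})"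
        unfolding q_def by (auto intro!: derivative_eq_intros w_der)
      ultimately show "((\<lambda>t. g (q s t)) has_vector_derivative s *\<^sub>R D (w' t) s t) (at t within {0..1})"
        using has_vector_derivative_chain[of g _ "\<lambda>t. q s t"] by (fastforce simp: D_def scaleR_add_right)
    qed simp
    moreover have "q s 1 = q s 0" by (simp add: q_def w_eq)
    ultimately have "s *\<^sub>R integral {0..1} (\<lambda>t. D (w' t) s t) = 0"
      by (simp only: integral_cmul) simp
    then show ?thesis using s by simp
  qed
  have I_bound: "norm (I' s) \<le> 4 * pi * R * d"
    if s: "0 < s" "s < 1" for s
  proof -
    have c1: "continuous_on {0..1} (\<lambda>t. D (w t) s t * (w' t / w t))"
    proof -
      have "continuous_on {0..1} (\<lambda>t. (s, t))" "(\<lambda>t. (s, t)) ` {0..1} \<subseteq> {0..1} \<times> {0..1}"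
        using s by (auto intro: continuous_intros)
      from continuous_on_compose2[OF cfx this] show ?thesis by simp
    qed
    have c2: "continuous_on {0..1} (\<lambda>t. D (w' t) s t)"
      unfolding D_def using s
      by (intro continuous_intros cw' continuous_on_compose2[OF cgq(1)[of UNIV], of _ "\<lambda>t. (s, t)", simplified]
             continuous_on_compose2[OF cgq(2)[of UNIV], of _ "\<lambda>t. (s, t)", simplified]) auto
    have "I' s =
        integral {0..1} (\<lambda>t. D (w t) s t * (w' t / w t) - D (w' t) s t)"
      using circ0[OF s] c1 c2 unfolding I'_def by (subst integral_diff) (auto intro: integrable_continuous_real)
    also have "norm \<dots> \<le> 4 * pi * R * d * (1 - 0)"
    proof (rule integral_bound)
      show "continuous_on {0..1} (\<lambda>t. D (w t) s t * (w' t / w t) - D (w' t) s t)"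
        by (intro continuous_on_diff c1 c2)
      fix t :: real assume "t \<in> {0..1}"
      define B where "B = 1/2 * (gx (q s t) + \<i> * gy (q s t))"
      define A where "A = 1/2 * (gx (q s t) - \<i> * gy (q s t))"
      \<comment> \<open>Splitting by the Wirtinger derivatives A and B. In the difference below the
        A-terms cancel, and each of the two remaining B-terms has norm at most d * 2 pi R.\<close>
      have Dv: "D v s t = A * v + B * cnj v" for v
        unfolding D_def A_def B_def by (simp add: complex_eq_iff field_simps)
      have "D (w t) s t * (w' t / w t) - D (w' t) s t = B * (cnj (w t) * (w' t / w t) - cnj (w' t))"
        unfolding Dv using w_nz[of t] by (simp add: field_simps)
      also have "norm \<dots> \<le> d * (norm (cnj (w t) * (w' t / w t)) + norm (cnj (w' t)))"
        unfolding norm_mult[of B] using d[of "q s t"] q_in[of s t] s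
        by (intro mult_mono norm_triangle_ineq4) (auto simp: B_def d0)
      also have "\<dots> = d * (4 * pi * R)"
        using w_nz[of t] nw'[of t] by (simp add: norm_mult norm_divide)
      finally show "norm (D (w t) s t * (w' t / w t) - D (w' t) s t) \<le> 4 * pi * R * d"
        by (simp add: mult_ac)
    qed simp
    finally show ?thesis by simp
  qed
  have contI: "continuous_on {0..1} I"
    using I_der has_vector_derivative_continuous by (fastforce simp: continuous_on_eq_continuous_within)
  \<comment> \<open>The mean value inequality asks for the derivative at interior s only, where its
    bound is known.\<close>
  obtain s where s: "0 < s" "s < 1" "norm (I 1 - I 0) \<le> norm ((1 - 0) *\<^sub>R I' s)"
  proof -
    have "\<exists>s\<in>{0<..<1}. norm (I 1 - I 0) \<le> norm ((1 - 0) *\<^sub>R I' s)"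
    proof (rule mvt_general[of 0 1 I "\<lambda>s x. x *\<^sub>R I' s"])
      fix s :: real assume s: "0 < s" "s < 1"
      then have "(I has_vector_derivative I' s) (at s within {0<..<1})"
        by (intro has_vector_derivative_within_subset[OF I_der]) auto
      then show "(I has_derivative (\<lambda>x. x *\<^sub>R I' s)) (at s)"
        using s by (simp add: has_vector_derivative_def at_within_open[of s "{0<..<1}"])
    qed (use contI in auto)
    then show ?thesis using that by auto
  qed
  then have diff: "norm (I 1 - I 0) \<le> 4 * pi * R * d"
    using I_bound by fastforce
  have ci: "contour_integral (circlepath c R) f = integral {0..1} (\<lambda>t. f (circlepath c R t) * w' t)" for f
    unfolding contour_integral_integral w'_def by (simp add: vector_derivative_circlepath)
  have I1: "I 1 = contour_integral (circlepath c R) (\<lambda>u. g u / (u - z))"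
    unfolding ci I_def F_def q_def by (simp add: w_def mult_ac)
  have "contour_integral (circlepath c R) (\<lambda>u. 1 / (u - z)) = 2 * of_real pi * \<i>"
    using Cauchy_integral_circlepath_simple[of "\<lambda>_. 1" c R z] z
    by (auto simp: dist_norm norm_minus_commute intro!: contour_integral_unique)
  then have "integral {0..1} (\<lambda>t. w' t / w t) = 2 * of_real pi * \<i>"
    unfolding ci by (simp add: w_def)
  then have "integral {0..1} (\<lambda>t. g z * (w' t / w t)) = g z * (2 * of_real pi * \<i>)"
    by (simp only: integral_mult_right)
  then have I0: "I 0 = g z * (2 * of_real pi * \<i>)"
    by (simp add: I_def F_def q_def)
  have "g z - I 1 / (2 * pi * \<i>) = (I 0 - I 1) / (2 * pi * \<i>)"
    unfolding I0 by (simp add: field_simps)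
  then have "norm (g z - I 1 / (2 * pi * \<i>)) = norm (I 1 - I 0) / (2 * pi)"
    by (simp add: norm_divide norm_mult norm_minus_commute)
  also have "\<dots> \<le> 4 * pi * R * d / (2 * pi)"
    by (intro divide_right_mono diff) auto
  finally show ?thesis unfolding I1 by simp
qed

text \<open>Differentiation under the integral sign gives holomorphy. On the half disc the kernel is
  at most 2/R, and the length 2 pi R against the factor 1/(2 pi) leaves the bound 2M. No bound up to
  the full radius can be expected from this estimate.\<close>

lemma cauchy_transform:
  fixes g :: "complex \<Rightarrow> complex"
  assumes R: "0 < R" and cg: "continuous_on (sphere c R) g" and gM: "\<And>u. u \<in> sphere c R \<Longrightarrow> norm (g u) \<le> M"
  defines "h \<equiv> \<lambda>z. contour_integral (circlepath c R) (\<lambda>u. g u / (u - z)) / (2 * pi * \<i>)"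
  shows "h holomorphic_on ball c R" and "\<And>z. z \<in> ball c (R/2) \<Longrightarrow> norm (h z) \<le> 2 * M"
proof -
  have "c + of_real R \<in> sphere c R" using R by (simp add: dist_norm)
  from order_trans[OF norm_ge_zero gM[OF this]] have M0: "0 \<le> M" .
  have int: "(\<lambda>u. g u / (u - z)) contour_integrable_on circlepath c R" if "z \<in> ball c R" for z
  proof (rule contour_integrable_continuous_circlepath)
    have "u \<noteq> z" if "u \<in> sphere c R" for u using that \<open>z \<in> ball c R\<close> by auto
    then have "continuous_on (sphere c R) (\<lambda>u. g u / (u - z))"
      by (intro continuous_on_divide continuous_on_diff continuous_on_id continuous_on_const cg) auto
    then show "continuous_on (path_image (circlepath c R)) (\<lambda>u. g u / (u - z))"
      using R by simp
  qed
  have "((\<lambda>z. contour_integral (circlepath c R) (\<lambda>u. g u / (u - z))) has_field_derivative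
      (of_nat 1 * contour_integral (circlepath c R) (\<lambda>u. g u / (u - z) ^ Suc 1))) (at z)"
    if "z \<in> ball c R" for z
  proof (rule Cauchy_next_derivative_circlepath(2)[OF _ _ _ that])
    show "((\<lambda>u. g u / (u - w) ^ 1) has_contour_integral
        contour_integral (circlepath c R) (\<lambda>u. g u / (u - w))) (circlepath c R)" if "w \<in> ball c R" for w
      using has_contour_integral_integral[OF int[OF that]] by simp
  qed (use cg R in auto)
  then show "h holomorphic_on ball c R"
    unfolding h_def
    by (intro holomorphic_on_divide holomorphic_on_const holomorphic_onI)
       (auto simp: field_differentiable_def intro: has_field_derivative_at_within)
  fix z assume z: "z \<in> ball c (R/2)"
  then have zR: "z \<in> ball c R" using R by auto
  have "norm (contour_integral (circlepath c R) (\<lambda>u. g u / (u - z))) \<le> (2 * M / R) * (2 * pi * R)"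
  proof (rule has_contour_integral_bound_circlepath[OF has_contour_integral_integral[OF int[OF zR]]])
    fix u assume "norm (u - c) = R"
    then have u: "dist c u = R" by (simp add: dist_norm norm_minus_commute)
    then have "R/2 \<le> norm (u - z)"
      using z dist_triangle[of c u z] by (simp add: dist_norm norm_minus_commute)
    then have "norm (g u) / norm (u - z) \<le> M / (R/2)"
      using gM[of u] u R M0 by (intro frac_le) auto
    then show "norm (g u / (u - z)) \<le> 2 * M / R" by (simp add: norm_divide mult_ac)
  qed (use M0 R in auto)
  then show "norm (h z) \<le> 2 * M"
    using R by (simp add: h_def norm_divide norm_mult field_simps)
qed

subsection \<open>Uniform growth of nets\<close>

text \<open>Only values count here, not derivatives, and V may be any set. No constant multiplies
  the power: since all exponents occur, one further power of \<epsilon> absorbs it.\<close>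

definition negligible_on :: "'a net \<Rightarrow> 'a set \<Rightarrow> bool" where
  "negligible_on f V \<longleftrightarrow>
     (\<forall>a. \<forall>\<^sub>F \<epsilon> in at_right 0. \<forall>x\<in>V. norm (f \<epsilon> x) \<le> \<epsilon> powr a)"

definition moderate_on :: "'a net \<Rightarrow> 'a set \<Rightarrow> bool" where
  "moderate_on f V \<longleftrightarrow>
     (\<exists>a. \<forall>\<^sub>F \<epsilon> in at_right 0. \<forall>x\<in>V. norm (f \<epsilon> x) \<le> \<epsilon> powr a)"

lemma eventually_at_right_0_unit: "\<forall>\<^sub>F \<epsilon>::real in at_right 0. \<epsilon> \<in> {0<..<1}"
  by (rule eventually_at_right_real) simp

lemma eventually_const_times_powr_le:
  fixes C :: real
  shows "\<forall>\<^sub>F \<epsilon> in at_right 0. C * \<epsilon> powr (a + 1) \<le> \<epsilon> powr a"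
proof -
  have "\<forall>\<^sub>F \<epsilon>::real in at_right 0. \<epsilon> \<in> {0<..<1 / (\<bar>C\<bar> + 1)}"
    by (rule eventually_at_right_real) (simp add: add_nonneg_pos)
  then show ?thesis
  proof eventually_elim
    case (elim \<epsilon>)
    then have e: "0 < \<epsilon>" "\<epsilon> * (\<bar>C\<bar> + 1) < 1" by (auto simp: field_simps add_nonneg_pos)
    have "\<epsilon> * C \<le> 1" using mult_left_mono[of C "\<bar>C\<bar> + 1" \<epsilon>] e by linarith
    then have "C * \<epsilon> * \<epsilon> powr a \<le> 1 * \<epsilon> powr a"
      by (intro mult_right_mono) (auto simp: mult_ac)
    then show ?case using e by (simp add: powr_add mult_ac)
  qed
qed

lemma negligible_onI:
  assumes "\<And>a. \<exists>C. \<forall>\<^sub>F \<epsilon> in at_right 0. \<forall>x\<in>V. norm (f \<epsilon> x) \<le> C * \<epsilon> powr a"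
  shows "negligible_on f V"
  unfolding negligible_on_def
proof
  fix a
  obtain C where "\<forall>\<^sub>F \<epsilon> in at_right 0. \<forall>x\<in>V. norm (f \<epsilon> x) \<le> C * \<epsilon> powr (a + 1)"
    using assms by blast
  then show "\<forall>\<^sub>F \<epsilon> in at_right 0. \<forall>x\<in>V. norm (f \<epsilon> x) \<le> \<epsilon> powr a"
    using eventually_const_times_powr_le[of C a] by eventually_elim (meson order_trans)
qed

lemma moderate_onI:
  assumes "\<forall>\<^sub>F \<epsilon> in at_right 0. \<forall>x\<in>V. norm (f \<epsilon> x) \<le> C * \<epsilon> powr a"
  shows "moderate_on f V"
  unfolding moderate_on_def
proof (rule exI)
  show "\<forall>\<^sub>F \<epsilon> in at_right 0. \<forall>x\<in>V. norm (f \<epsilon> x) \<le> \<epsilon> powr (a - 1)"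
    using assms eventually_const_times_powr_le[of C "a - 1"]
    by eventually_elim (auto intro: order_trans)
qed

lemma negligible_onD:
  "negligible_on f V \<Longrightarrow> \<forall>\<^sub>F \<epsilon> in at_right 0. \<forall>x\<in>V. norm (f \<epsilon> x) \<le> \<epsilon> powr a"
  by (simp add: negligible_on_def)

lemma negligible_on_subset:
  assumes "negligible_on f V" "W \<subseteq> V"
  shows "negligible_on f W"
  unfolding negligible_on_def
proof
  fix a
  have "\<forall>\<^sub>F \<epsilon> in at_right 0. \<forall>x\<in>V. norm (f \<epsilon> x) \<le> \<epsilon> powr a"
    using assms(1) by (simp add: negligible_on_def)
  then show "\<forall>\<^sub>F \<epsilon> in at_right 0. \<forall>x\<in>W. norm (f \<epsilon> x) \<le> \<epsilon> powr a"
    by eventually_elim (use assms(2) in auto)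
qed

lemma negligible_on_Un:
  "negligible_on f V \<Longrightarrow> negligible_on f W \<Longrightarrow> negligible_on f (V \<union> W)"
  by (simp add: negligible_on_def ball_Un eventually_conj_iff)

lemma negligible_on_Union:
  assumes "finite \<V>" "\<And>V. V \<in> \<V> \<Longrightarrow> negligible_on f V"
  shows "negligible_on f (\<Union>\<V>)"
  using assms
  by (induction \<V>) (auto intro: negligible_on_Un simp: negligible_on_def[of _ "{}"])

lemma negligible_on_diff:
  assumes "negligible_on f V" "negligible_on g V"
  shows "negligible_on (\<lambda>\<epsilon> x. f \<epsilon> x - g \<epsilon> x) V"
proof (rule negligible_onI, rule exI)
  fix a
  have "\<forall>\<^sub>F \<epsilon> in at_right 0. \<forall>x\<in>V. norm (f \<epsilon> x) \<le> \<epsilon> powr a"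
    "\<forall>\<^sub>F \<epsilon> in at_right 0. \<forall>x\<in>V. norm (g \<epsilon> x) \<le> \<epsilon> powr a"
    using assms by (auto simp: negligible_on_def)
  then show "\<forall>\<^sub>F \<epsilon> in at_right 0. \<forall>x\<in>V. norm (f \<epsilon> x - g \<epsilon> x) \<le> 2 * \<epsilon> powr a"
    by eventually_elim (use norm_triangle_ineq4 in \<open>fastforce intro: order_trans\<close>)
qed

text \<open>Taking \<open>n\<close> proportional to \<open>log (1/\<epsilon>)\<close> makes the first summand small; the factor
  \<open>L ^ n\<close> in the second one is then only a power of \<open>1/\<epsilon>\<close>.\<close>

lemma negligible_on_by_degree_choice:
  assumes L: "1 \<le> L" and A: "0 \<le> A"
    and bound: "\<And>k. \<forall>\<^sub>F \<epsilon> in at_right 0. \<forall>x\<in>V. \<forall>n>0.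
      norm (f \<epsilon> x) \<le> A * (\<epsilon> powr (- N) / 2 ^ n + L ^ n * \<epsilon> powr k)"
  shows "negligible_on f V"
proof (rule negligible_onI)
  fix a :: real
  \<comment> \<open>With n \<ge> m log2(1/\<epsilon>) one has 2^(-n) \<le> \<epsilon>^m, and m \<ge>
    N + a turns the first summand into at most \<epsilon>^a; the 1 keeps m positive, hence n too.
    Rounding n up costs at most one factor L, so L^n \<le> L \<epsilon>^(-m log2 L), which dictates
    \<open>k\<close>.\<close>
  define m where "m = \<bar>N + a\<bar> + 1"
  define k where "k = a + m * log 2 L"
  have m: "0 < m" by (simp add: m_def add_nonneg_pos)
  have "\<forall>\<^sub>F \<epsilon> in at_right 0. \<forall>x\<in>V. norm (f \<epsilon> x) \<le> A * (1 + L) * \<epsilon> powr a"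
    using bound[of k] eventually_at_right_0_unit
  proof eventually_elim
    case (elim \<epsilon>)
    then have e: "0 < \<epsilon>" "\<epsilon> < 1" by auto
    define l where "l = m * log 2 (1 / \<epsilon>)"
    define n where "n = nat \<lceil>l\<rceil>"
    have l: "0 < l" using e m by (simp add: l_def)
    then have n: "0 < n" "l \<le> real n" "real n \<le> l + 1" unfolding n_def by linarith+
    have "\<epsilon> powr (- m) = (2 powr log 2 (1 / \<epsilon>)) powr m"
      using e by (simp add: powr_minus inverse_eq_divide powr_divide)
    also have "\<dots> = 2 powr l" by (simp add: powr_powr l_def mult_ac)
    also have "\<dots> \<le> 2 powr real n" using n by simp
    finally have "\<epsilon> powr (- m) \<le> 2 ^ n" by (simp add: powr_realpow)
    then have "\<epsilon> powr (- N) / 2 ^ n \<le> \<epsilon> powr (- N) / \<epsilon> powr (- m)"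
      using e by (intro divide_left_mono) auto
    also have "\<dots> = \<epsilon> powr (m - N)" by (simp add: powr_diff[symmetric])
    also have "\<dots> \<le> \<epsilon> powr a" using e by (intro powr_mono') (auto simp: m_def)
    finally have 1: "\<epsilon> powr (- N) / 2 ^ n \<le> \<epsilon> powr a" .
    have "L ^ n = L powr real n" using L by (simp add: powr_realpow)
    also have "\<dots> \<le> L powr (l + 1)" using L n by (intro powr_mono) auto
    also have "\<dots> = L * L powr l" using L by (simp add: powr_add)
    also have "L powr l = \<epsilon> powr (- (m * log 2 L))"
    proof -
      have "ln L * l = ln \<epsilon> * (- (m * log 2 L))"
        using e L by (simp add: l_def log_def ln_div field_simps)
      then show ?thesis using e L by (simp add: powr_def mult_ac)
    qed
    finally have "L ^ n * \<epsilon> powr k \<le> L * \<epsilon> powr (- (m * log 2 L)) * \<epsilon> powr k"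
      by (intro mult_right_mono) auto
    also have "\<dots> = L * \<epsilon> powr a" by (simp add: k_def powr_add[symmetric])
    finally have 2: "L ^ n * \<epsilon> powr k \<le> L * \<epsilon> powr a" .
    show ?case
    proof
      fix x assume "x \<in> V"
      then have "norm (f \<epsilon> x) \<le> A * (\<epsilon> powr (- N) / 2 ^ n + L ^ n * \<epsilon> powr k)"
        using elim n by blast
      also have "\<dots> \<le> A * (\<epsilon> powr a + L * \<epsilon> powr a)"
        using A 1 2 by (intro mult_left_mono add_mono) auto
      finally show "norm (f \<epsilon> x) \<le> A * (1 + L) * \<epsilon> powr a" by (simp add: algebra_simps)
    qed
  qed
  then show "\<exists>C. \<forall>\<^sub>F \<epsilon> in at_right 0. \<forall>x\<in>V. norm (f \<epsilon> x) \<le> C * \<epsilon> powr a" by blast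
qed

subsection \<open>Sets of positive measure\<close>

text \<open>Greedy choice from the left: take a point close to the infimum, discard everything
  before it and within s after it, and repeat. Each round removes little more than length s.\<close>

lemma spaced_points:
  fixes E :: "real set"
  assumes "E \<in> sets borel" "bounded E" "0 < s" "real n * s < measure lborel E"
  shows "\<exists>t::nat \<Rightarrow> real. (\<forall>i<n. t i \<in> E) \<and> (\<forall>i j. i \<le> j \<and> j < n \<longrightarrow> t i + s * (real j - real i) \<le> t j)"
  using assms
proof (induction n arbitrary: E)
  case 0
  then show ?case by auto
next
  case (Suc n)
  \<comment> \<open>The surplus of length. Choosing the first point within \<eta> of the infimum
    removes less than s + \<eta>, which leaves more than n s.\<close>
  define \<eta> where "\<eta> = measure lborel E - real (Suc n) * s"
  have \<eta>: "0 < \<eta>" using Suc.prems by (simp add: \<eta>_def)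
  have ne: "E \<noteq> {}"
    using Suc.prems by (metis add_nonneg_nonneg measure_empty mult_nonneg_nonneg not_less of_nat_0_le_iff order_less_imp_le)
  have bb: "bdd_below E" using Suc.prems by (simp add: bounded_imp_bdd_below)
  obtain t0 where t0: "t0 \<in> E" "t0 < Inf E + \<eta>"
    using cInf_lessD[OF ne, of "Inf E + \<eta>"] \<eta> by auto
  define E' where "E' = E \<inter> {t0 + s..}"
  have E': "E' \<in> sets borel" "bounded E'"
    using Suc.prems by (auto simp: E'_def intro: bounded_subset)
  have "E \<subseteq> E' \<union> {Inf E..t0 + s}"
    using cInf_lower[OF _ bb] by (auto simp: E'_def)
  moreover have "emeasure lborel (E' \<union> {Inf E..t0 + s}) < \<infinity>"
    using E'(2) by (intro emeasure_bounded_finite) auto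
  ultimately have "measure lborel E \<le> measure lborel (E' \<union> {Inf E..t0 + s})"
    using E' Suc.prems by (intro measure_mono_fmeasurable) (auto simp: fmeasurable_def)
  also have "\<dots> \<le> measure lborel E' + measure lborel {Inf E..t0 + s}"
    using E' by (intro measure_Un_le) auto
  also have "measure lborel {Inf E..t0 + s} = t0 + s - Inf E"
    using cInf_lower[OF t0(1) bb] Suc.prems(3) by simp
  finally have "real n * s < measure lborel E'"
    using t0(2) by (simp add: \<eta>_def algebra_simps)
  from Suc.IH[OF E' Suc.prems(3) this] obtain t where
    t: "\<And>i. i < n \<Longrightarrow> t i \<in> E'" "\<And>i j. i \<le> j \<Longrightarrow> j < n \<Longrightarrow> t i + s * (real j - real i) \<le> t j" by auto
  have t0_le: "t0 + s * (real j + 1) \<le> t j" if "j < n" for j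
    using t(1)[of 0] t(2)[of 0 j] that by (auto simp: E'_def algebra_simps)
  define u where "u = case_nat t0 t"
  have "u i \<in> E" if "i < Suc n" for i
    using that t(1) t0 by (cases i) (auto simp: u_def E'_def)
  moreover have "u i + s * (real j - real i) \<le> u j" if ij: "i \<le> j" "j < Suc n" for i j
  proof (cases i)
    case 0
    then show ?thesis using t0_le[of "j - 1"] ij by (cases j) (auto simp: u_def algebra_simps)
  next
    case (Suc i')
    then obtain j' where "j = Suc j'" using ij by (cases j) auto
    then show ?thesis using t(2)[of i' j'] ij Suc by (simp add: u_def)
  qed
  ultimately show ?case by blast
qed

text \<open>The condition on \<open>n\<close> points under which interpolation at them costs only a factor
  exponential in \<open>n\<close>.\<close>

definition spread_out :: "real \<Rightarrow> 'a::metric_space set \<Rightarrow> bool" where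
  "spread_out \<kappa> A \<longleftrightarrow> (\<forall>n>0. \<exists>X::nat \<Rightarrow> 'a. (\<forall>k<n. X k \<in> A) \<and>
     (\<forall>k<n. \<forall>l<n. \<kappa> * \<bar>real k - real l\<bar> / n \<le> dist (X k) (X l)))"

lemma spread_outE:
  assumes "spread_out \<kappa> A" "0 < n"
  obtains X :: "nat \<Rightarrow> 'a::metric_space" where "\<And>k. k < n \<Longrightarrow> X k \<in> A"
    "\<And>k l. k < n \<Longrightarrow> l < n \<Longrightarrow> \<kappa> * \<bar>real k - real l\<bar> / n \<le> dist (X k) (X l)"
proof -
  from assms obtain X :: "nat \<Rightarrow> 'a" where "\<forall>k<n. X k \<in> A"
    "\<forall>k<n. \<forall>l<n. \<kappa> * \<bar>real k - real l\<bar> / n \<le> dist (X k) (X l)"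
    unfolding spread_out_def by blast
  then show ?thesis by (intro that[of X]) blast+
qed

text \<open>Carries separation through maps that do not contract by more than the factor C. It is
  applied to translations, to real lines in a complex coordinate (C = 1) and to short arcs of
  curves.\<close>

lemma spread_out_image:
  assumes A: "spread_out \<kappa> A" and C: "0 \<le> C"
    and \<phi>: "\<And>a. a \<in> A \<Longrightarrow> \<phi> a \<in> B"
    and lower: "\<And>a b. a \<in> A \<Longrightarrow> b \<in> A \<Longrightarrow> C * dist a b \<le> dist (\<phi> a) (\<phi> b)"
  shows "spread_out (C * \<kappa>) B"
  unfolding spread_out_def
proof (intro allI impI)
  fix n :: nat assume n: "0 < n"
  obtain X where X: "\<And>k. k < n \<Longrightarrow> X k \<in> A"
    "\<And>k l. k < n \<Longrightarrow> l < n \<Longrightarrow> \<kappa> * \<bar>real k - real l\<bar> / n \<le> dist (X k) (X l)"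
    using spread_outE[OF A n] by blast
  have "C * \<kappa> * \<bar>real k - real l\<bar> / n \<le> dist (\<phi> (X k)) (\<phi> (X l))" if kl: "k < n" "l < n" for k l
  proof -
    have "C * (\<kappa> * \<bar>real k - real l\<bar> / n) \<le> C * dist (X k) (X l)"
      using X(2)[OF kl] C by (rule mult_left_mono)
    also have "\<dots> \<le> dist (\<phi> (X k)) (\<phi> (X l))" by (rule lower[OF X(1)[OF kl(1)] X(1)[OF kl(2)]])
    finally show ?thesis by (simp add: mult.assoc)
  qed
  then show "\<exists>X. (\<forall>k<n. X k \<in> B) \<and>
     (\<forall>k<n. \<forall>l<n. C * \<kappa> * \<bar>real k - real l\<bar> / n \<le> dist (X k) (X l))"
    using X(1) \<phi> by (intro exI[of _ "\<lambda>k. \<phi> (X k)"]) blast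
qed

lemma spread_out_subset: "spread_out \<kappa> A \<Longrightarrow> A \<subseteq> B \<Longrightarrow> spread_out \<kappa> B"
  using spread_out_image[of \<kappa> A 1 "\<lambda>a. a" B] by auto

text \<open>The spacing c/(2n) uses up half of the length c; the half is what makes the strict
  inequality required by \<open>spaced_points\<close> available.\<close>

lemma spread_out_positive_length:
  fixes E :: "real set"
  assumes "E \<in> sets borel" "bounded E" "0 < c" "c \<le> measure lborel E"
  shows "spread_out (c / 2) E"
  unfolding spread_out_def
proof (intro allI impI)
  fix n :: nat assume n: "0 < n"
  define s where "s = c / (2 * n)"
  have s: "0 < s" "real n * s < measure lborel E"
    using assms n by (auto simp: s_def)
  obtain t :: "nat \<Rightarrow> real" where t: "\<And>i. i < n \<Longrightarrow> t i \<in> E" "\<And>i j. i \<le> j \<Longrightarrow> j < n \<Longrightarrow> t i + s * (real j - real i) \<le> t j"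
    using spaced_points[OF assms(1,2) s] by auto
  have "s * \<bar>real i - real j\<bar> \<le> dist (t i) (t j)" if "i < n" "j < n" for i j
    using t(2)[of i j] t(2)[of j i] that by (cases "i \<le> j") (auto simp: dist_real_def abs_if algebra_simps)
  moreover have "c / 2 * x / n = s * x" for x by (simp add: s_def)
  ultimately show "\<exists>X. (\<forall>k<n. X k \<in> E) \<and>
     (\<forall>k<n. \<forall>l<n. c / 2 * \<bar>real k - real l\<bar> / n \<le> dist (X k) (X l))"
    using t(1) by (intro exI[of _ t]) auto
qed

section \<open>Fubini and Egorov arguments\<close>

text \<open>The sets where g is at least 1/(n+1) exhaust the set where g is positive. Applied to the
  lengths of slices, this yields the common lower bound c on which the Remez constant
  depends.\<close>

lemma exists_superlevel_set_pos:
  assumes g: "g \<in> borel_measurable M" and pos: "0 < (\<integral>\<^sup>+ x. g x \<partial>M)"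
  shows "\<exists>c>0. 0 < emeasure M {x\<in>space M. ennreal c \<le> g x}"
proof (rule ccontr)
  assume "\<not> ?thesis"
  then have null: "emeasure M {x\<in>space M. ennreal c \<le> g x} = 0" if "0 < c" for c
    using that by (auto simp: zero_less_iff_neq_zero)
  have "AE x in M. \<not> ennreal (1 / Suc n) \<le> g x" for n
    by (rule AE_I[OF _ null[of "1 / Suc n"]]) (use g in auto)
  then have "AE x in M. \<forall>n. \<not> ennreal (1 / Suc n) \<le> g x"
    by (simp add: AE_all_countable)
  then have "AE x in M. g x = 0"
  proof eventually_elim
    case (elim x)
    show ?case
    proof (rule ccontr)
      assume "g x \<noteq> 0"
      then obtain r where r: "0 < r" "ennreal r \<le> g x"
      proof (cases "g x")
        case (real r)
        then show ?thesis using that[of r] \<open>g x \<noteq> 0\<close> by (auto simp: less_le)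
      next
        case top
        then show ?thesis using that[of 1] by auto
      qed
      obtain n where "1 / real (Suc n) < r" using nat_approx_posE[OF r(1)] by auto
      then have "ennreal (1 / Suc n) \<le> g x" using r by (meson ennreal_leI less_imp_le order_trans)
      then show False using elim by blast
    qed
  qed
  then have "(\<integral>\<^sup>+ x. g x \<partial>M) = 0" using g by (simp add: nn_integral_0_iff_AE)
  then show False using pos by simp
qed

text \<open>Here \<open>agr i z s\<close> reads ``the \<open>i\<close>-th coordinate of \<open>z\<close> has parameter \<open>s\<close>''
  and \<open>upd i z s\<close> moves that coordinate to the parameter \<open>s\<close>.\<close>

lemma (in product_sigma_finite) coordinatewise_propagation:
  fixes U :: "'z set \<Rightarrow> bool"
  assumes mono: "\<And>V W. U V \<Longrightarrow> W \<subseteq> V \<Longrightarrow> U W"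
    and step: "\<And>i c V. i \<in> I \<Longrightarrow> 0 < c \<Longrightarrow> V \<subseteq> P \<Longrightarrow> U V \<Longrightarrow>
       U {z\<in>P. \<exists>B\<in>sets (M i). B \<subseteq> T i \<and> ennreal c \<le> emeasure (M i) B \<and> (\<forall>s\<in>B. upd i z s \<in> V)}"
    and upd: "\<And>i z s. i \<in> I \<Longrightarrow> z \<in> P \<Longrightarrow> s \<in> T i \<Longrightarrow> upd i z s \<in> P"
    and agr_same: "\<And>i z s. i \<in> I \<Longrightarrow> z \<in> P \<Longrightarrow> s \<in> T i \<Longrightarrow> agr i (upd i z s) s"
    and agr_other: "\<And>i j z s u. i \<in> I \<Longrightarrow> j \<in> I \<Longrightarrow> i \<noteq> j \<Longrightarrow> z \<in> P \<Longrightarrow> s \<in> T i \<Longrightarrow> agr j z u \<Longrightarrow> agr j (upd i z s) u"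
    and fin: "finite K" and KI: "K \<subseteq> I"
    and E: "E \<in> sets (PiM K M)" "E \<subseteq> PiE K T" "0 < emeasure (PiM K M) E"
    and UE: "U {z\<in>P. \<exists>t\<in>E. \<forall>i\<in>K. agr i z (t i)}"
  shows "U P"
  using fin KI E UE
proof (induction K arbitrary: E)
  \<comment> \<open>With no coordinate left to prescribe, the described set is all of P as soon as E
    has an element.\<close>
  case empty
  then have "E \<noteq> {}" by auto
  then have "{z\<in>P. \<exists>t\<in>E. \<forall>i\<in>{}. agr i z (t i)} = P" by auto
  then show ?case using empty.prems by metis
next
  case (insert i K)
  have i: "i \<in> I" using insert by auto
  \<comment> \<open>Coordinate i is released: \<open>g t\<close> measures the slice of E over t in
    direction i. By Fubini \<open>g\<close> has positive integral, hence exceeds some c on a set E'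
    of positive measure in the remaining coordinates.\<close>
  define Q where "Q = (\<lambda>(f, y). f(i := y)) -` E \<inter> space (PiM K M \<Otimes>\<^sub>M M i)"
  have Q: "Q \<in> sets (PiM K M \<Otimes>\<^sub>M M i)"
    unfolding Q_def by (rule measurable_sets[OF measurable_add_dim insert.prems(2)])
  define g where "g = (\<lambda>t. emeasure (M i) (Pair t -` Q))"
  have g: "g \<in> borel_measurable (PiM K M)"
    unfolding g_def by (rule M.measurable_emeasure_Pair[OF Q])
  have slice: "Pair t -` Q = {y \<in> space (M i). t(i := y) \<in> E}" if "t \<in> space (PiM K M)" for t
    using that by (auto simp: Q_def space_pair_measure)
  have "emeasure (PiM (insert i K) M) E = (\<integral>\<^sup>+ t. indicator E t \<partial>PiM (insert i K) M)"
    using insert.prems by simp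
  also have "\<dots> = (\<integral>\<^sup>+ t. (\<integral>\<^sup>+ y. indicator E (t(i := y)) \<partial>M i) \<partial>PiM K M)"
    using insert.prems insert.hyps by (intro product_nn_integral_insert) auto
  also have "\<dots> = (\<integral>\<^sup>+ t. g t \<partial>PiM K M)"
  proof (rule nn_integral_cong)
    fix t assume t: "t \<in> space (PiM K M)"
    have "(\<integral>\<^sup>+ y. indicator E (t(i := y)) \<partial>M i) = (\<integral>\<^sup>+ y. indicator (Pair t -` Q) y \<partial>M i)"
      by (intro nn_integral_cong) (auto simp: slice[OF t] indicator_def)
    also have "\<dots> = g t" unfolding g_def using sets_Pair1[OF Q] by simp
    finally show "(\<integral>\<^sup>+ y. indicator E (t(i := y)) \<partial>M i) = g t" .
  qed
  finally have "0 < (\<integral>\<^sup>+ t. g t \<partial>PiM K M)" using insert.prems by simp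
  then obtain c where c: "0 < c" "0 < emeasure (PiM K M) {t\<in>space (PiM K M). ennreal c \<le> g t}"
    using exists_superlevel_set_pos[OF g] by blast
  define E' where "E' = {t\<in>space (PiM K M). ennreal c \<le> g t}"
  have "E' \<in> sets (PiM K M)" unfolding E'_def using g by simp
  moreover have "E' \<subseteq> PiE K T"
  proof
    fix t assume t: "t \<in> E'"
    then have ts: "t \<in> space (PiM K M)" by (simp add: E'_def)
    \<comment> \<open>A slice of positive measure contains a point, and this point places t in the
      box of the remaining coordinates.\<close>
    have "Pair t -` Q \<noteq> {}" using t c(1) by (auto simp: E'_def g_def)
    then obtain y where "t(i := y) \<in> E" using slice[OF ts] by auto
    then have "t(i := y) \<in> PiE (insert i K) T" using insert.prems by auto
    then have "t j \<in> T j" if "j \<in> K" for j using that insert.hyps by (metis PiE_mem fun_upd_other insertCI)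
    then show "t \<in> PiE K T" using ts by (auto simp: space_PiM PiE_def)
  qed
  moreover have "U {z\<in>P. \<exists>t\<in>E'. \<forall>i\<in>K. agr i z (t i)}"
  proof (rule mono[OF step[OF i c(1) _ insert.prems(5)]])
    show "{z \<in> P. \<exists>t\<in>E'. \<forall>i\<in>K. agr i z (t i)}
        \<subseteq> {z \<in> P. \<exists>B\<in>sets (M i). B \<subseteq> T i \<and> ennreal c \<le> emeasure (M i) B \<and>
           (\<forall>s\<in>B. upd i z s \<in> {z \<in> P. \<exists>t\<in>E. \<forall>j\<in>insert i K. agr j z (t j)})}"
    proof safe
      fix z t assume z: "z \<in> P" and t: "t \<in> E'" and agr: "\<forall>j\<in>K. agr j z (t j)"
      have ts: "t \<in> space (PiM K M)" using t by (simp add: E'_def)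
      let ?B = "Pair t -` Q"
      have B: "?B \<subseteq> T i"
        using slice[OF ts] insert.prems(3) by (auto dest!: PiE_mem[of _ "insert i K" T i] subsetD)
      show "\<exists>B\<in>sets (M i). B \<subseteq> T i \<and> ennreal c \<le> emeasure (M i) B \<and>
           (\<forall>s\<in>B. upd i z s \<in> {z \<in> P. \<exists>t\<in>E. \<forall>j\<in>insert i K. agr j z (t j)})"
      proof (intro bexI[of _ ?B] conjI ballI)
        show "ennreal c \<le> emeasure (M i) ?B" using t by (simp add: E'_def g_def)
        show "?B \<in> sets (M i)" using sets_Pair1[OF Q] .
        show "?B \<subseteq> T i" by (rule B)
        fix s assume s: "s \<in> ?B"
        then have sT: "s \<in> T i" and sE: "t(i := s) \<in> E" using B slice[OF ts] by auto
        have "agr j (upd i z s) ((t(i := s)) j)" if j: "j \<in> insert i K" for j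
        proof (cases "j = i")
          case True
          then show ?thesis using agr_same[OF i z sT] by simp
        next
          case False
          then show ?thesis using agr_other[OF i _ _ z sT, of j] agr j insert.prems(1) by auto
        qed
        then show "upd i z s \<in> {z \<in> P. \<exists>t\<in>E. \<forall>j\<in>insert i K. agr j z (t j)}"
          using upd[OF i z sT] sE by blast
      qed
    qed
  qed auto
  ultimately show ?case
    using insert.IH[of E'] insert.prems c(2) by (simp add: E'_def)
qed

text \<open>The measure-theoretic core of Egorov's theorem. By continuity from above the k-th level
  can be chosen so that it discards at most a 2^(-k-2) share of S; altogether at most half is
  lost.\<close>

lemma exists_common_level_sets:
  fixes A :: "nat \<Rightarrow> nat \<Rightarrow> 'a set"
  assumes S: "S \<in> sets M" "0 < emeasure M S" "emeasure M S < \<infinity>"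
    and A: "\<And>k n. A k n \<in> sets M" "\<And>k. incseq (A k)" "\<And>k. S \<subseteq> (\<Union>n. A k n)"
  shows "\<exists>m. 0 < emeasure M (S \<inter> (\<Inter>k. A k (m k)))"
proof -
  define \<mu> where "\<mu> = measure M S"
  have \<mu>: "emeasure M S = ennreal \<mu>" "0 < \<mu>"
    using S by (auto simp: \<mu>_def emeasure_eq_ennreal_measure less_top zero_less_measure_iff)
  have "\<exists>n. emeasure M (S - A k n) < ennreal (\<mu> / 2 * (1/2) ^ Suc k)" for k
  proof -
    have "(\<lambda>n. emeasure M (S - A k n)) \<longlonglongrightarrow> emeasure M (\<Inter>n. S - A k n)"
    proof (rule Lim_emeasure_decseq)
      show "decseq (\<lambda>n. S - A k n)" using A(2)[of k] by (auto simp: decseq_def incseq_def)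
      show "emeasure M (S - A k n) \<noteq> \<infinity>" for n
        using S A emeasure_mono[of "S - A k n" S M] by (auto simp: top_unique)
    qed (use S A in auto)
    also have "(\<Inter>n. S - A k n) = {}" using A(3)[of k] by auto
    finally have "(\<lambda>n. emeasure M (S - A k n)) \<longlonglongrightarrow> 0" by simp
    then have "eventually (\<lambda>n. emeasure M (S - A k n) < ennreal (\<mu> / 2 * (1/2) ^ Suc k)) sequentially"
      using \<mu> by (intro order_tendstoD(2)) auto
    then show ?thesis by (meson eventually_sequentially order_refl)
  qed
  then obtain m where m: "\<And>k. emeasure M (S - A k (m k)) < ennreal (\<mu> / 2 * (1/2) ^ Suc k)" by metis
  have "emeasure M (\<Union>k. S - A k (m k)) \<le> (\<Sum>k. emeasure M (S - A k (m k)))"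
    using S A by (intro emeasure_subadditive_countably) auto
  also have "\<dots> \<le> (\<Sum>k. ennreal (\<mu> / 2 * (1/2) ^ Suc k))"
    using m by (intro suminf_le) (auto intro: less_imp_le)
  also have "\<dots> = ennreal (\<mu> / 2 * 1)"
    using \<mu> by (intro suminf_ennreal_eq sums_mult power_half_series) auto
  finally have small: "emeasure M (\<Union>k. S - A k (m k)) \<le> ennreal (\<mu> / 2)" by simp
  have meas: "S \<inter> (\<Inter>k. A k (m k)) \<in> sets M" "(\<Union>k. S - A k (m k)) \<in> sets M" using S A by auto
  have "emeasure M (S \<inter> (\<Inter>k. A k (m k))) \<noteq> 0"
  proof
    assume "emeasure M (S \<inter> (\<Inter>k. A k (m k))) = 0"
    moreover have "emeasure M S \<le> emeasure M ((S \<inter> (\<Inter>k. A k (m k))) \<union> (\<Union>k. S - A k (m k)))"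
      using meas by (intro emeasure_mono) auto
    ultimately have "emeasure M S \<le> emeasure M (\<Union>k. S - A k (m k))"
      using emeasure_subadditive[OF meas] by simp
    then have "ennreal \<mu> \<le> ennreal (\<mu> / 2)" using small \<mu> by (metis order_trans)
    then show False using \<mu> by simp
  qed
  then show ?thesis by (auto simp: zero_less_iff_neq_zero)
qed

text \<open>For each exponent k the admissible constant and the threshold for \<epsilon> depend on
  the point; the set where both can be read off from one integer n grows to S with n. Choosing n for
  every k at once leaves a set on which the bounds are uniform. The map \<phi> is the identity or a
  product of curve parametrizations.\<close>

lemma exists_negligible_on_subset:
  fixes f :: "'b::euclidean_space net"
  assumes \<omega>: "open \<omega>" and cont: "\<And>\<epsilon>. \<epsilon> \<in> {0<..<1} \<Longrightarrow> continuous_on \<omega> (f \<epsilon>)"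
    and \<phi>: "\<phi> \<in> borel_measurable M"
    and S: "S \<in> sets M" "0 < emeasure M S" "emeasure M S < \<infinity>" "\<phi> ` S \<subseteq> \<omega>"
    and neg: "\<And>t. t \<in> S \<Longrightarrow> (\<lambda>\<epsilon>. f \<epsilon> (\<phi> t)) \<in> negligible_numbers"
  shows "\<exists>E\<in>sets M. E \<subseteq> S \<and> 0 < emeasure M E \<and> negligible_on f (\<phi> ` E)"
proof -
  \<comment> \<open>A single n bounds both data: the constant is n, the threshold 1/(n+1). The
    latter is at most 1, which keeps \<epsilon> in the range where continuity is known.\<close>
  define C where "C = (\<lambda>k n. {x\<in>\<omega>. \<forall>\<epsilon>\<in>{0<..<1 / real (Suc n)}. norm (f \<epsilon> x) \<le> n * \<epsilon> powr real k})"
  have C_borel: "C k n \<in> sets borel" for k n :: nat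
  proof -
    have op: "open (\<omega> \<inter> f \<epsilon> -` {y. n * \<epsilon> powr real k < norm y})" if "\<epsilon> \<in> {0<..<1 / real (Suc n)}" for \<epsilon>
    proof (rule continuous_open_preimage[OF _ \<omega>])
      have "\<epsilon> < 1 / real (Suc n)" using that by simp
      also have "\<dots> \<le> 1" by simp
      finally show "continuous_on \<omega> (f \<epsilon>)" using that by (intro cont) auto
      show "open {y::complex. n * \<epsilon> powr real k < norm y}" by (intro open_Collect_less continuous_intros)
    qed
    \<comment> \<open>Uncountably many \<epsilon> are involved, but for each the exceptional set is
      open, and so is their union. Thus no measurability in \<epsilon> is required.\<close>
    have "C k n = \<omega> - (\<Union>\<epsilon>\<in>{0<..<1 / real (Suc n)}. \<omega> \<inter> f \<epsilon> -` {y. n * \<epsilon> powr real k < norm y})"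
      by (auto simp: C_def not_less)
    moreover have "open (\<Union>\<epsilon>\<in>{0<..<1 / real (Suc n)}. \<omega> \<inter> f \<epsilon> -` {y. n * \<epsilon> powr real k < norm y})"
      using op by blast
    ultimately show ?thesis using \<omega> by auto
  qed
  define A where "A = (\<lambda>k n. \<phi> -` C k n \<inter> space M)"
  have A: "A k n \<in> sets M" for k n :: nat
    unfolding A_def using \<phi> C_borel by (rule measurable_sets)
  have inc: "incseq (A k)" for k
  proof (rule monoI)
    fix m n :: nat assume mn: "m \<le> n"
    have "C k m \<subseteq> C k n"
    proof
      fix x assume x: "x \<in> C k m"
      have "norm (f \<epsilon> x) \<le> n * \<epsilon> powr real k" if "\<epsilon> \<in> {0<..<1 / real (Suc n)}" for \<epsilon>
      proof -
        have "1 / real (Suc n) \<le> 1 / real (Suc m)" using mn by (simp add: field_simps)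
        then have "norm (f \<epsilon> x) \<le> m * \<epsilon> powr real k" using x that by (auto simp: C_def)
        also have "\<dots> \<le> n * \<epsilon> powr real k" using mn by (intro mult_right_mono) auto
        finally show ?thesis .
      qed
      then show "x \<in> C k n" using x by (auto simp: C_def)
    qed
    then show "A k m \<subseteq> A k n" by (auto simp: A_def)
  qed
  have cover: "S \<subseteq> (\<Union>n. A k n)" for k
  proof
    fix t assume t: "t \<in> S"
    obtain K where "eventually (\<lambda>\<epsilon>. norm (norm (f \<epsilon> (\<phi> t))) \<le> K * norm (\<epsilon> powr real k)) (at_right 0)"
      using neg[OF t] by (force simp: negligible_numbers_def elim: landau_o.bigE)
    then obtain d where d: "0 < d" "\<And>\<epsilon>. 0 < \<epsilon> \<Longrightarrow> \<epsilon> < d \<Longrightarrow> norm (f \<epsilon> (\<phi> t)) \<le> K * \<epsilon> powr real k"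
      by (auto simp: eventually_at_right_field)
    obtain n1 where n1: "1 / real (Suc n1) < d" using nat_approx_posE[OF d(1)] by auto
    obtain n2 :: nat where n2: "K \<le> real n2" using real_arch_simple by blast
    define n where "n = max n1 n2"
    have "norm (f \<epsilon> (\<phi> t)) \<le> n * \<epsilon> powr real k" if e: "\<epsilon> \<in> {0<..<1 / real (Suc n)}" for \<epsilon>
    proof -
      have "1 / real (Suc n) \<le> 1 / real (Suc n1)" by (simp add: n_def field_simps)
      then have "norm (f \<epsilon> (\<phi> t)) \<le> K * \<epsilon> powr real k" using e n1 by (intro d) auto
      also have "\<dots> \<le> n * \<epsilon> powr real k" using n2 by (intro mult_right_mono) (auto simp: n_def)
      finally show ?thesis .
    qed
    then have "t \<in> A k n" using t S sets.sets_into_space[OF S(1)] by (auto simp: A_def C_def)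
    then show "t \<in> (\<Union>n. A k n)" by blast
  qed
  obtain m where m: "0 < emeasure M (S \<inter> (\<Inter>k. A k (m k)))"
    using exists_common_level_sets[OF S(1,2,3), of A] A inc cover by blast
  define E where "E = S \<inter> (\<Inter>k. A k (m k))"
  have "negligible_on f (\<phi> ` E)"
  proof (rule negligible_onI)
    fix a :: real
    obtain k :: nat where k: "a \<le> real k" using real_arch_simple by blast
    have "eventually (\<lambda>\<epsilon>. \<epsilon> \<in> {0<..<1 / real (Suc (m k))}) (at_right 0)"
      by (rule eventually_at_right_real) simp
    then have "\<forall>\<^sub>F \<epsilon> in at_right 0. \<forall>x\<in>\<phi> ` E. norm (f \<epsilon> x) \<le> m k * \<epsilon> powr a"
    proof eventually_elim
      case (elim \<epsilon>)
      have "\<epsilon> < 1 / real (Suc (m k))" using elim by simp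
      also have "\<dots> \<le> 1" by simp
      finally have e: "0 < \<epsilon>" "\<epsilon> \<le> 1" using elim by auto
      show ?case
      proof
        fix x assume "x \<in> \<phi> ` E"
        then have "norm (f \<epsilon> x) \<le> m k * \<epsilon> powr real k" using elim by (auto simp: E_def A_def C_def)
        also have "\<dots> \<le> m k * \<epsilon> powr a" using e k by (intro mult_left_mono powr_mono') auto
        finally show "norm (f \<epsilon> x) \<le> m k * \<epsilon> powr a" .
      qed
    qed
    then show "\<exists>C. \<forall>\<^sub>F \<epsilon> in at_right 0. \<forall>x\<in>\<phi> ` E. norm (f \<epsilon> x) \<le> C * \<epsilon> powr a" by blast
  qed
  moreover have "E \<in> sets M" "E \<subseteq> S" using S A by (auto simp: E_def)
  ultimately show ?thesis using m by (auto simp: E_def)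
qed

subsection \<open>Iterated partial derivatives\<close>

lemma has_derivative_imp_partial:
  assumes "(F has_derivative D) (at x)"
  shows "D b = partial b F x"
proof -
  have "((\<lambda>t. x + t *\<^sub>R b) has_vector_derivative b) (at 0)"
    by (auto intro!: derivative_eq_intros)
  then have "((\<lambda>t. F (x + t *\<^sub>R b)) has_vector_derivative D b) (at 0)"
    by (rule has_vector_derivative_chain[where f = "\<lambda>t. x + t *\<^sub>R b" and t = 0, rotated]) (use assms in simp)
  then show ?thesis by (simp add: partial_def vector_derivative_at)
qed

lemma has_vector_derivative_partial:
  assumes "F differentiable (at (x + t *\<^sub>R b))"
  shows "((\<lambda>t. F (x + t *\<^sub>R b)) has_vector_derivative partial b F (x + t *\<^sub>R b)) (at t within X)"
proof -
  obtain D where D: "(F has_derivative D) (at (x + t *\<^sub>R b))"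
    using assms by (auto simp: differentiable_def)
  have "((\<lambda>t. x + t *\<^sub>R b) has_vector_derivative b) (at t within X)"
    by (auto intro!: derivative_eq_intros)
  then have "((\<lambda>t. F (x + t *\<^sub>R b)) has_vector_derivative D b) (at t within X)"
    by (rule has_vector_derivative_chain[where f = "\<lambda>t. x + t *\<^sub>R b", OF D])
  then show ?thesis by (simp add: has_derivative_imp_partial[OF D])
qed

lemma smooth_on_differentiable:
  assumes "smooth_on \<omega> F" "open \<omega>" "set bs \<subseteq> Basis" "x \<in> \<omega>"
  shows "foldr partial bs F differentiable (at x)"
  using assms by (metis differentiable_on_eq_differentiable_at smooth_on_def)

lemma smooth_on_continuous_on:
  assumes "smooth_on \<omega> F" "set bs \<subseteq> Basis"
  shows "continuous_on \<omega> (foldr partial bs F)"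
  using assms by (auto simp: smooth_on_def intro: differentiable_imp_continuous_on)

lemma funpow_partial: "(partial b ^^ n) F = foldr partial (replicate n b) F"
  by (induction n) auto

lemma basis_list:
  shows "distinct (basis_list :: 'a::euclidean_space list) \<and> set (basis_list :: 'a list) = Basis"
proof -
  obtain xs :: "'a list" where "distinct xs \<and> set xs = Basis"
    using finite_distinct_list[OF finite_Basis] by metis
  then show ?thesis unfolding basis_list_def by (rule someI)
qed

lemmas distinct_basis_list = basis_list[THEN conjunct1]
lemmas set_basis_list = basis_list[THEN conjunct2]

lemma foldr_funpow: "foldr (\<lambda>b. g b ^^ m b) xs F = foldr g (concat (map (\<lambda>b. replicate (m b) b) xs)) F"
proof (induction xs)
  case (Cons b xs)
  have "(g b ^^ n) G = foldr g (replicate n b) G" for n G by (induction n) auto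
  then show ?case by (simp add: Cons)
qed simp

lemma mderiv_eq_foldr:
  "mderiv \<alpha> F = foldr partial (concat (map (\<lambda>b. replicate (\<alpha> b) b) basis_list)) F"
  by (simp only: mderiv_def foldr_funpow)

lemma mderiv_foldr:
  "\<exists>bs. set bs \<subseteq> Basis \<and> (\<forall>F. mderiv \<alpha> F = foldr partial bs F)"
  by (rule exI[of _ "concat (map (\<lambda>b. replicate (\<alpha> b) b) basis_list)"])
     (simp add: mderiv_eq_foldr, auto simp: set_basis_list)

lemma mderiv_0: "mderiv (\<lambda>_. 0) F = F"
proof -
  have "foldr (\<lambda>b. partial b ^^ 0) xs F = F" for xs by (induction xs) auto
  then show ?thesis by (simp add: mderiv_def)
qed

text \<open>The derivatives in \<^const>\<open>mderiv\<close> are taken in the order of \<^const>\<open>basis_list\<close>,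
  so a further derivative can be put in front only in a direction that comes no later than
  those already used. This avoids the symmetry of mixed partial derivatives.\<close>

lemma mderiv_Suc:
  assumes "basis_list = bs @ b # bs'" and "\<And>b'. b' \<in> set bs \<Longrightarrow> \<alpha> b' = 0"
  shows "mderiv (\<alpha>(b := Suc (\<alpha> b))) F = partial b (mderiv \<alpha> F)"
proof -
  have "distinct (bs @ b # bs')" using distinct_basis_list assms(1) by metis
  then have nb: "b \<notin> set bs" "b \<notin> set bs'" by auto
  have id: "foldr (\<lambda>c. partial c ^^ \<beta> c) bs G = G" if "\<And>c. c \<in> set bs \<Longrightarrow> \<beta> c = 0" for \<beta> G
    using that by (induction bs) auto
  have "foldr (\<lambda>c. partial c ^^ (\<alpha>(b := Suc (\<alpha> b))) c) bs' F = foldr (\<lambda>c. partial c ^^ \<alpha> c) bs' F"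
    using nb by (intro foldr_cong) auto
  moreover have "foldr (\<lambda>c. partial c ^^ (\<alpha>(b := Suc (\<alpha> b))) c) bs G = G"
    "foldr (\<lambda>c. partial c ^^ \<alpha> c) bs G = G" for G
    using nb assms(2) by (intro id; auto)+
  ultimately show ?thesis
    by (simp add: mderiv_def assms(1) del: fun_upd_apply) simp
qed

text \<open>Identifies pure derivatives along one line as multi-index derivatives, for which the
  analytic bounds are stated.\<close>

lemma mderiv_single:
  assumes "b \<in> Basis"
  shows "mderiv (\<lambda>c. if c = b then n else 0) F = (partial b ^^ n) F"
proof (induction n)
  case 0
  then show ?case using mderiv_0 by (simp cong: if_cong)
next
  case (Suc n)
  obtain bs bs' where split: "basis_list = bs @ b # bs'"
    using assms set_basis_list by (metis split_list)
  have "distinct (bs @ b # bs')" using distinct_basis_list split by metis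
  then have "b \<notin> set bs" by auto
  then have "mderiv ((\<lambda>c. if c = b then n else 0)(b := Suc (if b = b then n else 0))) F =
      partial b (mderiv (\<lambda>c. if c = b then n else 0) F)"
    by (intro mderiv_Suc[OF split]) auto
  moreover have "(\<lambda>c. if c = b then n else 0)(b := Suc (if b = b then n else 0)) = (\<lambda>c. if c = b then Suc n else 0)"
    by auto
  ultimately show ?case using Suc by simp
qed

section \<open>Extension of a real analytic function of one variable\<close>

text \<open>The Taylor series at 0 has terms at most M \<eta>^n |w|^n. On half the radius 1/\<eta>
  they are dominated by a geometric series with sum 2M. It represents \<open>\<phi> 0\<close> on the
  segment because the Taylor remainder is at most 2M (\<rho>\<eta>)^n, with \<rho>\<eta> <
  1.\<close>

lemma real_analytic_extension:
  fixes \<phi> :: "nat \<Rightarrow> real \<Rightarrow> complex"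
  assumes der: "\<And>n t. \<bar>t\<bar> \<le> \<rho> \<Longrightarrow> (\<phi> n has_vector_derivative \<phi> (Suc n) t) (at t)"
    and bound: "\<And>n t. \<bar>t\<bar> \<le> \<rho> \<Longrightarrow> norm (\<phi> n t) \<le> M * \<eta> ^ n * fact n"
    and \<eta>: "0 < \<eta>" and \<rho>: "0 \<le> \<rho>" "\<rho> * \<eta> < 1"
  obtains h where "h holomorphic_on ball 0 (1 / (2 * \<eta>))"
    "\<And>w. w \<in> ball 0 (1 / (2 * \<eta>)) \<Longrightarrow> norm (h w) \<le> 2 * M"
    "\<And>t. \<bar>t\<bar> \<le> \<rho> \<Longrightarrow> of_real t \<in> ball (0::complex) (1 / (2 * \<eta>)) \<Longrightarrow> h (of_real t) = \<phi> 0 t"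
proof
  define a where "a = (\<lambda>n. \<phi> n 0 / fact n)"
  define h where "h = (\<lambda>w. \<Sum>n. a n * w ^ n)"
  have M0: "0 \<le> M" using order_trans[OF norm_ge_zero bound[of 0 0]] \<rho> by simp
  have a_le: "norm (a n) \<le> M * \<eta> ^ n" for n
    using bound[of 0 n] \<rho> by (simp add: a_def norm_divide divide_le_eq)
  have term_le: "norm (a n * w ^ n) \<le> M * (1/2) ^ n" if "w \<in> ball 0 (1 / (2 * \<eta>))" for n w
  proof -
    have "norm w \<le> 1 / (2 * \<eta>)" using that by simp
    then have "norm (a n) * norm w ^ n \<le> (M * \<eta> ^ n) * (1 / (2 * \<eta>)) ^ n"
      using a_le[of n] M0 \<eta> by (intro mult_mono power_mono) auto
    also have "\<dots> = M * (1/2) ^ n"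
      using \<eta> by (simp add: power_divide power_mult_distrib)
    finally show ?thesis by (simp add: norm_mult norm_power)
  qed
  have geo: "(\<lambda>n. M * (1/2) ^ n) sums (M * 2)"
    using geometric_sums[of "1/2 :: real"] by (intro sums_mult) simp
  have summ: "summable (\<lambda>n. a n * w ^ n)" if "w \<in> ball 0 (1 / (2 * \<eta>))" for w
    using term_le[OF that] by (intro summable_comparison_test'[OF sums_summable[OF geo], of 0]) auto
  show "h holomorphic_on ball 0 (1 / (2 * \<eta>))"
    by (rule power_series_holomorphic[where a = a])
       (use summ in \<open>auto simp: h_def intro!: summable_sums\<close>)
  show "norm (h w) \<le> 2 * M" if "w \<in> ball 0 (1 / (2 * \<eta>))" for w
  proof -
    have sn: "summable (\<lambda>n. norm (a n * w ^ n))"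
      using term_le[OF that] by (intro summable_comparison_test'[OF sums_summable[OF geo], of 0]) auto
    have "norm (h w) \<le> (\<Sum>n. norm (a n * w ^ n))" unfolding h_def by (rule summable_norm[OF sn])
    also have "\<dots> \<le> (\<Sum>n. M * (1/2) ^ n)"
      by (rule suminf_le[OF term_le[OF that] sn sums_summable[OF geo]])
    also have "\<dots> = 2 * M" using sums_unique[OF geo] by simp
    finally show ?thesis .
  qed
  fix t :: real assume t: "\<bar>t\<bar> \<le> \<rho>" and tb: "of_real t \<in> ball (0::complex) (1 / (2 * \<eta>))"
  have rem: "norm (\<phi> 0 t - (\<Sum>m<n. a m * of_real t ^ m)) \<le> 2 * M * (\<rho> * \<eta>) ^ n" for n
  proof -
    \<comment> \<open>The Lagrange form of the remainder holds for real valued functions only. It is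
      applied to the real and the imaginary part through L, whence the factor 2 in
      \<open>rem\<close>.\<close>
    have part: "\<bar>L (\<phi> 0 t - (\<Sum>m<n. a m * of_real t ^ m))\<bar> \<le> M * (\<rho> * \<eta>) ^ n"
      if L: "bounded_linear L" and Lle: "\<And>z. \<bar>L z\<bar> \<le> norm z" for L :: "complex \<Rightarrow> real"
    proof -
      interpret L: bounded_linear L by fact
      have "\<exists>s. \<bar>s\<bar> \<le> \<bar>t\<bar> \<and> L (\<phi> 0 t) = (\<Sum>m<n. L (\<phi> m 0) / fact m * t ^ m) + L (\<phi> n s) / fact n * t ^ n"
      proof (rule Maclaurin_bi_le[where diff = "\<lambda>m s. L (\<phi> m s)"])
        show "\<forall>m s. m < n \<and> \<bar>s\<bar> \<le> \<bar>t\<bar> \<longrightarrow> DERIV (\<lambda>s. L (\<phi> m s)) s :> L (\<phi> (Suc m) s)"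
          using L.has_vector_derivative[OF der] t
          by (simp add: has_real_derivative_iff_has_vector_derivative)
      qed simp
      then obtain s where s: "\<bar>s\<bar> \<le> \<bar>t\<bar>"
        "L (\<phi> 0 t) = (\<Sum>m<n. L (\<phi> m 0) / fact m * t ^ m) + L (\<phi> n s) / fact n * t ^ n" by blast
      have "L (a m * of_real t ^ m) = L (\<phi> m 0) / fact m * t ^ m" for m
      proof -
        have "a m * of_real t ^ m = (t ^ m / fact m) *\<^sub>R \<phi> m 0"
          by (simp add: a_def scaleR_conv_of_real field_simps)
        then show ?thesis by (simp add: L.scaleR)
      qed
      then have "L (\<phi> 0 t - (\<Sum>m<n. a m * of_real t ^ m)) = L (\<phi> n s) / fact n * t ^ n"
        using s(2) by (simp add: L.diff L.sum)
      also have "\<bar>\<dots>\<bar> = \<bar>L (\<phi> n s)\<bar> / fact n * \<bar>t\<bar> ^ n" by (simp add: abs_mult power_abs)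
      also have "\<dots> \<le> (M * \<eta> ^ n * fact n) / fact n * \<rho> ^ n"
        using Lle[of "\<phi> n s"] bound[of s n] s(1) t M0 \<eta>
        by (intro mult_mono divide_right_mono power_mono) auto
      also have "\<dots> = M * (\<rho> * \<eta>) ^ n" by (simp add: power_mult_distrib)
      finally show ?thesis .
    qed
    show ?thesis
      using part[OF bounded_linear_Re abs_Re_le_cmod] part[OF bounded_linear_Im abs_Im_le_cmod]
        cmod_le[of "\<phi> 0 t - (\<Sum>m<n. a m * of_real t ^ m)"] by linarith
  qed
  have "(\<lambda>n. 2 * M * (\<rho> * \<eta>) ^ n) \<longlonglongrightarrow> 2 * M * 0"
    using \<rho> \<eta> by (intro tendsto_mult tendsto_const LIMSEQ_power_zero) simp
  then have "(\<lambda>n. 2 * M * (\<rho> * \<eta>) ^ n) \<longlonglongrightarrow> 0" by simp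
  then have "(\<lambda>n. \<phi> 0 t - (\<Sum>m<n. a m * of_real t ^ m)) \<longlonglongrightarrow> 0"
    by (rule Lim_null_comparison[rotated]) (use rem in auto)
  then have "(\<lambda>n. \<phi> 0 t - (\<phi> 0 t - (\<Sum>m<n. a m * of_real t ^ m))) \<longlonglongrightarrow> \<phi> 0 t - 0"
    by (intro tendsto_diff tendsto_const)
  then have "(\<lambda>n. a n * of_real t ^ n) sums \<phi> 0 t" by (simp add: sums_def)
  then show "h (of_real t) = \<phi> 0 t" by (simp add: h_def sums_unique[symmetric])
qed

subsection \<open>Propagation in one coordinate\<close>

text \<open>Replacement of one coordinate, written as a translation along an axis so that its
  derivative in the new coordinate is visibly \<open>axis i\<close>.\<close>

definition cart_upd :: "complex^'p::finite \<Rightarrow> 'p \<Rightarrow> complex \<Rightarrow> complex^'p" where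
  "cart_upd z i \<zeta> = z + axis i (\<zeta> - z $ i)"

lemma cart_upd_nth [simp]: "cart_upd z i \<zeta> $ j = (if j = i then \<zeta> else z $ j)"
  by (simp add: cart_upd_def axis_def)

lemma cart_upd_self [simp]: "cart_upd z i (z $ i) = z"
  by (simp add: vec_eq_iff)

lemma linear_axis: "linear (axis i :: 'a::real_vector \<Rightarrow> 'a^'n::finite)"
  by (rule linearI) (auto simp: vec_eq_iff axis_def)

lemma has_derivative_cart_upd:
  fixes z :: "complex^'p::finite"
  shows "(cart_upd z i has_derivative axis i) (at \<zeta> within X)"
proof -
  have "bounded_linear (axis i :: complex \<Rightarrow> complex^'p)"
    using linear_axis by (rule linear_conv_bounded_linear[THEN iffD1])
  then have "((\<lambda>\<zeta>. axis i (\<zeta> - z $ i) :: complex^'p) has_derivative (\<lambda>v. axis i v)) (at \<zeta> within X)"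
    by (rule bounded_linear.has_derivative) (auto intro!: derivative_eq_intros)
  then have "((\<lambda>\<zeta>. z + axis i (\<zeta> - z $ i)) has_derivative (\<lambda>v. 0 + axis i v)) (at \<zeta> within X)"
    by (intro has_derivative_add has_derivative_const)
  then show ?thesis by (simp add: cart_upd_def[abs_def] fun_eq_iff)
qed

text \<open>Polydiscs, unlike balls, are stable under replacing one coordinate by another point of
  its disc.\<close>

definition polydisc :: "complex^'p::finite \<Rightarrow> real \<Rightarrow> (complex^'p) set" where
  "polydisc c r = {z. \<forall>i. dist (c $ i) (z $ i) \<le> r}"

lemma polydisc_subset_cball: "polydisc c r \<subseteq> cball c (real CARD('p) * r)" for c :: "complex^'p::finite"
proof
  fix z :: "complex^'p" assume z: "z \<in> polydisc c r"
  have "dist c z \<le> (\<Sum>i\<in>UNIV. dist (c $ i) (z $ i))"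
    unfolding dist_vec_def by (rule L2_set_le_sum) simp
  also have "\<dots> \<le> (\<Sum>i\<in>(UNIV::'p set). r)" using z by (intro sum_mono) (simp add: polydisc_def)
  finally show "z \<in> cball c (real CARD('p) * r)" by simp
qed

lemma compact_polydisc: "compact (polydisc c r)"
proof -
  have "closed (polydisc c r)"
    unfolding polydisc_def by (intro closed_Collect_all closed_Collect_le continuous_intros)
  then show ?thesis
    using bounded_subset[OF bounded_cball polydisc_subset_cball] by (simp add: compact_eq_bounded_closed)
qed

lemma polydisc_mono: "r \<le> s \<Longrightarrow> polydisc c r \<subseteq> polydisc c s"
  unfolding polydisc_def by (auto intro: order_trans)

lemma has_derivative_cart_slice:
  fixes z :: "complex^'a::finite"
  assumes "F differentiable (at (cart_upd z i \<zeta>))"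
  shows "((\<lambda>w. F (cart_upd z i w)) has_derivative
    (\<lambda>v. Re v *\<^sub>R partial (axis i 1) F (cart_upd z i \<zeta>) + Im v *\<^sub>R partial (axis i \<i>) F (cart_upd z i \<zeta>))) (at \<zeta>)"
proof -
  obtain D where D: "(F has_derivative D) (at (cart_upd z i \<zeta>))"
    using assms by (auto simp: differentiable_def)
  have "D (axis i v) = Re v *\<^sub>R partial (axis i 1) F (cart_upd z i \<zeta>)
      + Im v *\<^sub>R partial (axis i \<i>) F (cart_upd z i \<zeta>)" for v
  proof -
    have "axis i v = (Re v *\<^sub>R axis i 1 + Im v *\<^sub>R axis i \<i> :: complex^'a)"
      by (auto simp: vec_eq_iff axis_def complex_eq_iff)
    from arg_cong[OF this, of D] have "D (axis i v) = Re v *\<^sub>R D (axis i 1) + Im v *\<^sub>R D (axis i \<i>)"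
      by (simp only: linear_add[OF has_derivative_linear[OF D]] linear_scale[OF has_derivative_linear[OF D]])
    then show ?thesis by (simp only: has_derivative_imp_partial[OF D])
  qed
  then show ?thesis
    using has_derivative_compose[where f = "cart_upd z i" and g = F, OF has_derivative_cart_upd D]
    by simp
qed

text \<open>On the slice through z the function F is within 2 R d of the Cauchy transform h of its
  boundary values on the circle of radius R, and h is truly holomorphic. The Remez inequality for h
  is then translated back, at the nodes and at z. The same d bounds F at the nodes and its d-bar
  derivative, so both errors enter through \<open>L ^ n * d\<close>.\<close>

lemma remez_slice_estimate:
  fixes F :: "complex^'p::finite \<Rightarrow> complex" and X :: "nat \<Rightarrow> complex"
  assumes \<Omega>: "open \<Omega>" "polydisc c R \<subseteq> \<Omega>" and F: "smooth_on \<Omega> F"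
    and \<rho>: "0 < \<rho>" "10 * \<rho> < R" and \<kappa>: "0 < \<kappa>" and n: "0 < n" and z: "z \<in> polydisc c \<rho>"
    and M: "\<And>x. x \<in> polydisc c R \<Longrightarrow> norm (F x) \<le> M"
    and d: "\<And>x. x \<in> polydisc c R \<Longrightarrow> norm (dbar i F x) \<le> d"
    and X: "\<And>k. k < n \<Longrightarrow> X k \<in> cball (c $ i) \<rho>" "\<And>k. k < n \<Longrightarrow> norm (F (cart_upd z i (X k))) \<le> d"
    and sep: "\<And>k l. k < n \<Longrightarrow> l < n \<Longrightarrow> \<kappa> * \<bar>real k - real l\<bar> / n \<le> dist (X k) (X l)"
  shows "norm (F z) \<le> (2 + 4 * R) * (M / 2 ^ n + remez_const \<rho> \<kappa> ^ n * d)"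
proof -
  define L where "L = remez_const \<rho> \<kappa>"
  have R: "0 < R" using \<rho> by linarith
  define g where "g = (\<lambda>\<zeta>. F (cart_upd z i \<zeta>))"
  define gx where "gx = (\<lambda>\<zeta>. partial (axis i 1) F (cart_upd z i \<zeta>))"
  define gy where "gy = (\<lambda>\<zeta>. partial (axis i \<i>) F (cart_upd z i \<zeta>))"
  have in_pd: "cart_upd z i \<zeta> \<in> polydisc c R" if "\<zeta> \<in> cball (c $ i) R" for \<zeta>
  proof -
    have "z \<in> polydisc c R" using z polydisc_mono[of \<rho> R c] \<rho> by auto
    then show ?thesis using that by (simp add: polydisc_def)
  qed
  have der: "(g has_derivative (\<lambda>v. Re v *\<^sub>R gx \<zeta> + Im v *\<^sub>R gy \<zeta>)) (at \<zeta>)" if "\<zeta> \<in> cball (c $ i) R" for \<zeta>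
    unfolding g_def gx_def gy_def
    using smooth_on_differentiable[OF F \<Omega>(1), of "[]"] in_pd[OF that] \<Omega>(2)
    by (intro has_derivative_cart_slice) auto
  have Basis: "axis i (1::complex) \<in> Basis" "axis i \<i> \<in> Basis"
    by (auto simp: Basis_complex_def)
  have cupd: "continuous_on Y (cart_upd z i)" for Y
    by (rule has_derivative_continuous_on[OF has_derivative_cart_upd])
  have cont: "continuous_on (cball (c $ i) R) gx" "continuous_on (cball (c $ i) R) gy"
    unfolding gx_def gy_def using in_pd \<Omega>(2) Basis
      smooth_on_continuous_on[OF F, of "[axis i 1]"] smooth_on_continuous_on[OF F, of "[axis i \<i>]"]
    by (auto intro!: continuous_on_compose2[OF _ cupd])
  have contg: "continuous_on (sphere (c $ i) R) g"
    by (rule has_derivative_continuous_on[OF has_derivative_at_withinI[OF der]]) auto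
  define h where "h = (\<lambda>\<zeta>. contour_integral (circlepath (c $ i) R) (\<lambda>u. g u / (u - \<zeta>)) / (2 * pi * \<i>))"
  have gh: "norm (g \<zeta> - h \<zeta>) \<le> 2 * R * d" if "\<zeta> \<in> ball (c $ i) R" for \<zeta>
    unfolding h_def
    by (rule approx_cauchy_formula[OF der cont _ that])
       (use d[OF in_pd] in \<open>auto simp: gx_def gy_def dbar_def\<close>)
  have h: "h holomorphic_on ball (c $ i) R" "\<And>\<zeta>. \<zeta> \<in> ball (c $ i) (R/2) \<Longrightarrow> norm (h \<zeta>) \<le> 2 * M"
    unfolding h_def by (rule cauchy_transform[OF R contg]; use M in_pd in \<open>auto simp: g_def\<close>)+
  have zi: "z $ i \<in> cball (c $ i) \<rho>" using z by (simp add: polydisc_def)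
  have sub: "cball (c $ i) \<rho> \<subseteq> ball (c $ i) R" using \<rho> by auto
  have hX: "norm (h (X k)) \<le> (1 + 2 * R) * d" if "k < n" for k
  proof -
    have "norm (h (X k)) \<le> norm (g (X k)) + norm (g (X k) - h (X k))"
      using norm_triangle_ineq4[of "g (X k)" "g (X k) - h (X k)"] by simp
    also have "\<dots> \<le> d + 2 * R * d"
      using X[OF that] gh[of "X k"] sub by (intro add_mono) (auto simp: g_def)
    finally show ?thesis by (simp add: algebra_simps)
  qed
  have d0: "0 \<le> d" using X(2)[OF n] norm_ge_zero order_trans by blast
  have "c \<in> polydisc c R" using R by (simp add: polydisc_def)
  then have M0: "0 \<le> M" using M norm_ge_zero order_trans by blast
  have L1: "1 \<le> L" unfolding L_def by (rule remez_const_ge_1[OF \<rho>(1) \<kappa>])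
  have hz: "norm (h (z $ i)) \<le> 2 * M / 2 ^ n + L ^ n * ((1 + 2 * R) * d)"
    unfolding L_def
  \<comment> \<open>The bound 2M for the transform holds on radius R/2; there the requirement of the
    Remez inequality reads 5\<rho> < R/2.\<close>
  proof (rule holomorphic_remez[where h = h and z = "z $ i" and R = "R/2" and c = "c $ i" and X = X])
    show "h holomorphic_on ball (c $ i) (R / 2)"
      using h(1) R by (auto elim!: holomorphic_on_subset)
  qed (use h(2) \<rho> \<kappa> n X(1) hX sep zi in auto)
  have "norm (F z) \<le> norm (h (z $ i)) + norm (g (z $ i) - h (z $ i))"
    using norm_triangle_ineq[of "h (z $ i)" "g (z $ i) - h (z $ i)"] by (simp add: g_def)
  also have "\<dots> \<le> 2 * M / 2 ^ n + L ^ n * ((1 + 2 * R) * d) + 2 * R * d"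
    using hz gh[of "z $ i"] zi sub by (intro add_mono) auto
  also have "2 * R * d \<le> L ^ n * (2 * R * d)"
    using mult_right_mono[OF one_le_power[OF L1, of n], of "2 * R * d"] R d0 by simp
  finally have "norm (F z) \<le> 2 * (M / 2 ^ n) + (1 + 4 * R) * (L ^ n * d)"
    by (simp add: algebra_simps)
  also have "\<dots> \<le> (2 + 4 * R) * (M / 2 ^ n) + (2 + 4 * R) * (L ^ n * d)"
    using R M0 d0 L1 by (intro add_mono mult_right_mono) auto
  finally show ?thesis by (simp add: L_def algebra_simps)
qed

text \<open>The nodes may vary with z and n, but \<kappa> does not, so the slice estimate holds with
  the same constants for all z of the set and all n. This is the form in which the degree can be
  adapted to \<epsilon>.\<close>

lemma holomorphic_coordinate_step:
  fixes f :: "(complex^'p::finite) net"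
  assumes \<Omega>: "open \<Omega>" "polydisc c R \<subseteq> \<Omega>" and f: "f \<in> smooth_nets \<Omega>"
    and \<rho>: "0 < \<rho>" "10 * \<rho> < R" and \<kappa>: "0 < \<kappa>"
    and moderate: "moderate_on f (polydisc c R)"
    and dbar: "negligible_on (\<lambda>\<epsilon>. dbar i (f \<epsilon>)) (polydisc c R)"
    and V: "negligible_on f V"
  shows "negligible_on f {z \<in> polydisc c \<rho>. spread_out \<kappa> {\<zeta>\<in>cball (c $ i) \<rho>. cart_upd z i \<zeta> \<in> V}}"
    (is "negligible_on f ?W")
proof -
  define W where "W = ?W"
  define L where "L = remez_const \<rho> \<kappa>"
  obtain a where a: "\<forall>\<^sub>F \<epsilon> in at_right 0. \<forall>x\<in>polydisc c R. norm (f \<epsilon> x) \<le> \<epsilon> powr a"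
    using moderate by (auto simp: moderate_on_def)
  have "negligible_on f W"
  proof (rule negligible_on_by_degree_choice[where A = "2 + 4 * R" and L = L and N = "- a"])
    show "1 \<le> L" unfolding L_def by (rule remez_const_ge_1[OF \<rho>(1) \<kappa>])
    show "0 \<le> 2 + 4 * R" using \<rho> by linarith
    fix k :: real
    show "\<forall>\<^sub>F \<epsilon> in at_right 0. \<forall>x\<in>W. \<forall>n>0. norm (f \<epsilon> x)
        \<le> (2 + 4 * R) * (\<epsilon> powr - (- a) / 2 ^ n + L ^ n * \<epsilon> powr k)"
      using negligible_onD[OF dbar, of k] negligible_onD[OF V, of k] a eventually_at_right_0_unit
    proof eventually_elim
      case (elim \<epsilon>)
      show ?case
      proof (intro ballI allI impI)
        fix z and n :: nat assume z: "z \<in> W" and n: "0 < n"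
        from z have zc: "z \<in> polydisc c \<rho>" by (simp add: W_def)
        have "spread_out \<kappa> {\<zeta>\<in>cball (c $ i) \<rho>. cart_upd z i \<zeta> \<in> V}" using z by (simp only: W_def mem_Collect_eq)
        then obtain X where X: "\<And>k. k < n \<Longrightarrow> X k \<in> {\<zeta>\<in>cball (c $ i) \<rho>. cart_upd z i \<zeta> \<in> V}"
          "\<And>k l. k < n \<Longrightarrow> l < n \<Longrightarrow> \<kappa> * \<bar>real k - real l\<bar> / n \<le> dist (X k) (X l)"
          by (rule spread_outE[OF _ n]) blast
        have "norm (f \<epsilon> z)
          \<le> (2 + 4 * R) * (\<epsilon> powr a / 2 ^ n + remez_const \<rho> \<kappa> ^ n * \<epsilon> powr k)"
        proof (rule remez_slice_estimate[where F = "f \<epsilon>" and X = X and i = i, OF \<Omega> _ \<rho> \<kappa> n zc])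
          show "smooth_on \<Omega> (f \<epsilon>)" using f elim by (simp add: smooth_nets_def)
          show "norm (f \<epsilon> x) \<le> \<epsilon> powr a" "norm (dbar i (f \<epsilon>) x) \<le> \<epsilon> powr k" if "x \<in> polydisc c R" for x
            using elim that by blast+
          show "X j \<in> cball (c $ i) \<rho>" "norm (f \<epsilon> (cart_upd z i (X j))) \<le> \<epsilon> powr k" if "j < n" for j
            using X(1) elim that by blast+
          show "\<kappa> * \<bar>real k - real l\<bar> / n \<le> dist (X k) (X l)" if "k < n" "l < n" for k l
            using that by (rule X(2))
        qed
        then show "norm (f \<epsilon> z) \<le> (2 + 4 * R) * (\<epsilon> powr - (- a) / 2 ^ n + L ^ n * \<epsilon> powr k)"
          by (simp add: L_def)
      qed
    qed
  qed
  then show ?thesis by (simp only: W_def)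
qed

text \<open>Along a segment in direction b inside \<omega> the net extends to holomorphic functions
  on a disc of radius 1/(2\<eta>), bounded by 2 \<eta> \<epsilon>^(-a). The Remez inequality is
  applied there with all nodes on the real axis. Points are described by the midpoint y of their
  segment, about which the extension is centred.\<close>

lemma analytic_coordinate_step:
  fixes g :: "'a::euclidean_space net"
  assumes \<omega>: "open \<omega>" and g: "g \<in> smooth_nets \<omega>" and b: "b \<in> Basis"
    and \<eta>: "0 < \<eta>" and \<epsilon>0: "0 < \<epsilon>0"
    and bound: "\<And>\<epsilon> \<alpha> x. 0 < \<epsilon> \<Longrightarrow> \<epsilon> < \<epsilon>0 \<Longrightarrow> x \<in> \<omega> \<Longrightarrow>
      norm (mderiv \<alpha> (g \<epsilon>) x) \<le> \<eta> ^ (mi_length \<alpha> + 1) * mi_fact \<alpha> * \<epsilon> powr (- a)"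
    and \<rho>: "0 < \<rho>" "10 * \<rho> * \<eta> < 1" and \<kappa>: "0 < \<kappa>"
    and V: "negligible_on g V"
  shows "negligible_on g {z. (\<exists>y u. (\<forall>t. \<bar>t\<bar> \<le> \<rho> \<longrightarrow> y + t *\<^sub>R b \<in> \<omega>) \<and> \<bar>u\<bar> \<le> \<rho> \<and> z = y + u *\<^sub>R b \<and>
      spread_out \<kappa> {t. \<bar>t\<bar> \<le> \<rho> \<and> y + t *\<^sub>R b \<in> V})}"
    (is "negligible_on g ?W")
proof -
  define W where "W = ?W"
  have "negligible_on g W"
  proof (rule negligible_on_by_degree_choice
      [where A = "1 + 2 * \<eta>" and L = "remez_const \<rho> \<kappa>" and N = "a"])
  show L1: "1 \<le> remez_const \<rho> \<kappa>" by (rule remez_const_ge_1[OF \<rho>(1) \<kappa>])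
  show "0 \<le> 1 + 2 * \<eta>" using \<eta> by simp
  fix k :: real
  note negligible_onD[OF V, of k]
  moreover have "\<forall>\<^sub>F \<epsilon> in at_right 0. \<epsilon> \<in> {0<..<\<epsilon>0}"
    using \<epsilon>0 by (rule eventually_at_right_real)
  ultimately show "\<forall>\<^sub>F \<epsilon> in at_right 0. \<forall>x\<in>W. \<forall>n>0. norm (g \<epsilon> x)
      \<le> (1 + 2 * \<eta>) * (\<epsilon> powr - a / 2 ^ n + remez_const \<rho> \<kappa> ^ n * \<epsilon> powr k)"
    using eventually_at_right_0_unit
  proof eventually_elim
    case (elim \<epsilon>)
    have sm: "smooth_on \<omega> (g \<epsilon>)" using g elim by (auto simp: smooth_nets_def)
    show ?case
    proof (intro ballI allI impI)
      fix z and n :: nat assume z: "z \<in> W" and n: "0 < n"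
      from z obtain y u where y: "\<forall>t. \<bar>t\<bar> \<le> \<rho> \<longrightarrow> y + t *\<^sub>R b \<in> \<omega>" "\<bar>u\<bar> \<le> \<rho>" "z = y + u *\<^sub>R b" and
        sep: "spread_out \<kappa> {t. \<bar>t\<bar> \<le> \<rho> \<and> y + t *\<^sub>R b \<in> V}"
        unfolding W_def mem_Collect_eq by (elim exE conjE)
      obtain t where t0: "\<And>k. k < n \<Longrightarrow> t k \<in> {t. \<bar>t\<bar> \<le> \<rho> \<and> y + t *\<^sub>R b \<in> V}"
        "\<And>k l. k < n \<Longrightarrow> l < n \<Longrightarrow> \<kappa> * \<bar>real k - real l\<bar> / n \<le> dist (t k) (t l)"
        by (rule spread_outE[OF sep n]) blast
      then have t: "\<And>k. k < n \<Longrightarrow> \<bar>t k\<bar> \<le> \<rho>" "\<And>k. k < n \<Longrightarrow> y + t k *\<^sub>R b \<in> V"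
        "\<And>k l. k < n \<Longrightarrow> l < n \<Longrightarrow> \<kappa> * \<bar>real k - real l\<bar> / n \<le> \<bar>t k - t l\<bar>"
        by (auto simp: dist_real_def)
      note y_in = y(1)[rule_format]
      define \<phi> where "\<phi> = (\<lambda>m s. (partial b ^^ m) (g \<epsilon>) (y + s *\<^sub>R b))"
      have "(\<phi> m has_vector_derivative \<phi> (Suc m) s) (at s)" if "\<bar>s\<bar> \<le> \<rho>" for m s
      proof -
        have "(partial b ^^ m) (g \<epsilon>) differentiable (at (y + s *\<^sub>R b))"
          unfolding funpow_partial using b y_in[OF that]
          by (intro smooth_on_differentiable[OF sm \<omega>]) auto
        then show ?thesis
          unfolding \<phi>_def using has_vector_derivative_partial by fastforce
      qed
      \<comment> \<open>The multi-index concentrated at b has length m and factorial m!; of the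
        power \<eta>^(m+1) one factor is moved into the constant.\<close>
      moreover have "norm (\<phi> m s) \<le> (\<eta> * \<epsilon> powr - a) * \<eta> ^ m * fact m" if "\<bar>s\<bar> \<le> \<rho>" for m s
      proof -
        have "mi_length (\<lambda>c. if c = b then m else 0) = m"
          using b by (simp add: mi_length_def sum.delta)
        moreover have "mi_fact (\<lambda>c. if c = b then m else 0) = fact m"
        proof -
          have "(\<Prod>c\<in>Basis. fact (if c = b then m else 0) :: real) = (\<Prod>c\<in>Basis. if c = b then fact m else 1)"
            by (intro prod.cong) auto
          then show ?thesis using b by (simp add: mi_fact_def prod.delta)
        qed
        ultimately show ?thesis
          using bound[of \<epsilon> "y + s *\<^sub>R b" "\<lambda>c. if c = b then m else 0"] elim y_in[OF that]
          by (simp add: \<phi>_def mderiv_single[OF b] mult_ac)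
      qed
      moreover have "\<rho> * \<eta> < 1"
      proof -
        have "0 < \<rho> * \<eta>" using \<rho> \<eta> by simp
        then show ?thesis using \<rho> by linarith
      qed
      ultimately obtain h where h: "h holomorphic_on ball 0 (1 / (2 * \<eta>))"
        "\<And>w. w \<in> ball 0 (1 / (2 * \<eta>)) \<Longrightarrow> norm (h w) \<le> 2 * (\<eta> * \<epsilon> powr - a)"
        "\<And>s. \<bar>s\<bar> \<le> \<rho> \<Longrightarrow> of_real s \<in> ball (0::complex) (1 / (2 * \<eta>)) \<Longrightarrow> h (of_real s) = \<phi> 0 s"
        using \<rho>(1) \<eta> by (elim real_analytic_extension[of \<rho> \<phi> "\<eta> * \<epsilon> powr - a" \<eta>, rotated 5]) auto
      \<comment> \<open>The disc of the extension must contain that of radius 5\<rho>, which is the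
        meaning of the condition 10 \<rho> \<eta> < 1.\<close>
      have r: "5 * \<rho> < 1 / (2 * \<eta>)" using \<rho> \<eta> by (simp add: field_simps)
      have h\<phi>: "h (of_real s) = \<phi> 0 s" if "\<bar>s\<bar> \<le> \<rho>" for s
        using that r \<rho> by (intro h(3)) auto
      have "norm (h (of_real u)) \<le> 2 * (\<eta> * \<epsilon> powr - a) / 2 ^ n + remez_const \<rho> \<kappa> ^ n * \<epsilon> powr k"
      proof (rule holomorphic_remez[OF h(1,2) \<rho>(1) r \<kappa> n, where X = "\<lambda>k. of_real (t k)"])
        show "norm (h (of_real (t i))) \<le> \<epsilon> powr k" if "i < n" for i
          using h\<phi>[OF t(1)[OF that]] t(2)[OF that] elim by (simp add: \<phi>_def)
        show "\<kappa> * \<bar>real i - real j\<bar> / n \<le> dist (complex_of_real (t i)) (of_real (t j))" if "i < n" "j < n" for i j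
          using t(3)[OF that] by (simp add: dist_norm flip: of_real_diff)
      qed (use t y in auto)
      then have "norm (g \<epsilon> z) \<le> (2 * \<eta>) * (\<epsilon> powr - a / 2 ^ n) + 1 * (remez_const \<rho> \<kappa> ^ n * \<epsilon> powr k)"
        using h\<phi>[OF y(2)] by (simp add: \<phi>_def y(3) mult_ac)
      also have "\<dots> \<le> (1 + 2 * \<eta>) * (\<epsilon> powr - a / 2 ^ n) + (1 + 2 * \<eta>) * (remez_const \<rho> \<kappa> ^ n * \<epsilon> powr k)"
        using \<eta> L1 by (intro add_mono mult_right_mono) auto
      finally show "norm (g \<epsilon> z) \<le> (1 + 2 * \<eta>) * (\<epsilon> powr - a / 2 ^ n + remez_const \<rho> \<kappa> ^ n * \<epsilon> powr k)"
        by (simp add: algebra_simps)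
    qed
  qed
qed
  then show ?thesis by (simp only: W_def)
qed

subsection \<open>Propagation from sets of positive measure\<close>

text \<open>A product of intervals in the real coordinates, so that it fits Fubini's theorem and is
  stable under changing one coordinate. It covers C^p as well, whose basis consists of real and
  imaginary directions.\<close>

definition cube :: "'a::euclidean_space \<Rightarrow> real \<Rightarrow> 'a set" where
  "cube x r = {z. \<forall>b\<in>Basis. \<bar>z \<bullet> b - x \<bullet> b\<bar> \<le> r}"

lemma ball_subset_cube: "ball x r \<subseteq> cube x r"
proof
  fix z assume "z \<in> ball x r"
  then have "norm (z - x) \<le> r" by (simp add: dist_norm norm_minus_commute)
  then show "z \<in> cube x r"
    unfolding cube_def mem_Collect_eq inner_diff_left[symmetric]
    by (meson Basis_le_norm order_trans)
qed

lemma cube_subset_cball: "cube x r \<subseteq> cball x (DIM('a) * r)" for x :: "'a::euclidean_space" and r :: real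
proof
  fix z assume z: "z \<in> cube x r"
  have "norm (z - x) \<le> (\<Sum>b\<in>Basis. \<bar>(z - x) \<bullet> b\<bar>)" by (rule norm_le_l1)
  also have "\<dots> \<le> (\<Sum>b\<in>(Basis::'a set). r)"
    using z by (intro sum_mono) (simp add: cube_def inner_diff_left)
  finally show "z \<in> cball x (DIM('a) * r)" by (simp add: dist_norm norm_minus_commute)
qed

lemma compact_cube: "compact (cube x r)"
proof -
  have "closed (cube x r)"
    unfolding cube_def Ball_def
    by (intro closed_Collect_all closed_Collect_imp closed_Collect_le continuous_intros) auto
  then show ?thesis
    by (meson bounded_cball bounded_subset compact_eq_bounded_closed cube_subset_cball)
qed

text \<open>The local uniqueness principle, isolated as a common interface: what follows it is the
  same for holomorphic and for real analytic nets.\<close>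

definition propagates_in_cube :: "'a::euclidean_space net \<Rightarrow> 'a \<Rightarrow> real \<Rightarrow> bool" where
  "propagates_in_cube f x r \<longleftrightarrow>
     (\<forall>E\<in>sets borel. E \<subseteq> cube x r \<longrightarrow> 0 < emeasure lborel E \<longrightarrow> negligible_on f E \<longrightarrow>
        negligible_on f (cube x r))"

text \<open>Lebesgue measure is the image of the product measure over the basis, which reduces the
  principle to a step in one real direction.\<close>

lemma propagates_in_cubeI:
  fixes f :: "'a::euclidean_space net"
  assumes step: "\<And>b \<kappa> V. b \<in> Basis \<Longrightarrow> 0 < \<kappa> \<Longrightarrow> V \<subseteq> cube x r \<Longrightarrow> negligible_on f V \<Longrightarrow>
    negligible_on f {z\<in>cube x r. spread_out \<kappa> {t. \<bar>t - x \<bullet> b\<bar> \<le> r \<and> z + (t - z \<bullet> b) *\<^sub>R b \<in> V}}"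
  shows "propagates_in_cube f x r"
  unfolding propagates_in_cube_def
proof (intro ballI impI)
  fix E assume E: "E \<in> sets borel" "E \<subseteq> cube x r" "0 < emeasure lborel E" "negligible_on f E"
  interpret product_sigma_finite "\<lambda>_::'a. lborel :: real measure" by standard
  define \<phi> where "\<phi> = (\<lambda>t::'a \<Rightarrow> real. \<Sum>b\<in>Basis. t b *\<^sub>R b)"
  define T where "T = (\<lambda>b. {x \<bullet> b - r..x \<bullet> b + r})"
  define P where "P = (PiM Basis (\<lambda>_. lborel) :: ('a \<Rightarrow> real) measure)"
  have \<phi>: "\<phi> \<in> measurable P borel"
    unfolding \<phi>_def P_def by measurable
  have \<phi>_inner: "\<phi> t \<bullet> b = t b" if "b \<in> Basis" for t and b :: 'a
    using that by (simp add: \<phi>_def inner_sum_left inner_Basis if_distrib cong: if_cong)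
  define E' where "E' = \<phi> -` E \<inter> space P"
  have E': "E' \<in> sets P" unfolding E'_def by (rule measurable_sets[OF \<phi> E(1)])
  have "emeasure lborel E = emeasure P E'"
    unfolding E'_def lborel_eq[where 'a = 'a] using \<phi> E(1)
    by (subst emeasure_distr) (auto simp: \<phi>_def[abs_def] P_def)
  then have pos: "0 < emeasure P E'" using E(3) by simp
  have in_T: "t b \<in> T b" if "t \<in> E'" "b \<in> Basis" for t and b :: 'a
  proof -
    have "\<phi> t \<in> cube x r" using that E(2) by (auto simp: E'_def)
    then have "\<bar>t b - x \<bullet> b\<bar> \<le> r" using that \<phi>_inner by (simp add: cube_def)
    then show ?thesis by (auto simp: T_def)
  qed
  have E'T: "E' \<subseteq> PiE Basis T"
    using in_T by (auto simp: E'_def P_def space_PiM PiE_def)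
  have upd_inner: "(z + (s - z \<bullet> b) *\<^sub>R b) \<bullet> b' = (if b' = b then s else z \<bullet> b')"
    if "b \<in> Basis" "b' \<in> Basis" for b b' z :: 'a and s
    using that by (simp add: inner_add_left inner_Basis)
  show "negligible_on f (cube x r)"
  proof (rule coordinatewise_propagation[where I = Basis and K = Basis and E = E' and T = T
        and agr = "\<lambda>b z s. z \<bullet> b = s" and upd = "\<lambda>b z s. z + (s - z \<bullet> b) *\<^sub>R b"
        and U = "negligible_on f"])
    fix V W assume "negligible_on f V" "W \<subseteq> V"
    then show "negligible_on f W" by (rule negligible_on_subset)
  next
    fix b :: 'a and c :: real and V assume b: "b \<in> Basis" and c: "0 < c" and V: "V \<subseteq> cube x r" "negligible_on f V"
    \<comment> \<open>Slices of length at least c are turned into spread out ones with the same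
      constant c/2 for all z.\<close>
    have claim: "spread_out (c / 2) {t. \<bar>t - x \<bullet> b\<bar> \<le> r \<and> z + (t - z \<bullet> b) *\<^sub>R b \<in> V}"
      if B: "B \<in> sets lborel" "B \<subseteq> T b" "ennreal c \<le> emeasure lborel B"
        "\<forall>s\<in>B. z + (s - z \<bullet> b) *\<^sub>R b \<in> V" for z B
    proof -
      have bB: "bounded B" using B(2) unfolding T_def by (rule bounded_subset[OF bounded_closed_interval])
      have "c \<le> measure lborel B"
        using B(3) emeasure_bounded_finite[OF bB] by (simp add: emeasure_eq_ennreal_measure less_top)
      from spread_out_positive_length[OF B(1)[unfolded sets_lborel] bB c this] show ?thesis
      proof (rule spread_out_subset, intro subsetI CollectI conjI)
        fix s assume s: "s \<in> B"
        then have "s \<in> T b" using B(2) by blast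
        then show "\<bar>s - x \<bullet> b\<bar> \<le> r" by (simp add: T_def abs_le_iff)
        show "z + (s - z \<bullet> b) *\<^sub>R b \<in> V" using s B(4) by blast
      qed
    qed
    have "{z \<in> cube x r. \<exists>B\<in>sets lborel. B \<subseteq> T b \<and> ennreal c \<le> emeasure lborel B \<and>
          (\<forall>s\<in>B. z + (s - z \<bullet> b) *\<^sub>R b \<in> V)}
       \<subseteq> {z\<in>cube x r. spread_out (c / 2) {t. \<bar>t - x \<bullet> b\<bar> \<le> r \<and> z + (t - z \<bullet> b) *\<^sub>R b \<in> V}}"
      using claim by blast
    then show "negligible_on f {z \<in> cube x r. \<exists>B\<in>sets lborel. B \<subseteq> T b \<and> ennreal c \<le> emeasure lborel B \<and>
          (\<forall>s\<in>B. z + (s - z \<bullet> b) *\<^sub>R b \<in> V)}"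
      by (rule negligible_on_subset[OF step[OF b half_gt_zero[OF c] V]])
  next
    fix b z :: 'a and s assume "b \<in> Basis" "z \<in> cube x r" "s \<in> T b"
    then show "z + (s - z \<bullet> b) *\<^sub>R b \<in> cube x r"
      by (auto simp: cube_def upd_inner T_def)
  next
    show "E' \<in> sets (Pi\<^sub>M Basis (\<lambda>_. lborel))" using E' unfolding P_def .
  next
    show "0 < emeasure (Pi\<^sub>M Basis (\<lambda>_. lborel)) E'" using pos unfolding P_def .
  next
    \<comment> \<open>When all coordinates are prescribed, the starting set of the propagation is
      contained in E itself.\<close>
    have "z \<in> E" if "t \<in> E'" "\<forall>b\<in>Basis. z \<bullet> b = t b" for z :: 'a and t
    proof -
      have "z = \<phi> t" by (rule euclidean_eqI) (simp add: \<phi>_inner that(2))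
      then show ?thesis using that(1) by (simp add: E'_def)
    qed
    then have "{z \<in> cube x r. \<exists>t\<in>E'. \<forall>b\<in>Basis. z \<bullet> b = t b} \<subseteq> E" by blast
    then show "negligible_on f {z \<in> cube x r. \<exists>t\<in>E'. \<forall>b\<in>Basis. z \<bullet> b = t b}"
      by (rule negligible_on_subset[OF E(4)])
  qed (simp_all add: upd_inner E'T)
qed

section \<open>From one cube to a connected open set\<close>

text \<open>Otherwise S is covered by open sets that each meet it in a null set, and by Lindelof
  countably many suffice. The statement is kept general in M because it serves Lebesgue measure and
  the parameter measure of curves.\<close>

lemma exists_support_point:
  fixes S :: "'a::second_countable_topology set"
  assumes S: "S \<in> sets M" "0 < emeasure M S" and op: "\<And>U. open U \<Longrightarrow> S \<inter> U \<in> sets M"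
  shows "\<exists>x\<in>S. \<forall>U. open U \<and> x \<in> U \<longrightarrow> 0 < emeasure M (S \<inter> U)"
proof (rule ccontr)
  assume "\<not> ?thesis"
  then have "\<forall>x\<in>S. \<exists>U. open U \<and> x \<in> U \<and> emeasure M (S \<inter> U) = 0"
    by (auto simp: zero_less_iff_neq_zero)
  then obtain U where U: "\<And>x. x \<in> S \<Longrightarrow> open (U x)" "\<And>x. x \<in> S \<Longrightarrow> x \<in> U x"
    "\<And>x. x \<in> S \<Longrightarrow> emeasure M (S \<inter> U x) = 0" by metis
  obtain \<F> where \<F>: "\<F> \<subseteq> U ` S" "countable \<F>" "\<Union>\<F> = \<Union>(U ` S)"
    using Lindelof[of "U ` S"] U(1) by auto
  have "(\<Union>V\<in>\<F>. S \<inter> V) \<in> null_sets M"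
  proof (rule null_sets_UN'[OF \<F>(2)])
    fix V assume "V \<in> \<F>"
    then show "S \<inter> V \<in> null_sets M" using \<F>(1) U op by (auto simp: null_sets_def)
  qed
  moreover have "S = (\<Union>V\<in>\<F>. S \<inter> V)" using \<F>(3) U(2) by blast
  ultimately have "emeasure M S = 0" by (metis null_setsD1)
  then show False using S by simp
qed

lemma emeasure_lborel_open_pos:
  fixes E :: "'a::euclidean_space set"
  assumes "open E" "E \<noteq> {}"
  shows "0 < emeasure lborel E"
proof -
  have "E \<notin> null_sets lebesgue"
    using open_not_negligible[OF assms] by (simp add: negligible_iff_null_sets)
  then show ?thesis
    using assms(1) by (auto simp: null_sets_def zero_less_iff_neq_zero)
qed

text \<open>The Egorov argument, with the identity as parametrization, supplies the uniformly
  negligible set from which the cube is filled.\<close>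

lemma negligible_on_cube:
  fixes f :: "'a::euclidean_space net"
  assumes \<omega>: "open \<omega>" and cont: "\<And>\<epsilon>. \<epsilon> \<in> {0<..<1} \<Longrightarrow> continuous_on \<omega> (f \<epsilon>)"
    and cube: "cube x r \<subseteq> \<omega>" "propagates_in_cube f x r"
    and B: "B \<in> sets borel" "0 < emeasure lborel (B \<inter> cube x r)"
    and neg: "\<And>y. y \<in> B \<inter> cube x r \<Longrightarrow> (\<lambda>\<epsilon>. f \<epsilon> y) \<in> negligible_numbers"
  shows "negligible_on f (cube x r)"
proof -
  have cb: "cube x r \<in> sets borel" by (rule borel_compact[OF compact_cube])
  have "emeasure lborel (B \<inter> cube x r) < \<infinity>"
    using compact_cube compact_imp_bounded by (intro emeasure_bounded_finite) blast
  then have "\<exists>E\<in>sets lborel. E \<subseteq> B \<inter> cube x r \<and> 0 < emeasure lborel E \<and> negligible_on f ((\<lambda>y. y) ` E)"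
    using B cb cube(1) by (intro exists_negligible_on_subset[OF \<omega> cont _ _ _ _ _ neg]) auto
  then obtain E where "E \<in> sets borel" "E \<subseteq> cube x r" "0 < emeasure lborel E" "negligible_on f E"
    by auto
  then show ?thesis using cube(2) by (simp add: propagates_in_cube_def)
qed

text \<open>The points with a negligible neighbourhood form a set that is open and, by the local
  principle, relatively closed in \<omega>.\<close>

lemma negligible_on_spread:
  fixes f :: "'a::euclidean_space net"
  assumes \<omega>: "open \<omega>" "connected \<omega>"
    and propagates: "\<And>x. x \<in> \<omega> \<Longrightarrow> \<exists>r>0. cube x r \<subseteq> \<omega> \<and> propagates_in_cube f x r"
    and x0: "x0 \<in> \<omega>" "0 < r0" "negligible_on f (ball x0 r0)"
    and x: "x \<in> \<omega>"
  shows "\<exists>r>0. negligible_on f (ball x r)"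
proof (rule ccontr)
  assume x_bad: "\<not> ?thesis"
  define G where "G = {x\<in>\<omega>. \<exists>r>0. negligible_on f (ball x r)}"
  have "open G"
    unfolding open_contains_ball
  proof
    fix y assume y: "y \<in> G"
    then obtain r :: real where r: "0 < r" "negligible_on f (ball y r)" by (auto simp: G_def)
    obtain s where s: "0 < s" "ball y s \<subseteq> \<omega>" using y \<omega> by (auto simp: G_def open_contains_ball)
    have "ball y (min r s) \<subseteq> G"
    proof
      fix z assume z: "z \<in> ball y (min r s)"
      have "ball z (r - dist y z) \<subseteq> ball y r"
      proof
        fix w assume "w \<in> ball z (r - dist y z)"
        then show "w \<in> ball y r" using dist_triangle[of y w z] by simp
      qed
      then have "negligible_on f (ball z (r - dist y z))"
        by (rule negligible_on_subset[OF r(2)])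
      moreover have "0 < r - dist y z" "z \<in> \<omega>" using z s by auto
      ultimately show "z \<in> G" unfolding G_def by blast
    qed
    then show "\<exists>e>0. ball y e \<subseteq> G" using r s by (intro exI[of _ "min r s"]) auto
  qed
  \<comment> \<open>If a ball inside the cube about y met G, it would contain a nonempty open set
    where f is negligible; such a set has positive measure, so negligibility would fill the cube and
    y would lie in G.\<close>
  moreover have "open (\<omega> - G)"
    unfolding open_contains_ball
  proof
    fix y assume y: "y \<in> \<omega> - G"
    then obtain r where r: "0 < r" "cube y r \<subseteq> \<omega>" "propagates_in_cube f y r" using propagates by blast
    have "z \<notin> G" if z: "z \<in> ball y r" for z
    proof
      assume "z \<in> G"
      then obtain s where s: "0 < s" "negligible_on f (ball z s)" by (auto simp: G_def)
      define E where "E = ball z s \<inter> ball y r"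
      have "open E" "z \<in> E" using z s by (auto simp: E_def)
      then have "0 < emeasure lborel E" by (intro emeasure_lborel_open_pos) auto
      moreover have "E \<subseteq> cube y r" using ball_subset_cube unfolding E_def by blast
      moreover have "negligible_on f E"
        using s(2) by (rule negligible_on_subset) (simp add: E_def)
      ultimately have "negligible_on f (cube y r)"
        using r(3) borel_open[OF \<open>open E\<close>] by (simp add: propagates_in_cube_def)
      then have "negligible_on f (ball y r)"
        using ball_subset_cube by (rule negligible_on_subset)
      then have "y \<in> G" using y r(1) unfolding G_def by blast
      then show False using y by blast
    qed
    then have "ball y r \<subseteq> \<omega> - G" using r(2) ball_subset_cube[of y r] by blast
    then show "\<exists>e>0. ball y e \<subseteq> \<omega> - G" using r by blast
  qed
  moreover have "x0 \<in> G" "x \<in> \<omega> - G" using x0 x x_bad by (auto simp: G_def)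
  ultimately show False
    using connectedD[OF \<omega>(2), of G "\<omega> - G"] x0(1) x by (auto simp: G_def)
qed

text \<open>The thresholds for \<epsilon> differ from ball to ball; compactness leaves finitely many
  of them.\<close>

lemma negligible_on_compact:
  fixes f :: "'a::euclidean_space net"
  assumes "\<And>x. x \<in> K \<Longrightarrow> \<exists>r>0. negligible_on f (ball x r)" "compact K"
  shows "negligible_on f K"
proof -
  obtain r where r: "\<And>x. x \<in> K \<Longrightarrow> 0 < r x" "\<And>x. x \<in> K \<Longrightarrow> negligible_on f (ball x (r x))"
    using assms(1) by metis
  have "K \<subseteq> (\<Union>x\<in>K. ball x (r x))" using r(1) by force
  then obtain C where C: "C \<subseteq> K" "finite C" "K \<subseteq> (\<Union>x\<in>C. ball x (r x))"
    using compactE_image[OF assms(2), of K "\<lambda>x. ball x (r x)"] by auto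
  have "negligible_on f (\<Union>((\<lambda>x. ball x (r x)) ` C))"
    using C r(2) by (intro negligible_on_Union) auto
  then show ?thesis using C(3) by (rule negligible_on_subset)
qed

lemma lebesgue_borel_part:
  assumes "A \<in> sets lebesgue" "0 < emeasure lebesgue A"
  obtains B where "B \<in> sets borel" "B \<subseteq> A" "0 < emeasure lborel B"
proof
  show "main_part lborel A \<in> sets borel" using main_part_sets[OF assms(1)] by simp
  show "main_part lborel A \<subseteq> A" using main_part_null_part_Un[OF assms(1)] by blast
  show "0 < emeasure lborel (main_part lborel A)" using assms by (simp add: emeasure_completion)
qed

text \<open>The size of the propagating cubes is not under control, so the starting point is chosen
  such that every neighbourhood of it meets the set in positive measure.\<close>

lemma negligible_on_from_positive_measure:
  fixes f :: "'a::euclidean_space net"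
  assumes \<omega>: "open \<omega>" "connected \<omega>" and cont: "\<And>\<epsilon>. \<epsilon> \<in> {0<..<1} \<Longrightarrow> continuous_on \<omega> (f \<epsilon>)"
    and propagates: "\<And>x. x \<in> \<omega> \<Longrightarrow> \<exists>r>0. cube x r \<subseteq> \<omega> \<and> propagates_in_cube f x r"
    and A: "A \<subseteq> \<omega>" "A \<in> sets lebesgue" "0 < emeasure lebesgue A"
    and neg: "\<And>x. x \<in> A \<Longrightarrow> (\<lambda>\<epsilon>. f \<epsilon> x) \<in> negligible_numbers"
    and x: "x \<in> \<omega>"
  shows "\<exists>r>0. negligible_on f (ball x r)"
proof -
  obtain B where B: "B \<in> sets borel" "B \<subseteq> A" "0 < emeasure lborel B"
    using lebesgue_borel_part[OF A(2,3)] by blast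
  obtain y where y: "y \<in> B" "\<forall>U. open U \<and> y \<in> U \<longrightarrow> 0 < emeasure lborel (B \<inter> U)"
    using exists_support_point[of B lborel] B by auto
  obtain r where r: "0 < r" "cube y r \<subseteq> \<omega>" "propagates_in_cube f y r" using propagates y A B by blast
  have "0 < emeasure lborel (B \<inter> ball y r)" using y(2) r(1) by simp
  also have "\<dots> \<le> emeasure lborel (B \<inter> cube y r)"
    using B(1) borel_compact[OF compact_cube[of y r]] ball_subset_cube[of y r] by (intro emeasure_mono) auto
  finally have "negligible_on f (cube y r)"
    using B A neg by (intro negligible_on_cube[OF \<omega>(1) cont r(2,3) B(1)]) auto
  then have "negligible_on f (ball y r)" using ball_subset_cube by (rule negligible_on_subset)
  then show ?thesis using y B A r by (intro negligible_on_spread[OF \<omega> propagates _ r(1) _ x]) auto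
qed

section \<open>Local propagation for holomorphic and for real analytic nets\<close>

lemma Basis_complex_cartE:
  fixes b :: "complex^'p::finite"
  assumes "b \<in> Basis"
  obtains i u where "b = axis i u" "u \<in> {1, \<i>}"
  using assms by (auto simp: Basis_vec_def Basis_complex_def)

text \<open>The side is halved because a modulus is estimated by the sum of the real and imaginary
  parts.\<close>

lemma cube_subset_polydisc:
  fixes x :: "complex^'p::finite"
  shows "cube x (\<rho> / 2) \<subseteq> polydisc x \<rho>"
proof
  fix z assume z: "z \<in> cube x (\<rho> / 2)"
  have "dist (x $ i) (z $ i) \<le> \<rho>" for i
  proof -
    have B: "axis i (1::complex) \<in> Basis" "axis i \<i> \<in> Basis"
      by (auto simp: Basis_complex_def)
    have "\<bar>Re (z $ i) - Re (x $ i)\<bar> \<le> \<rho> / 2"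
      using z B(1) by (auto simp: cube_def inner_axis inner_complex_def dest!: bspec[of _ _ "axis i 1"])
    moreover have "\<bar>Im (z $ i) - Im (x $ i)\<bar> \<le> \<rho> / 2"
      using z B(2) by (auto simp: cube_def inner_axis inner_complex_def dest!: bspec[of _ _ "axis i \<i>"])
    ultimately show ?thesis
      using cmod_le[of "z $ i - x $ i"] by (simp add: dist_norm norm_minus_commute)
  qed
  then show "z \<in> polydisc x \<rho>" by (simp add: polydisc_def)
qed

text \<open>A step in a real basis direction is a step in one complex coordinate with nodes on a
  real line. The complex step fills a whole disc; only its trace on the cube is used.\<close>

lemma holomorphic_propagates:
  fixes f :: "(complex^'p::finite) net"
  assumes \<Omega>: "open \<Omega>" and f: "f \<in> smooth_nets \<Omega>"
    and moderate: "\<And>K. compact K \<Longrightarrow> K \<subseteq> \<Omega> \<Longrightarrow> moderate_on f K"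
    and dbar: "\<And>K i. compact K \<Longrightarrow> K \<subseteq> \<Omega> \<Longrightarrow> negligible_on (\<lambda>\<epsilon>. dbar i (f \<epsilon>)) K"
    and x: "x \<in> \<Omega>"
  shows "\<exists>r>0. cube x r \<subseteq> \<Omega> \<and> propagates_in_cube f x r"
proof -
  obtain e where e: "0 < e" "cball x e \<subseteq> \<Omega>" using \<Omega> x by (auto simp: open_contains_cball)
  define R where "R = e / real CARD('p)"
  have R: "0 < R" using e by (simp add: R_def)
  have pd: "polydisc x R \<subseteq> \<Omega>"
    using polydisc_subset_cball[of x R] e by (auto simp: R_def)
  \<comment> \<open>Any fraction of R below 1/10 meets the condition \<open>10 * \<rho> < R\<close>
    of the coordinate step.\<close>
  define \<rho> where "\<rho> = R / 11"
  have \<rho>: "0 < \<rho>" "10 * \<rho> < R" using R by (auto simp: \<rho>_def)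
  have cube: "cube x (\<rho> / 2) \<subseteq> polydisc x \<rho>" by (rule cube_subset_polydisc)
  have sub: "polydisc x \<rho> \<subseteq> polydisc x R" using \<rho> by (intro polydisc_mono) auto
  have "propagates_in_cube f x (\<rho> / 2)"
  proof (rule propagates_in_cubeI)
    fix b :: "complex^'p" and \<kappa> :: real and V :: "(complex^'p) set"
    assume b: "b \<in> Basis" and \<kappa>: "0 < \<kappa>" and V: "V \<subseteq> cube x (\<rho> / 2)" "negligible_on f V"
    obtain i u where iu: "b = axis i u" "u \<in> {1, \<i>}" using b by (rule Basis_complex_cartE)
    have u: "norm u = 1" using iu(2) by auto
    have upd: "cart_upd z i (z $ i + (t - z \<bullet> b) *\<^sub>R u) = z + (t - z \<bullet> b) *\<^sub>R b" for z t
      by (simp add: vec_eq_iff iu(1) axis_def)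
    \<comment> \<open>The line runs in direction u with |u| = 1, so parameters and points of the
      disc have the same mutual distances.\<close>
    have conv: "spread_out \<kappa> {\<zeta>\<in>cball (x $ i) \<rho>. cart_upd z i \<zeta> \<in> V}"
      if "spread_out \<kappa> {t. \<bar>t - x \<bullet> b\<bar> \<le> \<rho> / 2 \<and> z + (t - z \<bullet> b) *\<^sub>R b \<in> V}" for z
    proof -
      have "spread_out (1 * \<kappa>) {\<zeta>\<in>cball (x $ i) \<rho>. cart_upd z i \<zeta> \<in> V}"
      proof (rule spread_out_image[OF that, where \<phi> = "\<lambda>t. z $ i + (t - z \<bullet> b) *\<^sub>R u"])
        fix t assume "t \<in> {t. \<bar>t - x \<bullet> b\<bar> \<le> \<rho> / 2 \<and> z + (t - z \<bullet> b) *\<^sub>R b \<in> V}"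
        then have V': "cart_upd z i (z $ i + (t - z \<bullet> b) *\<^sub>R u) \<in> V" by (simp only: upd mem_Collect_eq)
        then have "cart_upd z i (z $ i + (t - z \<bullet> b) *\<^sub>R u) \<in> polydisc x \<rho>" using V(1) cube by blast
        then have "dist (x $ i) (cart_upd z i (z $ i + (t - z \<bullet> b) *\<^sub>R u) $ i) \<le> \<rho>" unfolding polydisc_def by blast
        with V' show "z $ i + (t - z \<bullet> b) *\<^sub>R u \<in> {\<zeta>\<in>cball (x $ i) \<rho>. cart_upd z i \<zeta> \<in> V}" by simp
      next
        fix s t
        have "(z $ i + (s - z \<bullet> b) *\<^sub>R u) - (z $ i + (t - z \<bullet> b) *\<^sub>R u) = (s - t) *\<^sub>R u"
          by (simp add: algebra_simps)
        then have "dist (z $ i + (s - z \<bullet> b) *\<^sub>R u) (z $ i + (t - z \<bullet> b) *\<^sub>R u) = dist s t"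
          unfolding dist_norm by (simp only: norm_scaleR u) simp
        then show "1 * dist s t \<le> dist (z $ i + (s - z \<bullet> b) *\<^sub>R u) (z $ i + (t - z \<bullet> b) *\<^sub>R u)" by simp
      qed simp
      then show ?thesis by simp
    qed
    have "negligible_on f {z \<in> polydisc x \<rho>. spread_out \<kappa> {\<zeta>\<in>cball (x $ i) \<rho>. cart_upd z i \<zeta> \<in> V}}"
      by (rule holomorphic_coordinate_step[OF \<Omega> pd f \<rho> \<kappa> moderate[OF compact_polydisc pd] dbar[OF compact_polydisc pd] V(2)])
    then show "negligible_on f {z\<in>cube x (\<rho> / 2).
        spread_out \<kappa> {t. \<bar>t - x \<bullet> b\<bar> \<le> \<rho> / 2 \<and> z + (t - z \<bullet> b) *\<^sub>R b \<in> V}}"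
      by (rule negligible_on_subset) (use conv cube in blast)
  qed
  moreover have "cube x (\<rho> / 2) \<subseteq> \<Omega>" using cube sub pd by blast
  ultimately show ?thesis using \<rho>(1) by (intro exI[of _ "\<rho> / 2"]) simp
qed

lemma negligible_on_diff_iff:
  assumes "negligible_on (\<lambda>\<epsilon> x. f \<epsilon> x - g \<epsilon> x) V"
  shows "negligible_on f V \<longleftrightarrow> negligible_on g V"
proof
  assume "negligible_on f V"
  from negligible_on_diff[OF this assms] show "negligible_on g V" by simp
next
  assume g: "negligible_on g V"
  have "negligible_on (\<lambda>\<epsilon> x. g \<epsilon> x - f \<epsilon> x) V"
    using assms by (simp add: negligible_on_def norm_minus_commute)
  from negligible_on_diff[OF g this] show "negligible_on f V" by simp
qed

text \<open>The derivative bounds are known for the local net g, whereas propagation is wanted for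
  f. On the compact cube the two differ negligibly, so either may be used.\<close>

lemma analytic_propagates:
  fixes f g :: "'a::euclidean_space net"
  assumes g: "g \<in> smooth_nets (ball x r)" and r: "0 < r"
    and \<eta>: "0 < \<eta>" and \<epsilon>0: "0 < \<epsilon>0"
    and bound: "\<And>\<epsilon> \<alpha> y. 0 < \<epsilon> \<Longrightarrow> \<epsilon> < \<epsilon>0 \<Longrightarrow> y \<in> ball x r \<Longrightarrow>
      norm (mderiv \<alpha> (g \<epsilon>) y) \<le> \<eta> ^ (mi_length \<alpha> + 1) * mi_fact \<alpha> * \<epsilon> powr (- a)"
    and fg: "\<And>K. compact K \<Longrightarrow> K \<subseteq> ball x r \<Longrightarrow> negligible_on (\<lambda>\<epsilon> y. f \<epsilon> y - g \<epsilon> y) K"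
  shows "\<exists>s>0. cube x s \<subseteq> ball x r \<and> propagates_in_cube f x s"
proof -
  \<comment> \<open>The first bound keeps the cube, which lies in the closed ball of radius
    dimension times s, inside the ball of radius r; the second gives
    \<open>10 * s * \<eta> < 1\<close>.\<close>
  define s where "s = min (r / (2 * DIM('a))) (1 / (20 * \<eta>))"
  have s: "0 < s" using r \<eta> by (simp add: s_def)
  have "s \<le> 1 / (20 * \<eta>)" by (simp add: s_def)
  then have s\<eta>: "10 * s * \<eta> < 1" using \<eta> by (simp add: field_simps)
  have "DIM('a) * s \<le> DIM('a) * (r / (2 * DIM('a)))" by (intro mult_left_mono) (auto simp: s_def)
  also have "\<dots> < r" using r by simp
  finally have sub: "cube x s \<subseteq> ball x r" using cube_subset_cball[of x s] by auto
  have fgc: "negligible_on f V \<longleftrightarrow> negligible_on g V" if "V \<subseteq> cube x s" for V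
    by (rule negligible_on_diff_iff[OF negligible_on_subset[OF fg[OF compact_cube sub] that]])
  have "propagates_in_cube f x s"
  proof (rule propagates_in_cubeI)
    fix b :: 'a and \<kappa> :: real and V :: "'a set"
    assume b: "b \<in> Basis" and \<kappa>: "0 < \<kappa>" and V: "V \<subseteq> cube x s" "negligible_on f V"
    have Vg: "negligible_on g V" using V fgc by blast
    define W where "W = {z\<in>cube x s. spread_out \<kappa> {t. \<bar>t - x \<bullet> b\<bar> \<le> s \<and> z + (t - z \<bullet> b) *\<^sub>R b \<in> V}}"
    have claim: "\<exists>y u. (\<forall>t. \<bar>t\<bar> \<le> s \<longrightarrow> y + t *\<^sub>R b \<in> ball x r) \<and> \<bar>u\<bar> \<le> s \<and> z = y + u *\<^sub>R b \<and>
      spread_out \<kappa> {t. \<bar>t\<bar> \<le> s \<and> y + t *\<^sub>R b \<in> V}" if z: "z \<in> W" for z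
    proof -
      have zc: "z \<in> cube x s" using z by (simp add: W_def)
      \<comment> \<open>The segment through z is centred at y, where coordinate b agrees with that
        of x; then its parameters range over exactly [-s, s].\<close>
      define u where "u = z \<bullet> b - x \<bullet> b"
      define y where "y = z - u *\<^sub>R b"
      have "\<bar>u\<bar> \<le> s" using zc b by (simp add: cube_def u_def)
      moreover have "z = y + u *\<^sub>R b" by (simp add: y_def)
      moreover have "y + t *\<^sub>R b \<in> ball x r" if "\<bar>t\<bar> \<le> s" for t
      proof -
        have "\<bar>(y + t *\<^sub>R b) \<bullet> b' - x \<bullet> b'\<bar> \<le> s" if "b' \<in> Basis" for b'
          using that zc b \<open>\<bar>t\<bar> \<le> s\<close>
          by (cases "b' = b") (auto simp: y_def u_def inner_add_left inner_diff_left inner_Basis cube_def)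
        then have "y + t *\<^sub>R b \<in> cube x s" by (simp add: cube_def)
        then show ?thesis using sub by blast
      qed
      moreover have "spread_out (1 * \<kappa>) {t. \<bar>t\<bar> \<le> s \<and> y + t *\<^sub>R b \<in> V}"
      proof (rule spread_out_image[where \<phi> = "\<lambda>t. t - x \<bullet> b"])
        show "spread_out \<kappa> {t. \<bar>t - x \<bullet> b\<bar> \<le> s \<and> z + (t - z \<bullet> b) *\<^sub>R b \<in> V}"
          using z unfolding W_def by blast
        have "z + (t - z \<bullet> b) *\<^sub>R b = y + (t - x \<bullet> b) *\<^sub>R b" for t
          by (simp add: y_def u_def algebra_simps)
        then show "t - x \<bullet> b \<in> {t. \<bar>t\<bar> \<le> s \<and> y + t *\<^sub>R b \<in> V}"
          if "t \<in> {t. \<bar>t - x \<bullet> b\<bar> \<le> s \<and> z + (t - z \<bullet> b) *\<^sub>R b \<in> V}" for t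
          using that by simp
      qed (simp_all add: dist_real_def)
      ultimately show ?thesis unfolding mult_1 by blast
    qed
    have "negligible_on g W"
      by (rule negligible_on_subset[OF analytic_coordinate_step[OF open_ball g b \<eta> \<epsilon>0 bound s s\<eta> \<kappa> Vg]])
         (use claim in blast)+
    moreover have "W \<subseteq> cube x s" by (simp add: W_def)
    ultimately have "negligible_on f W" using fgc by blast
    then show "negligible_on f {z\<in>cube x s. spread_out \<kappa> {t. \<bar>t - x \<bullet> b\<bar> \<le> s \<and> z + (t - z \<bullet> b) *\<^sub>R b \<in> V}}" unfolding W_def .
  qed
  then show ?thesis using s sub by blast
qed

subsection \<open>Negligibility of derivatives\<close>

text \<open>The first order expansion h \<phi>'(0) = \<phi>(h) - \<phi>(0) - remainder, with
  remainder at most h^2 M. It bounds the first derivative by the values, at the price of a second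
  derivative that may be large if h is small.\<close>

lemma landau_inequality:
  fixes \<phi> \<phi>' \<phi>'' :: "real \<Rightarrow> complex"
  assumes h: "0 < h"
    and d1: "\<And>t. t \<in> {0..h} \<Longrightarrow> (\<phi> has_vector_derivative \<phi>' t) (at t)"
    and d2: "\<And>t. t \<in> {0..h} \<Longrightarrow> (\<phi>' has_vector_derivative \<phi>'' t) (at t)"
    and M: "\<And>t. t \<in> {0..h} \<Longrightarrow> norm (\<phi>'' t) \<le> M"
    and \<delta>: "norm (\<phi> 0) \<le> \<delta>" "norm (\<phi> h) \<le> \<delta>"
  shows "norm (\<phi>' 0) \<le> 2 * \<delta> / h + h * M"
proof -
  have mvt: "norm (\<psi> b - \<psi> 0) \<le> b * C"
    if b: "0 < b" "b \<le> h" and d: "\<And>t. t \<in> {0..h} \<Longrightarrow> (\<psi> has_vector_derivative \<psi>' t) (at t)"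
      and C: "\<And>t. 0 < t \<Longrightarrow> t < b \<Longrightarrow> norm (\<psi>' t) \<le> C" for \<psi> \<psi>' :: "real \<Rightarrow> complex" and b C
  proof -
    have cont: "continuous_on {0..b} \<psi>"
    proof (rule continuous_at_imp_continuous_on, rule ballI)
      fix t assume "t \<in> {0..b}"
      then show "isCont \<psi> t" using b by (intro has_vector_derivative_continuous[OF d]) auto
    qed
    have "\<exists>t\<in>{0<..<b}. norm (\<psi> b - \<psi> 0) \<le> norm ((b - 0) *\<^sub>R \<psi>' t)"
    proof (rule mvt_general[OF b(1) cont])
      fix t assume "0 < t" "t < b"
      then have "(\<psi> has_vector_derivative \<psi>' t) (at t)" using b by (intro d) auto
      then show "(\<psi> has_derivative (\<lambda>s. s *\<^sub>R \<psi>' t)) (at t)" by (simp add: has_vector_derivative_def)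
    qed
    then obtain t where t: "0 < t" "t < b" "norm (\<psi> b - \<psi> 0) \<le> b * norm (\<psi>' t)"
      using b by auto
    note t(3)
    also have "b * norm (\<psi>' t) \<le> b * C" using C[OF t(1,2)] b by (intro mult_left_mono) auto
    finally show ?thesis .
  qed
  have M0: "0 \<le> M" using order_trans[OF norm_ge_zero M[of 0]] h by simp
  have 1: "norm (\<phi>' t - \<phi>' 0) \<le> h * M" if t: "0 < t" "t < h" for t
  proof -
    have "norm (\<phi>' t - \<phi>' 0) \<le> t * M"
      by (rule mvt[OF t(1) less_imp_le[OF t(2)] d2]) (use M t in auto)
    also have "\<dots> \<le> h * M" using t M0 by (intro mult_right_mono) auto
    finally show ?thesis .
  qed
  \<comment> \<open>The linear part is removed so that the mean value inequality for \<psi>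
    estimates the remainder.\<close>
  define \<psi> where "\<psi> = (\<lambda>t. \<phi> t - t *\<^sub>R \<phi>' 0)"
  have "norm (\<psi> h - \<psi> 0) \<le> h * (h * M)"
  proof (rule mvt[OF h order_refl _ 1])
    fix t assume t: "t \<in> {0..h}"
    have "((\<lambda>t. t *\<^sub>R \<phi>' 0) has_vector_derivative \<phi>' 0) (at t)"
      by (auto intro!: derivative_eq_intros)
    then show "(\<psi> has_vector_derivative \<phi>' t - \<phi>' 0) (at t)"
      unfolding \<psi>_def by (rule has_vector_derivative_diff[OF d1[OF t]])
  qed
  moreover have "h *\<^sub>R \<phi>' 0 = (\<phi> h - \<phi> 0) - (\<psi> h - \<psi> 0)" by (simp add: \<psi>_def)
  ultimately have "norm (h *\<^sub>R \<phi>' 0) \<le> norm (\<phi> h - \<phi> 0) + h * (h * M)"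
    by (metis add_left_mono norm_triangle_ineq4 order_trans)
  also have "norm (\<phi> h - \<phi> 0) \<le> \<delta> + \<delta>"
    using \<delta> norm_triangle_ineq4[of "\<phi> h" "\<phi> 0"] by linarith
  finally have "h * norm (\<phi>' 0) \<le> 2 * \<delta> + h * (h * M)" using h by simp
  then show ?thesis using h by (simp add: field_simps)
qed

text \<open>The step length is a power \<epsilon>^m: the values are smaller than any power and
  survive division by it, while the moderate second derivative is beaten by the factor
  \<epsilon>^m.\<close>

lemma negligible_on_partial:
  fixes G :: "'a::euclidean_space net"
  assumes \<omega>: "open \<omega>" and K: "compact K" "K \<subseteq> \<omega>" and b: "b \<in> Basis"
    and d1: "\<And>\<epsilon> x. \<epsilon> \<in> {0<..<1} \<Longrightarrow> x \<in> \<omega> \<Longrightarrow> G \<epsilon> differentiable (at x)"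
    and d2: "\<And>\<epsilon> x. \<epsilon> \<in> {0<..<1} \<Longrightarrow> x \<in> \<omega> \<Longrightarrow> partial b (G \<epsilon>) differentiable (at x)"
    and neg: "\<And>K. compact K \<Longrightarrow> K \<subseteq> \<omega> \<Longrightarrow> negligible_on G K"
    and moderate: "\<And>K. compact K \<Longrightarrow> K \<subseteq> \<omega> \<Longrightarrow> moderate_on (\<lambda>\<epsilon>. partial b (partial b (G \<epsilon>))) K"
  shows "negligible_on (\<lambda>\<epsilon>. partial b (G \<epsilon>)) K"
proof -
  obtain d where d: "0 < d" "(\<Union>x\<in>K. cball x d) \<subseteq> \<omega>"
    using compact_subset_open_imp_cball_epsilon_subset[OF K(1) \<omega> K(2)] by blast
  \<comment> \<open>The compact set swept out by K along b, on which the values and the second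
    derivative must be controlled.\<close>
  define K' where "K' = (\<lambda>(x, t). x + t *\<^sub>R b) ` (K \<times> {0..d})"
  have K'_in: "x + t *\<^sub>R b \<in> K'" if "x \<in> K" "t \<in> {0..d}" for x t
    using that unfolding K'_def by force
  have K': "compact K'"
    unfolding K'_def split_beta
    by (intro compact_continuous_image continuous_intros compact_Times K(1)) simp
  have K'\<omega>: "K' \<subseteq> \<omega>"
  proof
    fix y assume "y \<in> K'"
    then obtain x t where y: "y = x + t *\<^sub>R b" "x \<in> K" "t \<in> {0..d}" unfolding K'_def by auto
    then have "y \<in> cball x d" using b by (simp add: dist_norm)
    then show "y \<in> \<omega>" using y(2) d(2) by blast
  qed
  obtain N where N: "\<forall>\<^sub>F \<epsilon> in at_right 0. \<forall>x\<in>K'. norm (partial b (partial b (G \<epsilon>)) x) \<le> \<epsilon> powr N"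
    using moderate[OF K' K'\<omega>] by (auto simp: moderate_on_def)
  show ?thesis
  proof (rule negligible_onI)
    fix a :: real
    \<comment> \<open>Chosen so that m + N \<ge> a, which settles the second derivative term; m
      \<ge> 1 makes the step length at most d for small \<epsilon>.\<close>
    define m where "m = \<bar>a - N\<bar> + 1"
    have "\<forall>\<^sub>F \<epsilon> in at_right 0. \<forall>x\<in>K. norm (partial b (G \<epsilon>) x) \<le> 3 * \<epsilon> powr a"
      using N negligible_onD[OF neg[OF K' K'\<omega>], of "a + m"] eventually_at_right_0_unit
        eventually_const_times_powr_le[of "1 / d" "m - 1"]
    proof eventually_elim
      case (elim \<epsilon>)
      then have e: "0 < \<epsilon>" "\<epsilon> < 1" by auto
      define h where "h = \<epsilon> powr m"
      have h: "0 < h" using e by (simp add: h_def)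
      have "h / d \<le> \<epsilon> powr (m - 1)" using elim by (simp add: h_def)
      also have "\<dots> \<le> \<epsilon> powr 0" using e by (intro powr_mono') (auto simp: m_def)
      finally have hd: "h \<le> d" using d(1) e by (simp add: field_simps)
      show ?case
      proof
        fix x assume x: "x \<in> K"
        have in\<omega>: "x + t *\<^sub>R b \<in> K'" "x + t *\<^sub>R b \<in> \<omega>" if "t \<in> {0..h}" for t
        proof -
          show "x + t *\<^sub>R b \<in> K'" using that hd by (intro K'_in x) auto
          then show "x + t *\<^sub>R b \<in> \<omega>" using K'\<omega> by blast
        qed
        have "norm (partial b (G \<epsilon>) (x + 0 *\<^sub>R b)) \<le> 2 * \<epsilon> powr (a + m) / h + h * \<epsilon> powr N"
        proof (rule landau_inequality[OF h, where \<phi> = "\<lambda>t. G \<epsilon> (x + t *\<^sub>R b)"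
              and \<phi>' = "\<lambda>t. partial b (G \<epsilon>) (x + t *\<^sub>R b)"
              and \<phi>'' = "\<lambda>t. partial b (partial b (G \<epsilon>)) (x + t *\<^sub>R b)"])
          fix t assume t: "t \<in> {0..h}"
          show "((\<lambda>t. G \<epsilon> (x + t *\<^sub>R b)) has_vector_derivative partial b (G \<epsilon>) (x + t *\<^sub>R b)) (at t)"
            by (rule has_vector_derivative_partial[OF d1[OF elim(3) in\<omega>(2)[OF t]]])
          show "((\<lambda>t. partial b (G \<epsilon>) (x + t *\<^sub>R b)) has_vector_derivative partial b (partial b (G \<epsilon>)) (x + t *\<^sub>R b)) (at t)"
            by (rule has_vector_derivative_partial[OF d2[OF elim(3) in\<omega>(2)[OF t]]])
          show "norm (partial b (partial b (G \<epsilon>)) (x + t *\<^sub>R b)) \<le> \<epsilon> powr N"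
            using elim(1) in\<omega>(1)[OF t] by blast
        next
          show "norm (G \<epsilon> (x + 0 *\<^sub>R b)) \<le> \<epsilon> powr (a + m)" "norm (G \<epsilon> (x + h *\<^sub>R b)) \<le> \<epsilon> powr (a + m)"
            using bspec[OF elim(2) in\<omega>(1)[of 0]] bspec[OF elim(2) in\<omega>(1)[of h]] h by simp_all
        qed
        also have "2 * \<epsilon> powr (a + m) / h = 2 * \<epsilon> powr a" using e by (simp add: h_def powr_add)
        also have "h * \<epsilon> powr N = \<epsilon> powr (m + N)" by (simp add: h_def powr_add)
        also have "\<dots> \<le> \<epsilon> powr a" using e by (intro powr_mono') (auto simp: m_def)
        finally show "norm (partial b (G \<epsilon>) x) \<le> 3 * \<epsilon> powr a" by simp
      qed
    qed
    then show "\<exists>C. \<forall>\<^sub>F \<epsilon> in at_right 0. \<forall>x\<in>K. norm (partial b (G \<epsilon>) x) \<le> C * \<epsilon> powr a" by blast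
  qed
qed

section \<open>The ideal of negligible nets in terms of uniform bounds\<close>

text \<open>\<open>SUP\<close> and pointwise bounds agree once the supremum is genuine: continuity
  of the derivative on the compact K gives an upper bound, and a point of K shows that the supremum
  is nonnegative.\<close>

lemma sup_growth_iff:
  fixes f :: "'a::euclidean_space net"
  assumes f: "f \<in> smooth_nets \<omega>" and K: "compact K" "K \<noteq> {}" "K \<subseteq> \<omega>"
  shows "sup_growth f K \<alpha> a \<longleftrightarrow>
    (\<exists>C. \<forall>\<^sub>F \<epsilon> in at_right 0. \<forall>x\<in>K. norm (mderiv \<alpha> (f \<epsilon>) x) \<le> C * \<epsilon> powr a)"
proof
  have bdd: "bdd_above ((\<lambda>x. norm (mderiv \<alpha> (f \<epsilon>) x)) ` K)" if e: "\<epsilon> \<in> {0<..<1}" for \<epsilon>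
  proof -
    obtain bs where bs: "set bs \<subseteq> (Basis :: 'a set)" "\<And>F. mderiv \<alpha> F = foldr partial bs F"
      using mderiv_foldr[of \<alpha>] by blast
    have "smooth_on \<omega> (f \<epsilon>)" using f e by (simp add: smooth_nets_def)
    from smooth_on_continuous_on[OF this bs(1)]
    have "continuous_on K (mderiv \<alpha> (f \<epsilon>))" using K(3) by (simp add: bs(2) continuous_on_subset)
    then have "compact ((\<lambda>x. norm (mderiv \<alpha> (f \<epsilon>) x)) ` K)"
      by (intro compact_continuous_image continuous_on_norm K(1))
    then show ?thesis by (intro bounded_imp_bdd_above compact_imp_bounded)
  qed
  {
    assume "sup_growth f K \<alpha> a"
    then obtain C where "\<forall>\<^sub>F \<epsilon> in at_right 0. norm (SUP x\<in>K. norm (mderiv \<alpha> (f \<epsilon>) x)) \<le> C * norm (\<epsilon> powr a)"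
      unfolding sup_growth_def by (elim landau_o.bigE)
    then have "\<forall>\<^sub>F \<epsilon> in at_right 0. \<forall>x\<in>K. norm (mderiv \<alpha> (f \<epsilon>) x) \<le> C * \<epsilon> powr a"
      using eventually_at_right_0_unit
    proof eventually_elim
      case (elim \<epsilon>)
      show ?case
      proof
        fix x assume "x \<in> K"
        then have "norm (mderiv \<alpha> (f \<epsilon>) x) \<le> (SUP x\<in>K. norm (mderiv \<alpha> (f \<epsilon>) x))"
          by (rule cSUP_upper[OF _ bdd[OF elim(2)]])
        also have "\<dots> \<le> norm (SUP x\<in>K. norm (mderiv \<alpha> (f \<epsilon>) x))" by simp
        finally show "norm (mderiv \<alpha> (f \<epsilon>) x) \<le> C * \<epsilon> powr a" using elim(1) by simp
      qed
    qed
    then show "\<exists>C. \<forall>\<^sub>F \<epsilon> in at_right 0. \<forall>x\<in>K. norm (mderiv \<alpha> (f \<epsilon>) x) \<le> C * \<epsilon> powr a" by blast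
  }
  assume "\<exists>C. \<forall>\<^sub>F \<epsilon> in at_right 0. \<forall>x\<in>K. norm (mderiv \<alpha> (f \<epsilon>) x) \<le> C * \<epsilon> powr a"
  then obtain C where C: "\<forall>\<^sub>F \<epsilon> in at_right 0. \<forall>x\<in>K. norm (mderiv \<alpha> (f \<epsilon>) x) \<le> C * \<epsilon> powr a" by blast
  show "sup_growth f K \<alpha> a"
    unfolding sup_growth_def
  proof (rule bigoI)
    show "\<forall>\<^sub>F \<epsilon> in at_right 0. norm (SUP x\<in>K. norm (mderiv \<alpha> (f \<epsilon>) x)) \<le> C * norm (\<epsilon> powr a)"
      using C eventually_at_right_0_unit
    proof eventually_elim
      case (elim \<epsilon>)
      obtain x where x: "x \<in> K" using K(2) by blast
      have "0 \<le> norm (mderiv \<alpha> (f \<epsilon>) x)" by simp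
      also have "\<dots> \<le> (SUP x\<in>K. norm (mderiv \<alpha> (f \<epsilon>) x))"
        by (rule cSUP_upper[OF x bdd[OF elim(2)]])
      finally have "0 \<le> (SUP x\<in>K. norm (mderiv \<alpha> (f \<epsilon>) x))" .
      moreover have "(SUP x\<in>K. norm (mderiv \<alpha> (f \<epsilon>) x)) \<le> C * \<epsilon> powr a"
        using elim(1) by (intro cSUP_least K(2)) blast
      ultimately show ?case by simp
    qed
  qed
qed

lemma negligible_nets_iff:
  "f \<in> negligible_nets \<omega> \<longleftrightarrow> f \<in> smooth_nets \<omega> \<and>
     (\<forall>K \<alpha>. compact K \<and> K \<subseteq> \<omega> \<longrightarrow> negligible_on (\<lambda>\<epsilon>. mderiv \<alpha> (f \<epsilon>)) K)"
proof -
  have "(\<forall>a. sup_growth f K \<alpha> a) \<longleftrightarrow> negligible_on (\<lambda>\<epsilon>. mderiv \<alpha> (f \<epsilon>)) K"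
    if f: "f \<in> smooth_nets \<omega>" and K: "compact K" "K \<noteq> {}" "K \<subseteq> \<omega>" for K \<alpha>
  proof
    assume "\<forall>a. sup_growth f K \<alpha> a"
    then show "negligible_on (\<lambda>\<epsilon>. mderiv \<alpha> (f \<epsilon>)) K"
      unfolding sup_growth_iff[OF f K] by (intro negligible_onI) simp
  next
    assume neg: "negligible_on (\<lambda>\<epsilon>. mderiv \<alpha> (f \<epsilon>)) K"
    show "\<forall>a. sup_growth f K \<alpha> a"
    proof
      fix a
      show "sup_growth f K \<alpha> a"
        unfolding sup_growth_iff[OF f K] using negligible_onD[OF neg, of a]
        by (intro exI[of _ 1]) simp
    qed
  qed
  moreover have "negligible_on (\<lambda>\<epsilon>. mderiv \<alpha> (f \<epsilon>)) {}" for \<alpha>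
    by (simp add: negligible_on_def)
  ultimately have eq: "f \<in> smooth_nets \<omega> \<Longrightarrow> (compact K \<and> K \<noteq> {} \<and> K \<subseteq> \<omega> \<longrightarrow> (\<forall>a. sup_growth f K \<alpha> a)) \<longleftrightarrow>
      (compact K \<and> K \<subseteq> \<omega> \<longrightarrow> negligible_on (\<lambda>\<epsilon>. mderiv \<alpha> (f \<epsilon>)) K)" for K \<alpha>
    by (cases "K = {}") simp_all
  show ?thesis
  proof (cases "f \<in> smooth_nets \<omega>")
    case True
    show ?thesis by (simp only: negligible_nets_def mem_Collect_eq eq[OF True])
  qed (simp add: negligible_nets_def)
qed

lemma moderate_smooth: "f \<in> moderate \<omega> \<Longrightarrow> f \<in> smooth_nets \<omega>"
  by (simp add: moderate_def)

lemma moderate_imp_moderate_on: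
  assumes f: "f \<in> moderate \<omega>" and K: "compact K" "K \<subseteq> \<omega>"
  shows "moderate_on (\<lambda>\<epsilon>. mderiv \<alpha> (f \<epsilon>)) K"
proof (cases "K = {}")
  case True
  then show ?thesis by (simp add: moderate_on_def)
next
  case False
  then obtain a where "sup_growth f K \<alpha> a" using f K unfolding moderate_def by blast
  then obtain C where "\<forall>\<^sub>F \<epsilon> in at_right 0. \<forall>x\<in>K. norm (mderiv \<alpha> (f \<epsilon>) x) \<le> C * \<epsilon> powr a"
    unfolding sup_growth_iff[OF moderate_smooth[OF f] K(1) False K(2)] by blast
  then show ?thesis by (rule moderate_onI)
qed

text \<open>Induction on the order of the derivative by Landau's inequality, whose second derivative
  is controlled by moderateness.\<close>

lemma negligible_nets_if_negligible_on:
  fixes f :: "'a::euclidean_space net"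
  assumes \<omega>: "open \<omega>" and f: "f \<in> moderate \<omega>"
    and neg: "\<And>K. compact K \<Longrightarrow> K \<subseteq> \<omega> \<Longrightarrow> negligible_on f K"
  shows "f \<in> negligible_nets \<omega>"
proof -
  have sm: "smooth_on \<omega> (f \<epsilon>)" if "\<epsilon> \<in> {0<..<1}" for \<epsilon>
    using moderate_smooth[OF f] that by (simp add: smooth_nets_def)
  have "\<forall>K. compact K \<and> K \<subseteq> \<omega> \<longrightarrow> negligible_on (\<lambda>\<epsilon>. mderiv \<alpha> (f \<epsilon>)) K" if "mi_length \<alpha> = n" for n \<alpha>
    using that
  proof (induction n arbitrary: \<alpha>)
    case 0
    then have "\<alpha> b = 0" if "b \<in> Basis" for b using that by (simp add: mi_length_def)
    then have "mderiv \<alpha> F = mderiv (\<lambda>_. 0) F" for F :: "'a \<Rightarrow> complex"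
      unfolding mderiv_def by (intro foldr_cong) (simp_all add: set_basis_list)
    then show ?case using neg by (simp add: mderiv_0)
  next
    case (Suc n)
    have "(\<Sum>b\<in>Basis. \<alpha> b) \<noteq> 0" using Suc.prems by (simp add: mi_length_def)
    then have "\<exists>b\<in>Basis. \<alpha> b \<noteq> 0" by (meson sum.neutral)
    \<comment> \<open>The first basis vector in the list that \<alpha> really uses: in its direction
      a derivative can be split off, and one more added, without changing the order of
      differentiation.\<close>
    then obtain bs b bs' where b: "basis_list = bs @ b # bs'" "\<alpha> b \<noteq> 0" "\<forall>c\<in>set bs. \<alpha> c = 0"
      using split_list_first_prop[of "basis_list :: 'a list" "\<lambda>b. \<alpha> b \<noteq> 0"] by (auto simp: set_basis_list)
    have bB: "b \<in> Basis" using set_basis_list b(1) by (metis in_set_conv_decomp)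
    define \<beta> where "\<beta> = \<alpha>(b := \<alpha> b - 1)"
    have \<beta>: "\<alpha> = \<beta>(b := Suc (\<beta> b))" using b(2) by (auto simp: \<beta>_def)
    have 1: "mderiv \<alpha> F = partial b (mderiv \<beta> F)" for F
    proof -
      have "\<beta> c = 0" if "c \<in> set bs" for c using b(2,3) that by (auto simp: \<beta>_def)
      from mderiv_Suc[OF b(1), of \<beta> F, OF this] show ?thesis unfolding \<beta>[symmetric] .
    qed
    have 2: "mderiv (\<alpha>(b := Suc (\<alpha> b))) F = partial b (partial b (mderiv \<beta> F))" for F
      using mderiv_Suc[OF b(1), of \<alpha> F] b(3) by (simp add: 1)
    have "mi_length \<alpha> = mi_length \<beta> + 1"
    proof -
      have "mi_length \<alpha> = \<alpha> b + (\<Sum>c\<in>Basis - {b}. \<alpha> c)"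
        unfolding mi_length_def using bB by (subst sum.remove[of _ b]) auto
      moreover have "mi_length \<beta> = \<beta> b + (\<Sum>c\<in>Basis - {b}. \<beta> c)"
        unfolding mi_length_def using bB by (subst sum.remove[of _ b]) auto
      moreover have "(\<Sum>c\<in>Basis - {b}. \<beta> c) = (\<Sum>c\<in>Basis - {b}. \<alpha> c)"
        by (intro sum.cong) (auto simp: \<beta>_def)
      ultimately show ?thesis using b(2) by (simp add: \<beta>_def)
    qed
    then have "mi_length \<beta> = n" using Suc.prems by simp
    note IH = Suc.IH[OF this]
    obtain cs where cs: "set cs \<subseteq> (Basis :: 'a set)" "\<And>F. mderiv \<beta> F = foldr partial cs F"
      using mderiv_foldr[of \<beta>] by blast
    show ?case
    proof (intro allI impI)
      fix K assume K: "compact K \<and> K \<subseteq> \<omega>"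
      have "negligible_on (\<lambda>\<epsilon>. partial b (mderiv \<beta> (f \<epsilon>))) K"
      proof (rule negligible_on_partial[OF \<omega> _ _ bB])
        fix \<epsilon> :: real and x assume e: "\<epsilon> \<in> {0<..<1}" and x: "x \<in> \<omega>"
        show "mderiv \<beta> (f \<epsilon>) differentiable at x"
          unfolding cs(2) by (rule smooth_on_differentiable[OF sm[OF e] \<omega> cs(1) x])
        show "partial b (mderiv \<beta> (f \<epsilon>)) differentiable at x"
          using smooth_on_differentiable[OF sm[OF e] \<omega> _ x, of "b # cs"] cs bB by simp
      next
        fix K assume "compact K" "K \<subseteq> \<omega>"
        then show "negligible_on (\<lambda>\<epsilon>. mderiv \<beta> (f \<epsilon>)) K" using IH by blast
      next
        fix K assume "compact K" "K \<subseteq> \<omega>"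
        from moderate_imp_moderate_on[OF f this, of "\<alpha>(b := Suc (\<alpha> b))"]
        show "moderate_on (\<lambda>\<epsilon>. partial b (partial b (mderiv \<beta> (f \<epsilon>)))) K" by (simp only: 2)
      qed (use K in auto)
      then show "negligible_on (\<lambda>\<epsilon>. mderiv \<alpha> (f \<epsilon>)) K" by (simp only: 1)
    qed
  qed
  then show ?thesis using moderate_smooth[OF f] by (auto simp: negligible_nets_iff)
qed

section \<open>Differences of nets and equality of classes\<close>

text \<open>The difference formula is available on \<omega> only, and a partial derivative looks at
  neighbouring points; openness together with differentiability carries it to the next order. Hence
  both are proved in one induction.\<close>

lemma foldr_partial_diff:
  fixes F G :: "'a::euclidean_space \<Rightarrow> complex"
  assumes \<omega>: "open \<omega>" and F: "smooth_on \<omega> F" and G: "smooth_on \<omega> G" and bs: "set bs \<subseteq> Basis"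
  shows "\<forall>x\<in>\<omega>. foldr partial bs (\<lambda>x. F x - G x) x = foldr partial bs F x - foldr partial bs G x \<and>
    foldr partial bs (\<lambda>x. F x - G x) differentiable (at x)"
  using bs
proof (induction bs)
  case Nil
  then show ?case
    using smooth_on_differentiable[OF F \<omega>, of "[]"] smooth_on_differentiable[OF G \<omega>, of "[]"]
    by (auto intro: differentiable_diff)
next
  case (Cons b bs)
  define H where "H = foldr partial bs (\<lambda>x. F x - G x)"
  have eq: "partial b H x = partial b (foldr partial bs F) x - partial b (foldr partial bs G) x"
    if x: "x \<in> \<omega>" for x
  proof -
    obtain D1 D2 where D: "(foldr partial bs F has_derivative D1) (at x)" "(foldr partial bs G has_derivative D2) (at x)"
      using smooth_on_differentiable[OF F \<omega> _ x, of bs] smooth_on_differentiable[OF G \<omega> _ x, of bs] Cons.prems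
      by (auto simp: differentiable_def)
    have "(H has_derivative (\<lambda>v. D1 v - D2 v)) (at x)"
      by (rule has_derivative_transform_within_open[OF has_derivative_diff[OF D] \<omega> x])
         (use Cons in \<open>simp add: H_def\<close>)
    from has_derivative_imp_partial[OF this, of b] show ?thesis
      by (simp add: has_derivative_imp_partial[OF D(1)] has_derivative_imp_partial[OF D(2)])
  qed
  have "partial b H differentiable (at x)" if x: "x \<in> \<omega>" for x
  proof -
    have "foldr partial (b # bs) F differentiable (at x)" "foldr partial (b # bs) G differentiable (at x)"
      using smooth_on_differentiable[OF F \<omega> Cons.prems x] smooth_on_differentiable[OF G \<omega> Cons.prems x] .
    then obtain D where "((\<lambda>x. foldr partial (b # bs) F x - foldr partial (b # bs) G x) has_derivative D) (at x)"
      using differentiable_diff unfolding differentiable_def by blast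
    then have "(partial b H has_derivative D) (at x)"
      by (rule has_derivative_transform_within_open[OF _ \<omega> x]) (simp add: eq)
    then show ?thesis unfolding differentiable_def by blast
  qed
  then show ?case using eq by (simp add: H_def)
qed

lemma smooth_on_diff:
  assumes "open \<omega>" "smooth_on \<omega> F" "smooth_on \<omega> G"
  shows "smooth_on \<omega> (\<lambda>x. F x - G x)"
  unfolding smooth_on_def differentiable_on_def
  using foldr_partial_diff[OF assms] by (blast intro: differentiable_at_withinI)

lemma negligible_nets_diff:
  fixes f g :: "'a::euclidean_space net"
  assumes \<omega>: "open \<omega>" and f: "f \<in> negligible_nets \<omega>" and g: "g \<in> negligible_nets \<omega>"
  shows "(\<lambda>\<epsilon> x. f \<epsilon> x - g \<epsilon> x) \<in> negligible_nets \<omega>"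
proof -
  have fs: "smooth_on \<omega> (f \<epsilon>)" and gs: "smooth_on \<omega> (g \<epsilon>)" if "\<epsilon> \<in> {0<..<1}" for \<epsilon>
    using f g that by (simp_all add: negligible_nets_iff smooth_nets_def)
  have "negligible_on (\<lambda>\<epsilon>. mderiv \<alpha> (\<lambda>x. f \<epsilon> x - g \<epsilon> x)) K" if K: "compact K" "K \<subseteq> \<omega>" for K \<alpha>
  proof -
    obtain bs where bs: "set bs \<subseteq> (Basis :: 'a set)" "\<And>F. mderiv \<alpha> F = foldr partial bs F"
      using mderiv_foldr[of \<alpha>] by blast
    have "negligible_on (\<lambda>\<epsilon> x. mderiv \<alpha> (f \<epsilon>) x - mderiv \<alpha> (g \<epsilon>) x) K"
      using f g K by (intro negligible_on_diff) (simp_all add: negligible_nets_iff)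
    note neg = negligible_onD[OF this]
    show ?thesis
      unfolding negligible_on_def
    proof
      fix a
      show "\<forall>\<^sub>F \<epsilon> in at_right 0. \<forall>x\<in>K. norm (mderiv \<alpha> (\<lambda>x. f \<epsilon> x - g \<epsilon> x) x) \<le> \<epsilon> powr a"
        using neg[of a] eventually_at_right_0_unit
      proof eventually_elim
        case (elim \<epsilon>)
        have "mderiv \<alpha> (\<lambda>x. f \<epsilon> x - g \<epsilon> x) x = mderiv \<alpha> (f \<epsilon>) x - mderiv \<alpha> (g \<epsilon>) x" if "x \<in> K" for x
          using foldr_partial_diff[OF \<omega> fs[OF elim(2)] gs[OF elim(2)] bs(1)] that K(2) unfolding bs(2) by blast
        then show ?case using elim(1) by simp
      qed
    qed
  qed
  then show ?thesis
    using smooth_on_diff[OF \<omega> fs gs] by (simp add: negligible_nets_iff smooth_nets_def)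
qed

lemma foldr_partial_zero: "foldr partial bs (\<lambda>_. 0) = (\<lambda>_. 0)"
  by (induction bs) (auto simp: partial_def)

lemma zero_negligible: "(\<lambda>_ _. 0) \<in> negligible_nets \<omega>"
proof -
  have "mderiv \<alpha> (\<lambda>_. 0) = (\<lambda>_. 0)" for \<alpha> :: "'a \<Rightarrow> nat"
    by (simp only: mderiv_eq_foldr foldr_partial_zero)
  then show ?thesis
    by (simp add: negligible_nets_iff smooth_nets_def smooth_on_def foldr_partial_zero negligible_on_def)
qed

lemma negligible_imp_moderate: "f \<in> negligible_nets \<omega> \<Longrightarrow> f \<in> moderate \<omega>"
  by (auto simp: negligible_nets_def moderate_def)

text \<open>As g belongs to its own class, it belongs to that of f, which forces f to be moderate as
  well. This matters for the net of d-bar derivatives, whose moderateness is not known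
  beforehand.\<close>

lemma gfun_eqD:
  assumes "gfun \<omega> f = gfun \<omega> g" "g \<in> moderate \<omega>"
  shows "(\<lambda>\<epsilon> x. f \<epsilon> x - g \<epsilon> x) \<in> negligible_nets \<omega>"
proof -
  have "g \<in> gfun \<omega> g" using assms(2) zero_negligible by (simp add: gfun_def colombeau_rel_def)
  then have "g \<in> gfun \<omega> f" by (simp only: assms(1))
  then show ?thesis by (simp add: gfun_def colombeau_rel_def)
qed

lemma gfun_eq_zero:
  fixes f :: "'a::euclidean_space net"
  assumes \<omega>: "open \<omega>" and f: "f \<in> negligible_nets \<omega>"
  shows "gfun \<omega> f = gfun \<omega> (\<lambda>_ _. 0)"
proof -
  have eq: "(\<lambda>\<epsilon> x. f \<epsilon> x - g \<epsilon> x) \<in> negligible_nets \<omega> \<longleftrightarrow> (\<lambda>\<epsilon> x. 0 - g \<epsilon> x) \<in> negligible_nets \<omega>" for g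
  proof
    assume "(\<lambda>\<epsilon> x. f \<epsilon> x - g \<epsilon> x) \<in> negligible_nets \<omega>"
    from negligible_nets_diff[OF \<omega> this f] show "(\<lambda>\<epsilon> x. 0 - g \<epsilon> x) \<in> negligible_nets \<omega>" by simp
  next
    assume "(\<lambda>\<epsilon> x. 0 - g \<epsilon> x) \<in> negligible_nets \<omega>"
    from negligible_nets_diff[OF \<omega> this negligible_nets_diff[OF \<omega> zero_negligible f]]
    show "(\<lambda>\<epsilon> x. f \<epsilon> x - g \<epsilon> x) \<in> negligible_nets \<omega>" by simp
  qed
  have fm: "f \<in> moderate \<omega>" and zm: "(\<lambda>_ _. 0) \<in> moderate \<omega>"
    using negligible_imp_moderate[OF f] negligible_imp_moderate[OF zero_negligible] .
  show ?thesis
    by (simp only: gfun_def colombeau_rel_def Image_singleton mem_Collect_eq case_prod_conv fm zm eq)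
qed

lemma negligible_nets_uniformly:
  assumes "f \<in> negligible_nets \<omega>" "compact K" "K \<subseteq> \<omega>"
  shows "negligible_on f K"
proof -
  have "negligible_on (\<lambda>\<epsilon>. mderiv (\<lambda>_. 0) (f \<epsilon>)) K"
    using assms by (simp only: negligible_nets_iff)
  then show ?thesis by (simp only: mderiv_0)
qed

lemma gvalue_zeroD:
  assumes "gvalue f x = gcomplex (\<lambda>_. 0)"
  shows "(\<lambda>\<epsilon>. f \<epsilon> x) \<in> negligible_numbers"
proof -
  have 0: "(\<lambda>_. 0) \<in> negligible_numbers" by (simp add: negligible_numbers_def)
  then have "(\<lambda>_. 0) \<in> moderate_numbers" by (auto simp: negligible_numbers_def moderate_numbers_def)
  then have "(\<lambda>_. 0) \<in> gcomplex (\<lambda>_. 0)" using 0 by (simp add: gcomplex_def gcomplex_rel_def)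
  then have "(\<lambda>_. 0) \<in> gcomplex (\<lambda>\<epsilon>. f \<epsilon> x)" using assms by (simp add: gvalue_def)
  then show ?thesis by (simp add: gcomplex_def gcomplex_rel_def)
qed

text \<open>The definitions of holomorphic and analytic classes speak of some representative f', not
  of the given f. Negligibility found for f' is carried over on compact sets, and moderateness of f
  then takes care of the derivatives.\<close>

lemma gfun_eq_zero_locally:
  fixes f f' :: "'a::euclidean_space net"
  assumes \<omega>: "open \<omega>" and f: "f \<in> moderate \<omega>"
    and ff': "(\<lambda>\<epsilon> x. f \<epsilon> x - f' \<epsilon> x) \<in> negligible_nets \<omega>"
    and loc: "\<And>x. x \<in> \<omega> \<Longrightarrow> \<exists>r>0. negligible_on f' (ball x r)"
  shows "gfun \<omega> f = gfun \<omega> (\<lambda>_ _. 0)"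
proof (rule gfun_eq_zero[OF \<omega> negligible_nets_if_negligible_on[OF \<omega> f]])
  fix K assume K: "compact K" "K \<subseteq> \<omega>"
  have "negligible_on f' K"
    by (rule negligible_on_compact[OF _ K(1)]) (use loc K(2) in blast)
  moreover have "negligible_on (\<lambda>\<epsilon> x. f' \<epsilon> x - f \<epsilon> x) K"
    using negligible_nets_uniformly[OF ff' K] by (simp add: negligible_on_def norm_minus_commute)
  ultimately have "negligible_on (\<lambda>\<epsilon> x. f' \<epsilon> x - (f' \<epsilon> x - f \<epsilon> x)) K"
    by (rule negligible_on_diff)
  then show "negligible_on f K" by simp
qed

lemma negligible_numbers_diff:
  assumes "c \<in> negligible_numbers" "d \<in> negligible_numbers"
  shows "(\<lambda>\<epsilon>. c \<epsilon> - d \<epsilon>) \<in> negligible_numbers"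
proof -
  have "(\<lambda>\<epsilon>. norm (c \<epsilon> - d \<epsilon>)) \<in> O[at_right 0](\<lambda>\<epsilon>. \<epsilon> powr a)" for a
  proof -
    have "c \<in> O[at_right 0](\<lambda>\<epsilon>. of_real (\<epsilon> powr a))" "d \<in> O[at_right 0](\<lambda>\<epsilon>. of_real (\<epsilon> powr a))"
      using assms by (simp_all add: negligible_numbers_def bigo_def)
    from sum_in_bigo(2)[OF this] show ?thesis by (simp add: bigo_def)
  qed
  then show ?thesis by (simp add: negligible_numbers_def)
qed

subsection \<open>Product curves\<close>

text \<open>Near \<open>t0\<close> the velocity differs from its value at \<open>t0\<close> by less
  than half of its length c, so the curve is a line traversed with speed c up to an error that is
  Lipschitz with constant c/2. It is thus injective there with a lower Lipschitz bound, even if it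
  crosses itself elsewhere.\<close>

lemma smooth_curve_local:
  assumes \<gamma>: "smooth_curve J \<gamma>" and t0: "t0 \<in> J" and \<rho>: "0 < \<rho>"
  shows "\<exists>\<delta>>0. \<exists>\<kappa>>0. \<exists>C>0. \<forall>s\<in>J \<inter> {t0 - \<delta><..<t0 + \<delta>}. dist (\<gamma> t0) (\<gamma> s) \<le> \<rho> \<and>
    norm (vector_derivative \<gamma> (at s)) \<le> C \<and>
    (\<forall>u\<in>J \<inter> {t0 - \<delta><..<t0 + \<delta>}. \<kappa> * \<bar>s - u\<bar> \<le> dist (\<gamma> s) (\<gamma> u))"
proof -
  have J: "is_interval J" and nz: "vector_derivative \<gamma> (at t0) \<noteq> 0"
    using \<gamma> t0 by (auto simp: smooth_curve_def)
  obtain D where D: "\<And>x. x \<in> J \<Longrightarrow> (\<gamma> has_vector_derivative D x) (at x)" and cD: "continuous_on J D"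
    using \<gamma> by (auto simp: smooth_curve_def C1_differentiable_on_def)
  have vD: "vector_derivative \<gamma> (at x) = D x" if "x \<in> J" for x
    by (rule vector_derivative_at[OF D[OF that]])
  define c where "c = norm (D t0)"
  have c: "0 < c" using nz vD[OF t0] by (simp add: c_def)
  obtain \<delta>1 where \<delta>1: "0 < \<delta>1" "\<And>s. s \<in> J \<Longrightarrow> dist s t0 < \<delta>1 \<Longrightarrow> dist (D s) (D t0) < c / 2"
    using cD t0 half_gt_zero[OF c] unfolding continuous_on_iff by blast
  have "continuous_on J \<gamma>"
    using has_vector_derivative_continuous[OF D] continuous_at_imp_continuous_on by blast
  then obtain \<delta>2 where \<delta>2: "0 < \<delta>2" "\<And>s. s \<in> J \<Longrightarrow> dist s t0 < \<delta>2 \<Longrightarrow> dist (\<gamma> s) (\<gamma> t0) < \<rho>"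
    using t0 \<rho> unfolding continuous_on_iff by blast
  define \<delta> where "\<delta> = min \<delta>1 \<delta>2"
  define T where "T = J \<inter> {t0 - \<delta><..<t0 + \<delta>}"
  have near: "s \<in> J" "dist s t0 < \<delta>1" "dist s t0 < \<delta>2" if "s \<in> T" for s
    using that by (auto simp: T_def \<delta>_def dist_real_def)
  have ivl: "t \<in> T" if "s \<in> T" "u \<in> T" "s \<le> t" "t \<le> u" for s t u
  proof -
    have "t \<in> J" using J that unfolding is_interval_1 T_def by blast
    then show ?thesis using that by (auto simp: T_def)
  qed
  have lower: "c / 2 * \<bar>s - u\<bar> \<le> dist (\<gamma> s) (\<gamma> u)" if su: "s \<in> T" "u \<in> T" "s < u" for s u
  proof -
    \<comment> \<open>The deviation from the tangent motion; its derivative is at most c/2 in norm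
      on the neighbourhood.\<close>
    define \<psi> where "\<psi> = (\<lambda>t. \<gamma> t - t *\<^sub>R D t0)"
    have d: "(\<psi> has_vector_derivative D t - D t0) (at t)" if "t \<in> T" for t
    proof -
      have "((\<lambda>t. t *\<^sub>R D t0) has_vector_derivative D t0) (at t)"
        by (auto intro!: derivative_eq_intros)
      then show ?thesis unfolding \<psi>_def by (rule has_vector_derivative_diff[OF D[OF near(1)[OF that]]])
    qed
    have cont: "continuous_on {s..u} \<psi>"
    proof (rule continuous_at_imp_continuous_on, rule ballI)
      fix t assume "t \<in> {s..u}"
      then have "t \<in> T" by (intro ivl[OF su(1,2)]) simp_all
      then show "isCont \<psi> t" by (intro has_vector_derivative_continuous[OF d])
    qed
    have "\<exists>t\<in>{s<..<u}. norm (\<psi> u - \<psi> s) \<le> norm ((u - s) *\<^sub>R (D t - D t0))"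
    proof (rule mvt_general[OF su(3) cont])
      fix t assume "s < t" "t < u"
      then have "t \<in> T" by (intro ivl[OF su(1,2)]) simp_all
      from d[OF this] show "(\<psi> has_derivative (\<lambda>x. x *\<^sub>R (D t - D t0))) (at t)"
        by (simp add: has_vector_derivative_def)
    qed
    then obtain t where t: "t \<in> {s<..<u}" "norm (\<psi> u - \<psi> s) \<le> (u - s) * dist (D t) (D t0)"
      using su(3) by (auto simp: dist_norm)
    have "t \<in> T" using t(1) by (intro ivl[OF su(1,2)]) simp_all
    then have "dist (D t) (D t0) \<le> c / 2" using \<delta>1(2)[of t] near[of t] by simp
    then have "(u - s) * dist (D t) (D t0) \<le> (u - s) * (c / 2)" using su(3) by (intro mult_left_mono) auto
    with t(2) have 1: "norm (\<psi> u - \<psi> s) \<le> (u - s) * (c / 2)" by linarith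
    have "(u - s) *\<^sub>R D t0 = (\<gamma> u - \<gamma> s) - (\<psi> u - \<psi> s)" by (simp add: \<psi>_def algebra_simps)
    then have "norm ((u - s) *\<^sub>R D t0) \<le> norm (\<gamma> u - \<gamma> s) + norm (\<psi> u - \<psi> s)"
      by (metis norm_triangle_ineq4)
    then have "(u - s) * c \<le> dist (\<gamma> s) (\<gamma> u) + (u - s) * (c / 2)"
      using 1 su(3) by (simp add: c_def dist_norm norm_minus_commute)
    then show ?thesis using su(3) by (simp add: abs_if field_simps)
  qed
  have "dist (\<gamma> t0) (\<gamma> s) \<le> \<rho> \<and> norm (vector_derivative \<gamma> (at s)) \<le> 2 * c \<and>
      (\<forall>u\<in>T. c / 2 * \<bar>s - u\<bar> \<le> dist (\<gamma> s) (\<gamma> u))" if s: "s \<in> T" for s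
  proof (intro conjI ballI)
    show "dist (\<gamma> t0) (\<gamma> s) \<le> \<rho>" using \<delta>2(2)[of s] near[OF s] by (simp add: dist_commute)
    have "norm (D s) \<le> norm (D t0) + dist (D s) (D t0)"
      using norm_triangle_sub[of "D s" "D t0"] by (simp add: dist_norm)
    moreover have "dist (D s) (D t0) < c / 2" using \<delta>1(2)[of s] near[OF s] by simp
    ultimately have "norm (D s) \<le> 2 * c" unfolding c_def[symmetric] using c by linarith
    then show "norm (vector_derivative \<gamma> (at s)) \<le> 2 * c" using vD near(1)[OF s] by simp
    show "c / 2 * \<bar>s - u\<bar> \<le> dist (\<gamma> s) (\<gamma> u)" if u: "u \<in> T" for u
    proof (cases s u rule: linorder_cases)
      case less
      then show ?thesis using lower[OF s u] by simp
    next
      case greater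
      then show ?thesis using lower[OF u s] by (simp add: dist_commute abs_minus_commute)
    qed simp
  qed
  then show ?thesis
    unfolding T_def using c \<delta>1(1) \<delta>2(1)
    by (intro exI[of _ \<delta>] exI[of _ "c / 2"] exI[of _ "2 * c"] conjI) (auto simp: \<delta>_def)
qed

context
  fixes J :: "real set" and \<gamma> :: "real \<Rightarrow> complex"
  assumes \<gamma>: "smooth_curve J \<gamma>"
begin

lemma smooth_curve_borel: "J \<in> sets borel"
  using \<gamma> by (auto simp: smooth_curve_def intro: real_interval_borel_measurable)

lemma smooth_curve_continuous_on: "continuous_on J \<gamma>"
  using \<gamma> has_vector_derivative_continuous continuous_at_imp_continuous_on
  unfolding smooth_curve_def C1_differentiable_on_def by meson

lemma smooth_curve_speed_measurable:
  "(\<lambda>t. ennreal (norm (vector_derivative \<gamma> (at t)))) \<in> borel_measurable (restrict_space lborel J)"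
proof -
  obtain D where D: "\<And>x. x \<in> J \<Longrightarrow> (\<gamma> has_vector_derivative D x) (at x)" "continuous_on J D"
    using \<gamma> by (auto simp: smooth_curve_def C1_differentiable_on_def)
  have "continuous_on J (\<lambda>t. vector_derivative \<gamma> (at t))"
    using D(2) by (rule continuous_on_eq) (simp add: vector_derivative_at[OF D(1)])
  then have "(\<lambda>t. vector_derivative \<gamma> (at t)) \<in> borel_measurable (restrict_space borel J)"
    by (rule borel_measurable_continuous_on_restrict)
  then have "(\<lambda>t. vector_derivative \<gamma> (at t)) \<in> borel_measurable (restrict_space lborel J)"
    by (simp cong: measurable_cong_sets add: sets_restrict_space)
  then show ?thesis by measurable
qed

lemma sets_arc_length: "sets (arc_length J \<gamma>) = sets (restrict_space borel J)"
  by (simp add: arc_length_def sets_restrict_space)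

lemma space_arc_length: "space (arc_length J \<gamma>) = J"
  by (simp add: arc_length_def space_restrict_space)

lemma sets_arc_length_iff: "B \<in> sets (arc_length J \<gamma>) \<longleftrightarrow> B \<subseteq> J \<and> B \<in> sets borel"
  using smooth_curve_borel by (simp add: sets_arc_length sets_restrict_space_iff)

text \<open>Lebesgue measure on J is sigma-finite and the density is finite everywhere. This is what
  gives access to Fubini's theorem in the parameters.\<close>

lemma sigma_finite_arc_length: "sigma_finite_measure (arc_length J \<gamma>)"
proof -
  have "sigma_finite_measure (restrict_space lborel J)"
    using smooth_curve_borel by (intro sigma_finite_measure_restrict_space sigma_finite_lborel) simp
  then show ?thesis
    unfolding arc_length_def
    by (subst sigma_finite_measure.sigma_finite_iff_density_finite[OF _ smooth_curve_speed_measurable]) auto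
qed

text \<open>Turns a lower bound on arc length into one on parameter length, where separated points
  are found.\<close>

lemma emeasure_arc_length_le:
  assumes B: "B \<in> sets (arc_length J \<gamma>)" and C: "\<And>s. s \<in> B \<Longrightarrow> norm (vector_derivative \<gamma> (at s)) \<le> C"
  shows "emeasure (arc_length J \<gamma>) B \<le> ennreal C * emeasure lborel B"
proof -
  have Bs: "B \<subseteq> J" using B by (simp add: sets_arc_length_iff)
  have BJ: "B \<in> sets (restrict_space lborel J)" using B by (simp add: arc_length_def)
  have "emeasure (arc_length J \<gamma>) B =
      (\<integral>\<^sup>+ t. ennreal (norm (vector_derivative \<gamma> (at t))) * indicator B t \<partial>restrict_space lborel J)"
    unfolding arc_length_def using smooth_curve_speed_measurable BJ by (rule emeasure_density)
  also have "\<dots> \<le> (\<integral>\<^sup>+ t. ennreal C * indicator B t \<partial>restrict_space lborel J)"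
    by (intro nn_integral_mono) (auto simp: indicator_def C ennreal_leI)
  also have "\<dots> = ennreal C * emeasure (restrict_space lborel J) B"
    using BJ by (rule nn_integral_cmult_indicator)
  also have "emeasure (restrict_space lborel J) B = emeasure lborel B"
    using smooth_curve_borel Bs by (intro emeasure_restrict_space) simp_all
  finally show ?thesis .
qed

end

lemma product_curve_param_measurable:
  fixes \<gamma> :: "'p::finite \<Rightarrow> real \<Rightarrow> complex"
  assumes \<gamma>: "\<And>i. smooth_curve (J i) (\<gamma> i)"
  shows "(\<lambda>t. \<chi> i. \<gamma> i (t i)) \<in> measurable (PiM UNIV (\<lambda>i. arc_length (J i) (\<gamma> i))) borel"
    (is "_ \<in> measurable ?P borel")
proof (rule borel_measurable_euclidean_space[THEN iffD2], rule ballI)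
  fix b :: "complex^'p" assume "b \<in> Basis"
  then obtain i u where b: "b = axis i u" by (rule Basis_complex_cartE)
  have "\<gamma> i \<in> borel_measurable (restrict_space borel (J i))"
    by (rule borel_measurable_continuous_on_restrict[OF smooth_curve_continuous_on[OF \<gamma>]])
  then have [measurable]: "\<gamma> i \<in> borel_measurable (arc_length (J i) (\<gamma> i))"
    using sets_arc_length[OF \<gamma>] by (simp cong: measurable_cong_sets)
  have [measurable]: "(\<lambda>t. t i) \<in> measurable ?P (arc_length (J i) (\<gamma> i))"
    by (rule measurable_component_singleton) simp
  have "(\<lambda>t. \<gamma> i (t i) \<bullet> u) \<in> borel_measurable ?P"
    by measurable
  then show "(\<lambda>t. (\<chi> i. \<gamma> i (t i)) \<bullet> b) \<in> borel_measurable ?P"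
    by (simp add: b inner_axis)
qed

text \<open>For finitely many factors the product of the Borel sigma-algebras is the Borel
  sigma-algebra of the function space. Open neighbourhoods of parameters thus become available for
  the choice of a support point.\<close>

lemma open_Int_sets_PiM_arc_length:
  fixes \<gamma> :: "'p::finite \<Rightarrow> real \<Rightarrow> complex" and U :: "('p \<Rightarrow> real) set"
  assumes \<gamma>: "\<And>i. smooth_curve (J i) (\<gamma> i)" and U: "open U"
    and S: "S \<in> sets (PiM UNIV (\<lambda>i. arc_length (J i) (\<gamma> i)))"
  shows "S \<inter> U \<in> sets (PiM UNIV (\<lambda>i. arc_length (J i) (\<gamma> i)))" (is "_ \<in> sets ?P")
proof -
  have "(\<lambda>t. t) \<in> measurable ?P (PiM UNIV (\<lambda>_. borel))"
  proof (rule measurable_PiM_single')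
    fix i
    have "(\<lambda>s. s) \<in> measurable (arc_length (J i) (\<gamma> i)) borel"
      using sets_arc_length[OF \<gamma>] by (simp cong: measurable_cong_sets add: measurable_restrict_space1)
    then show "(\<lambda>t. t i) \<in> measurable ?P borel"
      by (rule measurable_compose[OF measurable_component_singleton, rotated]) simp
  qed (simp add: space_PiM)
  then have "(\<lambda>t. t) -` U \<inter> space ?P \<in> sets ?P"
    by (rule measurable_sets) (simp add: sets_PiM_equal_borel U)
  then have "S \<inter> (U \<inter> space ?P) \<in> sets ?P" using S by auto
  moreover have "S \<inter> (U \<inter> space ?P) = S \<inter> U" using sets.sets_into_space[OF S] by auto
  ultimately show ?thesis by simp
qed

text \<open>Although the product of curves has only half the real dimension, freeing one complex
  coordinate after another fills a full polydisc. Each release uses that many parameters on one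
  short arc give well separated points in the disc of that coordinate.\<close>

lemma negligible_on_near_curves:
  fixes f :: "(complex^'p::finite) net" and \<gamma> :: "'p \<Rightarrow> real \<Rightarrow> complex"
  assumes \<Omega>: "open \<Omega>" and f: "f \<in> smooth_nets \<Omega>"
    and moderate: "\<And>K. compact K \<Longrightarrow> K \<subseteq> \<Omega> \<Longrightarrow> moderate_on f K"
    and dbar: "\<And>K i. compact K \<Longrightarrow> K \<subseteq> \<Omega> \<Longrightarrow> negligible_on (\<lambda>\<epsilon>. dbar i (f \<epsilon>)) K"
    and \<gamma>: "\<And>i. smooth_curve (J i) (\<gamma> i)" and curves: "product_curve J \<gamma> \<subseteq> \<Omega>"
    and S: "S \<in> sets (product_length J \<gamma>)" "0 < emeasure (product_length J \<gamma>) S"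
    and neg: "\<And>x. x \<in> S \<Longrightarrow> (\<lambda>\<epsilon>. f \<epsilon> x) \<in> negligible_numbers"
  shows "\<exists>x\<in>\<Omega>. \<exists>r>0. negligible_on f (ball x r)"
proof -
  define M where "M = (\<lambda>i. arc_length (J i) (\<gamma> i))"
  define P where "P = PiM UNIV M"
  define \<Phi> :: "('p \<Rightarrow> real) \<Rightarrow> complex^'p" where "\<Phi> = (\<lambda>t. \<chi> i. \<gamma> i (t i))"
  interpret product_sigma_finite M
    unfolding M_def by (rule product_sigma_finite.intro) (rule sigma_finite_arc_length[OF \<gamma>])
  have \<Phi>: "\<Phi> \<in> measurable P borel"
    unfolding \<Phi>_def P_def M_def by (rule product_curve_param_measurable[OF \<gamma>])
  have \<Phi>_nth: "\<Phi> t $ i = \<gamma> i (t i)" for t i by (simp add: \<Phi>_def)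
  have space_P: "t i \<in> J i" if "t \<in> space P" for t i
    using that space_arc_length[OF \<gamma>] by (auto simp: P_def M_def space_PiM)
  have \<Phi>\<Omega>: "\<Phi> t \<in> \<Omega>" if "t \<in> space P" for t
    using space_P[OF that] curves by (auto simp: product_curve_def \<Phi>_nth)
  \<comment> \<open>S is measurable for the completed measure only; its main part is Borel with the
    same measure and can be pulled back to the parameters.\<close>
  define B where "B = main_part (distr P borel \<Phi>) S"
  have pl: "product_length J \<gamma> = completion (distr P borel \<Phi>)"
    by (simp add: product_length_def P_def M_def \<Phi>_def)
  have B: "B \<in> sets borel" "B \<subseteq> S" "0 < emeasure (distr P borel \<Phi>) B"
  proof -
    have S': "S \<in> sets (completion (distr P borel \<Phi>))" using S(1) by (simp only: pl)
    show "B \<in> sets borel" using main_part_sets[OF S'] unfolding B_def sets_distr .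
    show "B \<subseteq> S" using main_part_null_part_Un[OF S'] unfolding B_def by blast
    show "0 < emeasure (distr P borel \<Phi>) B"
      using S(2) unfolding pl emeasure_completion[OF S'] B_def .
  qed
  define T0 where "T0 = \<Phi> -` B \<inter> space P"
  have T0: "T0 \<in> sets P" unfolding T0_def by (rule measurable_sets[OF \<Phi> B(1)])
  have T0_pos: "0 < emeasure P T0" using B(3) unfolding emeasure_distr[OF \<Phi> B(1)] T0_def .
  have opP: "T \<inter> U \<in> sets P" if "T \<in> sets P" "open U" for T U
    unfolding P_def M_def
    by (rule open_Int_sets_PiM_arc_length[OF \<gamma> that(2) that(1)[unfolded P_def M_def]])
  obtain t0 where t0: "t0 \<in> T0" "\<forall>U. open U \<and> t0 \<in> U \<longrightarrow> 0 < emeasure P (T0 \<inter> U)"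
    using exists_support_point[OF T0 T0_pos opP[OF T0]] by blast
  have t0P: "t0 \<in> space P" using t0(1) by (simp add: T0_def)
  define c where "c = \<Phi> t0"
  have c\<Omega>: "c \<in> \<Omega>" unfolding c_def by (rule \<Phi>\<Omega>[OF t0P])
  obtain e where e: "0 < e" "cball c e \<subseteq> \<Omega>" using \<Omega> c\<Omega> by (auto simp: open_contains_cball)
  define R where "R = e / real CARD('p)"
  have R: "0 < R" using e by (simp add: R_def)
  have pd: "polydisc c R \<subseteq> \<Omega>"
    using polydisc_subset_cball[of c R] e by (auto simp: R_def)
  define \<rho> where "\<rho> = R / 11"
  have \<rho>: "0 < \<rho>" "10 * \<rho> < R" using R by (auto simp: \<rho>_def)
  have "\<forall>i. \<exists>\<delta>>0. \<exists>\<kappa>>0. \<exists>C>0. \<forall>s\<in>J i \<inter> {t0 i - \<delta><..<t0 i + \<delta>}. dist (\<gamma> i (t0 i)) (\<gamma> i s) \<le> \<rho> \<and>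
    norm (vector_derivative (\<gamma> i) (at s)) \<le> C \<and>
    (\<forall>u\<in>J i \<inter> {t0 i - \<delta><..<t0 i + \<delta>}. \<kappa> * \<bar>s - u\<bar> \<le> dist (\<gamma> i s) (\<gamma> i u))"
    using smooth_curve_local[OF \<gamma> space_P[OF t0P] \<rho>(1)] by blast
  then obtain \<delta> \<kappa> C where loc: "\<And>i. 0 < \<delta> i" "\<And>i. 0 < \<kappa> i" "\<And>i. 0 < C i"
    "\<And>i. \<forall>s\<in>J i \<inter> {t0 i - \<delta> i<..<t0 i + \<delta> i}. dist (\<gamma> i (t0 i)) (\<gamma> i s) \<le> \<rho> \<and>
    norm (vector_derivative (\<gamma> i) (at s)) \<le> C i \<and>
    (\<forall>u\<in>J i \<inter> {t0 i - \<delta> i<..<t0 i + \<delta> i}. \<kappa> i * \<bar>s - u\<bar> \<le> dist (\<gamma> i s) (\<gamma> i u))"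
    by metis
  define T where "T = (\<lambda>i. J i \<inter> {t0 i - \<delta> i<..<t0 i + \<delta> i})"
  have T_dist: "dist (\<gamma> i (t0 i)) (\<gamma> i s) \<le> \<rho>"
    and T_speed: "norm (vector_derivative (\<gamma> i) (at s)) \<le> C i"
    and T_sep: "u \<in> T i \<Longrightarrow> \<kappa> i * \<bar>s - u\<bar> \<le> dist (\<gamma> i s) (\<gamma> i u)" if "s \<in> T i" for i s u
    using loc(4)[of i] that unfolding T_def by blast+
  have T_sets: "T i \<in> sets (M i)" for i
    using smooth_curve_borel[OF \<gamma>[of i]] by (simp add: M_def sets_arc_length_iff[OF \<gamma>] T_def)
  have T_bounded: "bounded B" if "B \<subseteq> T i" for B i
    by (rule bounded_subset[of "{t0 i - \<delta> i..t0 i + \<delta> i}"]) (use that in \<open>auto simp: T_def\<close>)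
  have M_le: "emeasure (M i) B \<le> ennreal (C i) * emeasure lborel B" if "B \<in> sets (M i)" "B \<subseteq> T i" for B i
    using that T_speed unfolding M_def by (intro emeasure_arc_length_le[OF \<gamma>]) auto
  define U where "U = PiE UNIV (\<lambda>i. {t0 i - \<delta> i<..<t0 i + \<delta> i})"
  have "open U" unfolding U_def by (rule open_PiE) auto
  moreover have "t0 \<in> U" using loc(1) by (auto simp: U_def)
  ultimately have T1: "0 < emeasure P (T0 \<inter> U)" "T0 \<inter> U \<in> sets P"
    using t0(2) opP[OF T0] by auto
  have T1_sub: "T0 \<inter> U \<subseteq> PiE UNIV T"
    using space_P by (auto simp: T0_def U_def T_def PiE_def Pi_def)
  \<comment> \<open>The Egorov argument asks for finite measure; bounded parameter ranges and
    bounded speed provide it.\<close>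
  have "emeasure P (T0 \<inter> U) \<le> emeasure P (PiE UNIV T)"
    unfolding P_def by (rule emeasure_mono[OF T1_sub]) (intro sets_PiM_I_finite T_sets; simp)
  also have "\<dots> = (\<Prod>i\<in>UNIV. emeasure (M i) (T i))"
    unfolding P_def by (intro emeasure_PiM T_sets) simp
  also have "\<dots> < \<infinity>"
  proof -
    have fin: "emeasure (M i) (T i) < top" for i
      using M_le[OF T_sets order_refl, of i] emeasure_bounded_finite[OF T_bounded[OF order_refl, of i]]
      by (auto simp: less_top[symmetric] top_unique ennreal_mult_eq_top_iff)
    have "(\<Prod>i\<in>I. emeasure (M i) (T i)) < top" if "finite I" for I
      using that by induction (auto simp: fin ennreal_mult_less_top)
    then show ?thesis by simp
  qed
  finally have T1_fin: "emeasure P (T0 \<inter> U) < \<infinity>" .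
  have "\<exists>E\<in>sets P. E \<subseteq> T0 \<inter> U \<and> 0 < emeasure P E \<and> negligible_on f (\<Phi> ` E)"
  proof (rule exists_negligible_on_subset[OF \<Omega> _ \<Phi> T1(2,1) T1_fin])
    show "continuous_on \<Omega> (f \<epsilon>)" if "\<epsilon> \<in> {0<..<1}" for \<epsilon>
      using smooth_on_continuous_on[of \<Omega> "f \<epsilon>" "[]"] f that by (simp add: smooth_nets_def)
    show "\<Phi> ` (T0 \<inter> U) \<subseteq> \<Omega>" using \<Phi>\<Omega> by (auto simp: T0_def)
    show "(\<lambda>\<epsilon>. f \<epsilon> (\<Phi> t)) \<in> negligible_numbers" if "t \<in> T0 \<inter> U" for t
      using that B(2) by (intro neg) (auto simp: T0_def)
  qed
  then obtain E where E: "E \<in> sets P" "E \<subseteq> T0 \<inter> U" "0 < emeasure P E" "negligible_on f (\<Phi> ` E)"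
    by blast
  have in_disc: "\<gamma> i s \<in> cball (c $ i) \<rho>" if "s \<in> T i" for i s
    using T_dist[OF that] by (simp add: c_def \<Phi>_nth)
  have upd: "cart_upd z i (\<gamma> i s) \<in> polydisc c \<rho>" if "z \<in> polydisc c \<rho>" "s \<in> T i" for z i s
    using that(1) in_disc[OF that(2)] by (simp add: polydisc_def)
  have "negligible_on f (polydisc c \<rho>)"
  proof (rule coordinatewise_propagation[where I = UNIV and K = UNIV and E = E and T = T
        and agr = "\<lambda>i z s. z $ i = \<gamma> i s" and upd = "\<lambda>i z s. cart_upd z i (\<gamma> i s)"
        and U = "negligible_on f"])
    fix V W assume "negligible_on f V" "W \<subseteq> V"
    then show "negligible_on f W" by (rule negligible_on_subset)
  next
    fix i and b :: real and V assume b: "0 < b" and V: "V \<subseteq> polydisc c \<rho>" "negligible_on f V"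
    \<comment> \<open>Arc length b means parameter length at least b / C, hence parameters spread
      out with b / C / 2, and the lower Lipschitz bound of the curve contributes the factor
      \<open>\<kappa> i\<close>.\<close>
    define \<kappa>' where "\<kappa>' = \<kappa> i * (b / C i / 2)"
    have \<kappa>': "0 < \<kappa>'" using loc(2,3)[of i] b by (simp add: \<kappa>'_def)
    have claim: "spread_out \<kappa>' {\<zeta>\<in>cball (c $ i) \<rho>. cart_upd z i \<zeta> \<in> V}"
      if H: "H \<in> sets (M i)" "H \<subseteq> T i" "ennreal b \<le> emeasure (M i) H"
        "\<forall>s\<in>H. cart_upd z i (\<gamma> i s) \<in> V" for z H
    proof -
      have Hb: "H \<in> sets borel" using H(1) by (simp add: M_def sets_arc_length_iff[OF \<gamma>])
      have bH: "bounded H" by (rule T_bounded[OF H(2)])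
      have "ennreal b \<le> ennreal (C i) * emeasure lborel H"
        using H(3) M_le[OF H(1,2)] by (rule order_trans)
      also have "emeasure lborel H = ennreal (measure lborel H)"
        using emeasure_bounded_finite[OF bH] by (simp add: emeasure_eq_ennreal_measure less_top)
      finally have "b \<le> C i * measure lborel H"
        using loc(3)[of i] by (simp add: ennreal_mult[symmetric] less_imp_le)
      then have le: "b / C i \<le> measure lborel H" using loc(3)[of i] by (simp add: field_simps)
      have "0 < b / C i" using b loc(3)[of i] by simp
      from spread_out_positive_length[OF Hb bH this le] show ?thesis unfolding \<kappa>'_def
      proof (rule spread_out_image)
        show "0 \<le> \<kappa> i" using loc(2)[of i] by simp
        show "\<gamma> i s \<in> {\<zeta>\<in>cball (c $ i) \<rho>. cart_upd z i \<zeta> \<in> V}" if "s \<in> H" for s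
          using in_disc[OF subsetD[OF H(2) that]] H(4) that by blast
        show "\<kappa> i * dist s u \<le> dist (\<gamma> i s) (\<gamma> i u)" if "s \<in> H" "u \<in> H" for s u
          using T_sep[OF subsetD[OF H(2) that(1)] subsetD[OF H(2) that(2)]] by (simp add: dist_real_def)
      qed
    qed
    have "{z \<in> polydisc c \<rho>. \<exists>B\<in>sets (M i). B \<subseteq> T i \<and> ennreal b \<le> emeasure (M i) B \<and>
          (\<forall>s\<in>B. cart_upd z i (\<gamma> i s) \<in> V)}
      \<subseteq> {z \<in> polydisc c \<rho>. spread_out \<kappa>' {\<zeta>\<in>cball (c $ i) \<rho>. cart_upd z i \<zeta> \<in> V}}"
      using claim by blast
    then show "negligible_on f {z \<in> polydisc c \<rho>. \<exists>B\<in>sets (M i). B \<subseteq> T i \<and> ennreal b \<le> emeasure (M i) B \<and>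
          (\<forall>s\<in>B. cart_upd z i (\<gamma> i s) \<in> V)}"
      by (rule negligible_on_subset[OF holomorphic_coordinate_step[OF \<Omega> pd f \<rho> \<kappa>'
            moderate[OF compact_polydisc pd] dbar[OF compact_polydisc pd] V(2)]])
  next
    show "E \<in> sets (Pi\<^sub>M UNIV M)" using E(1) unfolding P_def .
  next
    show "0 < emeasure (Pi\<^sub>M UNIV M) E" using E(3) unfolding P_def .
  next
    show "E \<subseteq> PiE UNIV T" using E(2) T1_sub by (rule order_trans)
  next
    \<comment> \<open>The initial set, where every coordinate is prescribed by a parameter in E, is
      contained in the image of E.\<close>
    have "z = \<Phi> t" if "\<forall>i\<in>UNIV. z $ i = \<gamma> i (t i)" for z t
      using that by (simp add: vec_eq_iff \<Phi>_nth)
    then have "{z \<in> polydisc c \<rho>. \<exists>t\<in>E. \<forall>i\<in>UNIV. z $ i = \<gamma> i (t i)} \<subseteq> \<Phi> ` E" by blast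
    then show "negligible_on f {z \<in> polydisc c \<rho>. \<exists>t\<in>E. \<forall>i\<in>UNIV. z $ i = \<gamma> i (t i)}"
      by (rule negligible_on_subset[OF E(4)])
  qed (use upd in simp_all)
  moreover have "ball c \<rho> \<subseteq> polydisc c \<rho>"
  proof
    fix z assume "z \<in> ball c \<rho>"
    then have "dist (c $ i) (z $ i) \<le> \<rho>" for i using dist_vec_nth_le[of c i z] by simp
    then show "z \<in> polydisc c \<rho>" by (simp add: polydisc_def)
  qed
  ultimately have "negligible_on f (ball c \<rho>)" by (rule negligible_on_subset)
  then show ?thesis using c\<Omega> \<rho>(1) by blast
qed

subsection \<open>Uniqueness theorems\<close>

lemma negligible_on_imp_negligible_number:
  assumes "negligible_on f V" "x \<in> V"
  shows "(\<lambda>\<epsilon>. f \<epsilon> x) \<in> negligible_numbers"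
  unfolding negligible_numbers_def
proof (intro CollectI allI bigoI[where c = 1])
  fix a
  show "\<forall>\<^sub>F \<epsilon> in at_right 0. norm (norm (f \<epsilon> x)) \<le> 1 * norm (\<epsilon> powr a)"
    using negligible_onD[OF assms(1), of a] by eventually_elim (use assms(2) in auto)
qed

text \<open>Equal classes have equal point values, because a negligible net is in particular
  negligible on a single point.\<close>

lemma negligible_value:
  fixes f f' :: "'a::euclidean_space net"
  assumes "gvalue f x = gcomplex (\<lambda>_. 0)" "x \<in> \<omega>"
    and ff': "(\<lambda>\<epsilon> x. f \<epsilon> x - f' \<epsilon> x) \<in> negligible_nets \<omega>"
  shows "(\<lambda>\<epsilon>. f' \<epsilon> x) \<in> negligible_numbers"
proof -
  have "negligible_on (\<lambda>\<epsilon> x. f \<epsilon> x - f' \<epsilon> x) {x}"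
    using assms(2) by (intro negligible_nets_uniformly[OF ff']) auto
  then have "(\<lambda>\<epsilon>. f \<epsilon> x - f' \<epsilon> x) \<in> negligible_numbers"
    using negligible_on_imp_negligible_number by fastforce
  from negligible_numbers_diff[OF gvalue_zeroD[OF assms(1)] this] show ?thesis by simp
qed

lemma smooth_nets_continuous_on:
  "f \<in> smooth_nets \<omega> \<Longrightarrow> \<epsilon> \<in> {0<..<1} \<Longrightarrow> continuous_on \<omega> (f \<epsilon>)"
  using smooth_on_continuous_on[of \<omega> "f \<epsilon>" "[]"] by (simp add: smooth_nets_def)

lemma gen_holomorphicE:
  fixes f :: "(complex^'p::finite) net"
  assumes \<Omega>: "open \<Omega>" and f: "gfun \<Omega> f \<in> gen_holomorphic \<Omega>"
  obtains f' where "f' \<in> smooth_nets \<Omega>"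
    "(\<lambda>\<epsilon> x. f \<epsilon> x - f' \<epsilon> x) \<in> negligible_nets \<Omega>"
    "\<And>K. compact K \<Longrightarrow> K \<subseteq> \<Omega> \<Longrightarrow> moderate_on f' K"
    "\<And>K i. compact K \<Longrightarrow> K \<subseteq> \<Omega> \<Longrightarrow> negligible_on (\<lambda>\<epsilon>. dbar i (f' \<epsilon>)) K"
proof -
  obtain f' where f': "f' \<in> moderate \<Omega>" "gfun \<Omega> f = gfun \<Omega> f'"
    "\<And>i. gfun \<Omega> (\<lambda>\<epsilon>. dbar i (f' \<epsilon>)) = gfun \<Omega> (\<lambda>\<epsilon> x. 0)"
    using f by (auto simp: gen_holomorphic_def)
  show ?thesis
  proof (rule that[of f'])
    show "f' \<in> smooth_nets \<Omega>" by (rule moderate_smooth[OF f'(1)])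
    show "(\<lambda>\<epsilon> x. f \<epsilon> x - f' \<epsilon> x) \<in> negligible_nets \<Omega>" by (rule gfun_eqD[OF f'(2,1)])
    fix K assume K: "compact K" "K \<subseteq> \<Omega>"
    show "moderate_on f' K"
      using moderate_imp_moderate_on[OF f'(1) K, of "\<lambda>_. 0"] by (simp only: mderiv_0)
    have "(\<lambda>\<epsilon> x. dbar i (f' \<epsilon>) x - 0) \<in> negligible_nets \<Omega>" for i
      by (rule gfun_eqD[OF f'(3) negligible_imp_moderate[OF zero_negligible]])
    from negligible_nets_uniformly[OF this K]
    show "negligible_on (\<lambda>\<epsilon>. dbar i (f' \<epsilon>)) K" for i by simp
  qed
qed

lemma gen_analyticE:
  fixes f :: "'a::euclidean_space net"
  assumes f: "gfun \<omega> f \<in> gen_analytic \<omega>"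
  obtains f' where "f' \<in> smooth_nets \<omega>"
    "(\<lambda>\<epsilon> x. f \<epsilon> x - f' \<epsilon> x) \<in> negligible_nets \<omega>"
    "\<And>x. x \<in> \<omega> \<Longrightarrow> \<exists>r>0. cube x r \<subseteq> \<omega> \<and> propagates_in_cube f' x r"
proof -
  obtain f' where f': "f' \<in> moderate \<omega>" "gfun \<omega> f = gfun \<omega> f'"
    "\<And>x. x \<in> \<omega> \<Longrightarrow> gen_analytic_at \<omega> f' x"
    using f by (auto simp: gen_analytic_def)
  show ?thesis
  proof (rule that[of f'])
    show "f' \<in> smooth_nets \<omega>" by (rule moderate_smooth[OF f'(1)])
    show "(\<lambda>\<epsilon> x. f \<epsilon> x - f' \<epsilon> x) \<in> negligible_nets \<omega>" by (rule gfun_eqD[OF f'(2,1)])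
    fix x assume "x \<in> \<omega>"
    from f'(3)[OF this] obtain r g \<eta> a \<epsilon>0 where r: "0 < r" "ball x r \<subseteq> \<omega>"
      and g: "g \<in> moderate (ball x r)" "gfun (ball x r) f' = gfun (ball x r) g"
      and \<eta>: "0 < \<eta>" and \<epsilon>0: "\<epsilon>0 \<in> {0<..<1}"
      and bound: "\<forall>\<epsilon> \<alpha>. 0 < \<epsilon> \<and> \<epsilon> < \<epsilon>0 \<longrightarrow> (\<forall>y\<in>ball x r. norm (mderiv \<alpha> (g \<epsilon>) y)
              \<le> \<eta> ^ (mi_length \<alpha> + 1) * mi_fact \<alpha> * \<epsilon> powr (- a))"
      unfolding gen_analytic_at_def by (elim exE conjE bexE)
    have "\<exists>s>0. cube x s \<subseteq> ball x r \<and> propagates_in_cube f' x s"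
    proof (rule analytic_propagates[OF moderate_smooth[OF g(1)] r(1) \<eta>])
      show "0 < \<epsilon>0" using \<epsilon>0 by simp
      show "norm (mderiv \<alpha> (g \<epsilon>) y) \<le> \<eta> ^ (mi_length \<alpha> + 1) * mi_fact \<alpha> * \<epsilon> powr (- a)"
        if "0 < \<epsilon>" "\<epsilon> < \<epsilon>0" "y \<in> ball x r" for \<epsilon> \<alpha> y
        using bound that by blast
      show "negligible_on (\<lambda>\<epsilon> y. f' \<epsilon> y - g \<epsilon> y) K" if "compact K" "K \<subseteq> ball x r" for K
        by (rule negligible_nets_uniformly[OF gfun_eqD[OF g(2,1)] that])
    qed
    then show "\<exists>r>0. cube x r \<subseteq> \<omega> \<and> propagates_in_cube f' x r" using r(2) by blast
  qed
qed

text \<open>Each point has a cube made up of zeros, so the local principle already gives a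
  negligible neighbourhood of every point. What is gained is uniformity in the point and, through
  it, negligible derivatives.\<close>

lemma gen_holomorphic_zero_pointwise:
  fixes f :: "(complex^'p::finite) net"
  assumes \<Omega>: "open \<Omega>" and f: "f \<in> moderate \<Omega>" "gfun \<Omega> f \<in> gen_holomorphic \<Omega>"
    and zero: "\<And>x. x \<in> \<Omega> \<Longrightarrow> gvalue f x = gcomplex (\<lambda>_. 0)"
  shows "gfun \<Omega> f = gfun \<Omega> (\<lambda>_ _. 0)"
proof -
  obtain f' where f': "f' \<in> smooth_nets \<Omega>" "(\<lambda>\<epsilon> x. f \<epsilon> x - f' \<epsilon> x) \<in> negligible_nets \<Omega>"
    "\<And>K. compact K \<Longrightarrow> K \<subseteq> \<Omega> \<Longrightarrow> moderate_on f' K"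
    "\<And>K i. compact K \<Longrightarrow> K \<subseteq> \<Omega> \<Longrightarrow> negligible_on (\<lambda>\<epsilon>. dbar i (f' \<epsilon>)) K"
    using gen_holomorphicE[OF \<Omega> f(2)] by blast
  show ?thesis
  proof (rule gfun_eq_zero_locally[OF \<Omega> f(1) f'(2)])
    fix x assume "x \<in> \<Omega>"
    from holomorphic_propagates[OF \<Omega> f'(1,3,4) this]
    obtain r where r: "0 < r" "cube x r \<subseteq> \<Omega>" "propagates_in_cube f' x r" by blast
    have "0 < emeasure lborel (ball x r)" using r(1) by (intro emeasure_lborel_open_pos) auto
    also have "\<dots> \<le> emeasure lborel (UNIV \<inter> cube x r)"
      using ball_subset_cube[of x r] borel_compact[OF compact_cube[of x r]] by (intro emeasure_mono) auto
    finally have "negligible_on f' (cube x r)"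
      using r(2) by (intro negligible_on_cube[OF \<Omega> smooth_nets_continuous_on[OF f'(1)] r(2,3)]
          negligible_value[OF zero _ f'(2)]) auto
    then have "negligible_on f' (ball x r)" using ball_subset_cube by (rule negligible_on_subset)
    then show "\<exists>r>0. negligible_on f' (ball x r)" using r(1) by blast
  qed
qed

text \<open>The curves produce one ball on which the net is negligible; connectedness does the
  rest.\<close>

lemma gen_holomorphic_zero_on_curves:
  fixes f :: "(complex^'p::finite) net" and \<gamma> :: "'p \<Rightarrow> real \<Rightarrow> complex"
  assumes \<Omega>: "open \<Omega>" "connected \<Omega>" and f: "f \<in> moderate \<Omega>" "gfun \<Omega> f \<in> gen_holomorphic \<Omega>"
    and \<gamma>: "\<And>i. smooth_curve (J i) (\<gamma> i)" "product_curve J \<gamma> \<subseteq> \<Omega>"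
    and S: "S \<subseteq> product_curve J \<gamma>" "S \<in> sets (product_length J \<gamma>)" "0 < emeasure (product_length J \<gamma>) S"
    and zero: "\<And>x. x \<in> S \<Longrightarrow> gvalue f x = gcomplex (\<lambda>_. 0)"
  shows "gfun \<Omega> f = gfun \<Omega> (\<lambda>_ _. 0)"
proof -
  obtain f' where f': "f' \<in> smooth_nets \<Omega>" "(\<lambda>\<epsilon> x. f \<epsilon> x - f' \<epsilon> x) \<in> negligible_nets \<Omega>"
    "\<And>K. compact K \<Longrightarrow> K \<subseteq> \<Omega> \<Longrightarrow> moderate_on f' K"
    "\<And>K i. compact K \<Longrightarrow> K \<subseteq> \<Omega> \<Longrightarrow> negligible_on (\<lambda>\<epsilon>. dbar i (f' \<epsilon>)) K"
    using gen_holomorphicE[OF \<Omega>(1) f(2)] by blast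
  have "(\<lambda>\<epsilon>. f' \<epsilon> x) \<in> negligible_numbers" if "x \<in> S" for x
    using that S(1) \<gamma>(2) by (intro negligible_value[OF zero _ f'(2)]) auto
  from negligible_on_near_curves[OF \<Omega>(1) f'(1,3,4) \<gamma> S(2,3) this]
  obtain x0 r0 where x0: "x0 \<in> \<Omega>" "0 < r0" "negligible_on f' (ball x0 r0)" by blast
  show ?thesis
    by (rule gfun_eq_zero_locally[OF \<Omega>(1) f(1) f'(2)])
       (rule negligible_on_spread[OF \<Omega> holomorphic_propagates[OF \<Omega>(1) f'(1,3,4)] x0])
qed

lemma gfun_zero_on_positive_measure:
  fixes f f' :: "'a::euclidean_space net"
  assumes \<omega>: "open \<omega>" "connected \<omega>" and f: "f \<in> moderate \<omega>"
    and f': "f' \<in> smooth_nets \<omega>" "(\<lambda>\<epsilon> x. f \<epsilon> x - f' \<epsilon> x) \<in> negligible_nets \<omega>"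
    and propagates: "\<And>x. x \<in> \<omega> \<Longrightarrow> \<exists>r>0. cube x r \<subseteq> \<omega> \<and> propagates_in_cube f' x r"
    and A: "A \<subseteq> \<omega>" "A \<in> sets lebesgue" "0 < emeasure lebesgue A"
    and zero: "\<forall>x\<in>A. gvalue f x = gcomplex (\<lambda>_. 0)"
  shows "gfun \<omega> f = gfun \<omega> (\<lambda>_ _. 0)"
proof -
  have neg: "(\<lambda>\<epsilon>. f' \<epsilon> x) \<in> negligible_numbers" if "x \<in> A" for x
    using that A(1) by (intro negligible_value[OF bspec[OF zero] _ f'(2)]) auto
  show ?thesis
    by (rule gfun_eq_zero_locally[OF \<omega>(1) f f'(2)])
       (rule negligible_on_from_positive_measure[OF \<omega> smooth_nets_continuous_on[OF f'(1)] propagates A neg])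
qed

text \<open>Wherever zeros are prescribed on only a part of the open set, that set is taken to be
  connected: a function equal to 0 on one component and to 1 on another has zeros of positive
  measure without being zero.\<close>

theorem theorem3:
  shows
   "(\<forall>(\<Omega> :: (complex^'p::finite) set) f.
       CARD('p) > 1 \<and> open \<Omega> \<and> f \<in> moderate \<Omega> \<and> gfun \<Omega> f \<in> gen_holomorphic \<Omega> \<longrightarrow>
         ((\<forall>x\<in>\<Omega>. gvalue f x = gcomplex (\<lambda>_. 0)) \<longrightarrow> gfun \<Omega> f = gfun \<Omega> (\<lambda>_ _. 0))
       \<and> (\<forall>J \<gamma> S. connected \<Omega> \<and> (\<forall>i. smooth_curve (J i) (\<gamma> i))
             \<and> S \<subseteq> product_curve J \<gamma> \<and> product_curve J \<gamma> \<subseteq> \<Omega>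
             \<and> S \<in> sets (product_length J \<gamma>) \<and> emeasure (product_length J \<gamma>) S > 0
             \<and> (\<forall>x\<in>S. gvalue f x = gcomplex (\<lambda>_. 0))
             \<longrightarrow> gfun \<Omega> f = gfun \<Omega> (\<lambda>_ _. 0))
       \<and> (\<forall>A. connected \<Omega> \<and> A \<subseteq> \<Omega> \<and> A \<in> sets lebesgue \<and> emeasure lebesgue A > 0
             \<and> (\<forall>x\<in>A. gvalue f x = gcomplex (\<lambda>_. 0))
             \<longrightarrow> gfun \<Omega> f = gfun \<Omega> (\<lambda>_ _. 0)))
    \<and> (\<forall>(\<omega> :: (real^'d::finite) set) f.
       open \<omega> \<and> connected \<omega> \<and> f \<in> moderate \<omega> \<and> gfun \<omega> f \<in> gen_analytic \<omega> \<longrightarrow>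
         (\<forall>A. A \<subseteq> \<omega> \<and> A \<in> sets lebesgue \<and> emeasure lebesgue A > 0
             \<and> (\<forall>x\<in>A. gvalue f x = gcomplex (\<lambda>_. 0))
             \<longrightarrow> gfun \<omega> f = gfun \<omega> (\<lambda>_ _. 0)))"
proof (intro conjI allI impI; elim conjE)
  fix \<Omega> :: "(complex^'p) set" and f
  assume "open \<Omega>" "f \<in> moderate \<Omega>" "gfun \<Omega> f \<in> gen_holomorphic \<Omega>"
    and "\<forall>x\<in>\<Omega>. gvalue f x = gcomplex (\<lambda>_. 0)"
  then show "gfun \<Omega> f = gfun \<Omega> (\<lambda>_ _. 0)"
    by (intro gen_holomorphic_zero_pointwise) simp_all
next
  fix \<Omega> :: "(complex^'p) set" and f J \<gamma> S
  assume \<Omega>: "open \<Omega>" "connected \<Omega>" and f: "f \<in> moderate \<Omega>" "gfun \<Omega> f \<in> gen_holomorphic \<Omega>"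
    and \<gamma>: "\<forall>i. smooth_curve (J i) (\<gamma> i)" "product_curve J \<gamma> \<subseteq> \<Omega>"
    and S: "S \<subseteq> product_curve J \<gamma>" "S \<in> sets (product_length J \<gamma>)" "0 < emeasure (product_length J \<gamma>) S"
    and zero: "\<forall>x\<in>S. gvalue f x = gcomplex (\<lambda>_. 0)"
  show "gfun \<Omega> f = gfun \<Omega> (\<lambda>_ _. 0)"
    by (rule gen_holomorphic_zero_on_curves[OF \<Omega> f spec[OF \<gamma>(1)] \<gamma>(2) S bspec[OF zero]])
next
  fix \<Omega> :: "(complex^'p) set" and f A
  assume \<Omega>: "open \<Omega>" "connected \<Omega>" and f: "f \<in> moderate \<Omega>" "gfun \<Omega> f \<in> gen_holomorphic \<Omega>"
    and A: "A \<subseteq> \<Omega>" "A \<in> sets lebesgue" "0 < emeasure lebesgue A"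
    and zero: "\<forall>x\<in>A. gvalue f x = gcomplex (\<lambda>_. 0)"
  show "gfun \<Omega> f = gfun \<Omega> (\<lambda>_ _. 0)"
    by (rule gen_holomorphicE[OF \<Omega>(1) f(2)],
        rule gfun_zero_on_positive_measure[OF \<Omega> f(1) _ _ _ A zero]) (auto intro: holomorphic_propagates[OF \<Omega>(1)])
next
  fix \<omega> :: "(real^'d) set" and f A
  assume \<omega>: "open \<omega>" "connected \<omega>" and f: "f \<in> moderate \<omega>" "gfun \<omega> f \<in> gen_analytic \<omega>"
    and A: "A \<subseteq> \<omega>" "A \<in> sets lebesgue" "0 < emeasure lebesgue A"
    and zero: "\<forall>x\<in>A. gvalue f x = gcomplex (\<lambda>_. 0)"
  show "gfun \<omega> f = gfun \<omega> (\<lambda>_ _. 0)"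
    by (rule gen_analyticE[OF f(2)]) (rule gfun_zero_on_positive_measure[OF \<omega> f(1) _ _ _ A zero])
qed

end
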